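(* There exist absolute constants $c_0,c_1,C_1>0$ such that for all sufficiently large $n$ the following holds, where $X\sim N(\mathbf 0,I_n)$. (a) For any $1\le p\le c_0\log n$, $$c_1\frac{2^p}{p}\le n^{1-\frac2p}\,\mathrm{Var}\|X\|_p\le C_1\frac{2^p}{p}.$$ (b) If $p>c_0\log n$ (including $p=\infty$), then $\mathrm{Var}\|X\|_p\le\dfrac{C_1}{\log n}$. (c) If $p\ge(\log n)^2$ (including $p=\infty$), then also $\mathrm{Var}\|X\|_p\ge\dfrac{c_1}{\log n}$.
   Context: $\|x\|_p=(\sum_{i=1}^n|x_i|^p)^{1/p}$ for $1\le p<\infty$, $\|x\|_\infty=\max_i|x_i|$. "Absolute constant" means independent of $n$ and $p$. *)

theory Defs
  imports "HOL-Probability.Probability"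
begin

text \<open>Since the dimension $n$ tends to infinity inside the statement, a vector of $R^n$ is a
  function on the index set \<^term>\<open>{..<n}\<close>.\<close>

definition std_gaussian :: "nat \<Rightarrow> (nat \<Rightarrow> real) measure" where
  "std_gaussian n = (\<Pi>\<^sub>M i\<in>{..<n}. density lborel (\<lambda>x. ennreal (std_normal_density x)))"

lemma prob_space_std_gaussian: "prob_space (std_gaussian n)"
  unfolding std_gaussian_def by (intro prob_space_PiM prob_space_normal_density) simp

text \<open>The exponent ranges over \<^term>\<open>{1..\<infinity>::ereal}\<close>; the value at other exponents, and the
  maximum for \<^term>\<open>n = 0\<close>, carry no meaning.\<close>

definition lp_norm :: "nat \<Rightarrow> ereal \<Rightarrow> (nat \<Rightarrow> real) \<Rightarrow> real" where
  "lp_norm n p x =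
     (if p = \<infinity> then Max ((\<lambda>i. \<bar>x i\<bar>) ` {..<n})
      else (\<Sum>i<n. \<bar>x i\<bar> powr real_of_ereal p) powr (1 / real_of_ereal p))"

definition var_lp_norm :: "nat \<Rightarrow> ereal \<Rightarrow> real" where
  "var_lp_norm n p = prob_space.variance (std_gaussian n) (lp_norm n p)"

end

theory Submission
  imports Defs "HOL-Real_Asymp.Real_Asymp"
begin

text \<open>The Efron--Stein inequality, with one coordinate replaced by \<open>0\<close>, gives the upper
  bound for large exponents. Removing the coordinate \<open>i\<close> lowers \<open>\<parallel>x\<parallel>\<^sub>p\<close> by at most the excess of
  \<open>\<bar>x\<^sub>i\<bar>\<close> over the maximum \<open>M\<close> of the other coordinates plus a term of order \<open>\<parallel>x\<parallel>\<^sub>p / p\<close> times the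
  share of \<open>\<bar>x\<^sub>i\<bar>\<^sup>p\<close> in the power sum. The squared shares sum to at most one, and the squared excess
  has conditional expectation at most \<open>16 / M\<^sup>2\<close> times the probability that \<open>i\<close> is the maximizer;
  both contributions are of order \<open>1 / ln n\<close>. For \<open>p \<ge> (ln n)\<^sup>2\<close> the norm and the maximum agree
  up to a factor \<open>exp (1 / ln n)\<close>, so the lower bound follows from two values at distance of order
  \<open>1 / sqrt (ln n)\<close> which the maximum passes with constant probability.

  For small exponents the power sum concentrates. The upper bound linearizes the root around the
  mean of the power sum, its lower tail being controlled by a Laplace transform. The lower bound is
  the Cauchy--Schwarz inequality for the covariance of the norm with a sum of centered functions of
  the single coordinates, supported where the moment of order \<open>2 * p\<close> of a Gaussian is attained.\<close>

section \<open>Tensorization of the variance\<close>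

text \<open>The factor \<open>2 powr p / p\<close> comes from two moment asymptotics. Let
  \<open>\<sigma>\<close> and \<open>v\<close> be the absolute Gaussian moments of order
  \<open>p\<close> and \<open>2 * p\<close>. Linearizing the root predicts a variance of order
  \<open>(n * \<sigma>) powr (2 / p) / p\<^sup>2 * (v / (n * \<sigma>\<^sup>2))\<close>, where
  \<open>v / \<sigma>\<^sup>2\<close> has order \<open>2 powr p\<close> and
  \<open>\<sigma> powr (2 / p)\<close> has order \<open>p\<close>. Chebyshev's inequality for the
  lower tail of the power sum would contribute \<open>v / (n * \<sigma>\<^sup>2)\<close> without the
  factor \<open>1 / p\<^sup>2\<close>; this loss is what forces an exponential bound there. The
  threshold constant \<open>1 / 4\<close> serves both regimes. Below it
  \<open>exp (2 * p) \<le> sqrt (real n)\<close>, so a single coordinate of the size that carries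
  the moment of order \<open>2 * p\<close> does not dominate the power sum; above it
  \<open>real n powr (2 / p)\<close> is at most \<open>exp 8\<close>. The exponent
  \<open>(ln n)\<^sup>2\<close> in the last claim is natural because the maximum has order
  \<open>sqrt (ln n)\<close>: a relative error \<open>1 / ln n\<close> is then an absolute error
  \<open>1 / sqrt (ln n)\<close>, the size of the fluctuations themselves.\<close>

lemma tensorization_nn:
  fixes f :: "'a \<times> 'b \<Rightarrow> real"
  assumes "prob_space A" "prob_space B"
  assumes f[measurable]: "f \<in> borel_measurable (A \<Otimes>\<^sub>M B)"
  shows "(\<integral>\<^sup>+x. \<integral>\<^sup>+x'. \<integral>\<^sup>+y. \<integral>\<^sup>+y'. ennreal ((f (x, y) - f (x', y'))\<^sup>2) \<partial>B \<partial>B \<partial>A \<partial>A)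
    \<le> (\<integral>\<^sup>+x. \<integral>\<^sup>+x'. \<integral>\<^sup>+y. ennreal ((f (x, y) - f (x', y))\<^sup>2) \<partial>B \<partial>A \<partial>A)
      + (\<integral>\<^sup>+x. \<integral>\<^sup>+y. \<integral>\<^sup>+y'. ennreal ((f (x, y) - f (x, y'))\<^sup>2) \<partial>B \<partial>B \<partial>A)"
proof -
  interpret A: prob_space A by fact
  interpret B: prob_space B by fact
  interpret BB: pair_sigma_finite B B ..
  let ?D = "\<integral>\<^sup>+x. \<integral>\<^sup>+x'. \<integral>\<^sup>+y. \<integral>\<^sup>+y'. ennreal ((f (x, y) - f (x', y'))\<^sup>2) \<partial>B \<partial>B \<partial>A \<partial>A"
  let ?P = "\<integral>\<^sup>+x. \<integral>\<^sup>+x'. \<integral>\<^sup>+y. ennreal ((f (x, y) - f (x', y))\<^sup>2) \<partial>B \<partial>A \<partial>A"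
  let ?Q = "\<integral>\<^sup>+x. \<integral>\<^sup>+y. \<integral>\<^sup>+y'. ennreal ((f (x, y) - f (x, y'))\<^sup>2) \<partial>B \<partial>B \<partial>A"
  \<comment> \<open>The values of \<open>f\<close> at \<open>(x, y)\<close>, \<open>(x', y)\<close>,
    \<open>(x', y')\<close>, \<open>(x, y')\<close> form a quadrilateral, whose squared diagonals
    sum to at most its squared sides. The joint difference is a diagonal, the one-coordinate
    differences are sides.\<close>
  have quad: "(a - c)\<^sup>2 + (b - d)\<^sup>2 \<le> ((a - b)\<^sup>2 + (d - c)\<^sup>2) + ((b - c)\<^sup>2 + (a - d)\<^sup>2)" for a b c d :: real
  proof -
    have "0 \<le> (a - b + c - d)\<^sup>2" by simp
    also have "\<dots> = ((a - b)\<^sup>2 + (d - c)\<^sup>2) + ((b - c)\<^sup>2 + (a - d)\<^sup>2) - ((a - c)\<^sup>2 + (b - d)\<^sup>2)"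
      by (simp add: power2_eq_square algebra_simps)
    finally show ?thesis by simp
  qed
  \<comment> \<open>Exchanging \<open>y\<close> and \<open>y'\<close> yields the other diagonal, so
    that twice the left side is an integral of both diagonals.\<close>
  have swap: "?D = (\<integral>\<^sup>+x. \<integral>\<^sup>+x'. \<integral>\<^sup>+y. \<integral>\<^sup>+y'. ennreal ((f (x', y) - f (x, y'))\<^sup>2) \<partial>B \<partial>B \<partial>A \<partial>A)"
    by (rule nn_integral_cong, rule nn_integral_cong, subst BB.Fubini') (auto simp: power2_commute)
  have "?D + ?D = (\<integral>\<^sup>+x. \<integral>\<^sup>+x'. \<integral>\<^sup>+y. \<integral>\<^sup>+y'. ennreal ((f (x, y) - f (x', y'))\<^sup>2)
      + ennreal ((f (x', y) - f (x, y'))\<^sup>2) \<partial>B \<partial>B \<partial>A \<partial>A)"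
    apply (subst (2) swap) by (simp add: nn_integral_add cong: nn_integral_cong_simp)
  also have "\<dots> \<le> (\<integral>\<^sup>+x. \<integral>\<^sup>+x'. \<integral>\<^sup>+y. \<integral>\<^sup>+y'. (ennreal ((f (x, y) - f (x', y))\<^sup>2)
      + ennreal ((f (x, y') - f (x', y'))\<^sup>2)) + (ennreal ((f (x', y) - f (x', y'))\<^sup>2)
      + ennreal ((f (x, y) - f (x, y'))\<^sup>2)) \<partial>B \<partial>B \<partial>A \<partial>A)"
    by (intro nn_integral_mono) (auto simp: ennreal_plus[symmetric] simp del: ennreal_plus intro!: ennreal_leI quad)
  also have "\<dots> = (?P + ?P) + (?Q + ?Q)"
    by (simp add: nn_integral_add cong: nn_integral_cong_simp add: A.emeasure_space_1 B.emeasure_space_1)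
  finally have "?D + ?D \<le> (?P + ?Q) + (?P + ?Q)" by (simp add: ac_simps)
  then have "2 * ?D \<le> 2 * (?P + ?Q)" by (simp only: mult_2)
  then show ?thesis by (subst (asm) ennreal_mult_le_mult_iff) auto
qed


section \<open>Resampling one coordinate and the Efron-Stein inequality\<close>

context prob_space
begin

abbreviation pow :: "'i set \<Rightarrow> ('i \<Rightarrow> 'a) measure" where
  "pow I \<equiv> PiM I (\<lambda>_. M)"

lemma prob_space_pow: "prob_space (pow I)"
  by (intro prob_space_PiM prob_space_axioms)

lemma product_prob_space_pow: "product_prob_space (\<lambda>_. M)"
  by unfold_locales

lemma measurable_upd [measurable (raw)]:
  assumes "i \<in> I" "f \<in> N \<rightarrow>\<^sub>M pow I" "g \<in> N \<rightarrow>\<^sub>M M"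
  shows "(\<lambda>x. (f x)(i := g x)) \<in> N \<rightarrow>\<^sub>M pow I"
proof -
  have "insert i I = I" "I = I \<union> {i}" using assms(1) by auto
  then show ?thesis using assms(2,3) by (intro measurable_fun_upd)
qed

text \<open>Overwriting one coordinate by a fresh draw preserves the product measure, since the old
  value of that coordinate integrates out to mass one.\<close>

lemma nn_integral_pow_upd:
  assumes "finite I" "i \<in> I" and [measurable]: "h \<in> borel_measurable (pow I)"
  shows "(\<integral>\<^sup>+x. \<integral>\<^sup>+t. h (x(i := t)) \<partial>M \<partial>pow I) = (\<integral>\<^sup>+x. h x \<partial>pow I)"
proof -
  interpret P: product_prob_space "\<lambda>_. M" by (rule product_prob_space_pow)
  have I: "I = insert i (I - {i})" using assms(2) by auto
  have ins: "(\<integral>\<^sup>+x. g x \<partial>pow I) = (\<integral>\<^sup>+x. \<integral>\<^sup>+y. g (x(i := y)) \<partial>M \<partial>pow (I - {i}))"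
    if "g \<in> borel_measurable (pow I)" for g :: "_ \<Rightarrow> ennreal"
    using that assms(1) by (subst I, subst P.product_nn_integral_insert) (auto simp: insert_absorb assms(2))
  have "i \<in> I" by fact
  then have [measurable]: "(\<lambda>x. \<integral>\<^sup>+t. h (x(i := t)) \<partial>M) \<in> borel_measurable (pow I)" by measurable
  show ?thesis by (subst (1 2) ins) (auto simp: emeasure_space_1)
qed

lemma distr_pow_upd:
  assumes "finite I" and i[measurable]: "i \<in> I"
  shows "distr (pow I \<Otimes>\<^sub>M M) (pow I) (\<lambda>(x, t). x(i := t)) = pow I"
proof (rule measure_eqI)
  interpret I: prob_space "pow I" by (rule prob_space_pow)
  fix A assume "A \<in> sets (distr (pow I \<Otimes>\<^sub>M M) (pow I) (\<lambda>(x, t). x(i := t)))"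
  then have [measurable]: "A \<in> sets (pow I)" by simp
  have "emeasure (distr (pow I \<Otimes>\<^sub>M M) (pow I) (\<lambda>(x, t). x(i := t))) A
      = (\<integral>\<^sup>+z. indicator A ((\<lambda>(x, t). x(i := t)) z) \<partial>(pow I \<Otimes>\<^sub>M M))"
    by (subst nn_integral_indicator[symmetric], simp, subst nn_integral_distr) auto
  also have "\<dots> = (\<integral>\<^sup>+x. \<integral>\<^sup>+t. indicator A (x(i := t)) \<partial>M \<partial>pow I)"
    by (subst nn_integral_fst[symmetric]) auto
  also have "\<dots> = emeasure (pow I) A"
    by (subst nn_integral_pow_upd) (auto simp: assms)
  finally show "emeasure (distr (pow I \<Otimes>\<^sub>M M) (pow I) (\<lambda>(x, t). x(i := t))) A = emeasure (pow I) A" .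
qed simp

lemma
  fixes h :: "('i \<Rightarrow> 'a) \<Rightarrow> real"
  assumes I: "finite I" "i \<in> I" and h: "integrable (pow I) h"
  shows integral_pow_upd: "(\<integral>x. (\<integral>t. h (x(i := t)) \<partial>M) \<partial>pow I) = (\<integral>x. h x \<partial>pow I)"
    and integrable_pow_upd: "integrable (pow I) (\<lambda>x. \<integral>t. h (x(i := t)) \<partial>M)"
proof -
  interpret I: prob_space "pow I" by (rule prob_space_pow)
  interpret IM: pair_sigma_finite "pow I" M ..
  have [measurable]: "h \<in> borel_measurable (pow I)" using h by auto
  note [measurable] = I(2)
  have m: "(\<lambda>(x, t). x(i := t)) \<in> (pow I \<Otimes>\<^sub>M M) \<rightarrow>\<^sub>M pow I" by measurable
  have int: "integrable (pow I \<Otimes>\<^sub>M M) (\<lambda>(x, t). h (x(i := t)))"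
    using integrable_distr[OF m, of h] h unfolding distr_pow_upd[OF I] by (simp add: split_def)
  show "(\<integral>x. (\<integral>t. h (x(i := t)) \<partial>M) \<partial>pow I) = (\<integral>x. h x \<partial>pow I)"
    using IM.integral_fst'[OF int] integral_distr[OF m, of h]
    unfolding distr_pow_upd[OF I] by (simp add: split_def)
  show "integrable (pow I) (\<lambda>x. \<integral>t. h (x(i := t)) \<partial>M)"
    using IM.integrable_fst'[OF int] by simp
qed

text \<open>The variance written with an independent copy satisfies a coordinatewise bound for every
  measurable function, because no subtraction of integrals occurs.\<close>

lemma pow_tensorization:
  fixes f :: "('i \<Rightarrow> 'a) \<Rightarrow> real"
  assumes "finite I" and "f \<in> borel_measurable (pow I)"
  shows "(\<integral>\<^sup>+x. \<integral>\<^sup>+x'. ennreal ((f x - f x')\<^sup>2) \<partial>pow I \<partial>pow I)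
    \<le> (\<Sum>i\<in>I. \<integral>\<^sup>+x. \<integral>\<^sup>+t. ennreal ((f x - f (x(i := t)))\<^sup>2) \<partial>M \<partial>pow I)"
  using assms
proof (induction I arbitrary: f rule: finite_induct)
  case empty
  then show ?case by (simp add: PiM_empty nn_integral_count_space_finite)
next
  case (insert i I)
  interpret P: product_prob_space "\<lambda>_. M" by (rule product_prob_space_pow)
  interpret I: prob_space "pow I" by (rule prob_space_pow)
  interpret II: prob_space "pow (insert i I)" by (rule prob_space_pow)
  interpret IM: pair_sigma_finite "pow I" M ..
  note [measurable] = insert.prems
  have ins: "(\<integral>\<^sup>+x. g x \<partial>pow (insert i I)) = (\<integral>\<^sup>+x. \<integral>\<^sup>+y. g (x(i := y)) \<partial>M \<partial>pow I)"
    if "g \<in> borel_measurable (pow (insert i I))" for g :: "_ \<Rightarrow> ennreal"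
    using that insert.hyps by (subst P.product_nn_integral_insert) auto
  have mT: "(\<lambda>x. \<integral>\<^sup>+t. ennreal ((f x - f (x(j := t)))\<^sup>2) \<partial>M) \<in> borel_measurable (pow (insert i I))"
    if [measurable]: "j \<in> insert i I" for j by measurable
  have [measurable]: "(\<lambda>(x, y). x(i := y)) \<in> (pow I \<Otimes>\<^sub>M M) \<rightarrow>\<^sub>M pow (insert i I)"
    by (rule measurable_add_dim)
  have [measurable]: "(\<lambda>z. (p z)(i := q z)) \<in> N \<rightarrow>\<^sub>M pow (insert i I)"
    if "p \<in> N \<rightarrow>\<^sub>M pow I" "q \<in> N \<rightarrow>\<^sub>M M" for p q and N :: "'z measure"
    using that by (intro measurable_fun_upd[where J = I]) auto
  have [measurable]: "j \<in> I \<Longrightarrow> j \<in> insert i I" for j by simp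
  have ne: "i \<noteq> j" if "j \<in> I" for j using that insert.hyps by auto
  define F where "F = (\<lambda>(x, y). f (x(i := y)))"
  have F[measurable]: "F \<in> borel_measurable (pow I \<Otimes>\<^sub>M M)" unfolding F_def by measurable
  let ?T = "\<lambda>j. \<integral>\<^sup>+x. \<integral>\<^sup>+t. ennreal ((f x - f (x(j := t)))\<^sup>2) \<partial>M \<partial>pow (insert i I)"
  have Q: "(\<integral>\<^sup>+x. \<integral>\<^sup>+y. \<integral>\<^sup>+y'. ennreal ((F (x, y) - F (x, y'))\<^sup>2) \<partial>M \<partial>M \<partial>pow I) = ?T i"
    unfolding F_def by (subst ins, rule mT) auto
  have "(\<integral>\<^sup>+x. \<integral>\<^sup>+x'. \<integral>\<^sup>+y. ennreal ((F (x, y) - F (x', y))\<^sup>2) \<partial>M \<partial>pow I \<partial>pow I)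
      = (\<integral>\<^sup>+y. \<integral>\<^sup>+x. \<integral>\<^sup>+x'. ennreal ((F (x, y) - F (x', y))\<^sup>2) \<partial>pow I \<partial>pow I \<partial>M)"
  proof -
    have "(\<integral>\<^sup>+x. \<integral>\<^sup>+x'. \<integral>\<^sup>+y. ennreal ((F (x, y) - F (x', y))\<^sup>2) \<partial>M \<partial>pow I \<partial>pow I)
      = (\<integral>\<^sup>+x. \<integral>\<^sup>+y. \<integral>\<^sup>+x'. ennreal ((F (x, y) - F (x', y))\<^sup>2) \<partial>pow I \<partial>M \<partial>pow I)"
      by (rule nn_integral_cong, subst IM.Fubini'[symmetric]) auto
    then show ?thesis by (subst IM.Fubini') auto
  qed
  \<comment> \<open>With \<open>y\<close> outermost, the section of \<open>F\<close> at
    \<open>y\<close> is a function on the smaller product, and the induction hypothesis applies to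
    it.\<close>
  also have "\<dots> \<le> (\<integral>\<^sup>+y. (\<Sum>j\<in>I. \<integral>\<^sup>+x. \<integral>\<^sup>+t. ennreal ((F (x, y) - F (x(j := t), y))\<^sup>2) \<partial>M \<partial>pow I) \<partial>M)"
    by (intro nn_integral_mono insert.IH) measurable
  also have "\<dots> = (\<Sum>j\<in>I. \<integral>\<^sup>+y. \<integral>\<^sup>+x. \<integral>\<^sup>+t. ennreal ((F (x, y) - F (x(j := t), y))\<^sup>2) \<partial>M \<partial>pow I \<partial>M)"
    by (intro nn_integral_sum) measurable
  also have "\<dots> = (\<Sum>j\<in>I. ?T j)"
  proof (rule sum.cong[OF refl])
    fix j assume j[measurable]: "j \<in> I"
    have "(\<integral>\<^sup>+y. \<integral>\<^sup>+x. \<integral>\<^sup>+t. ennreal ((F (x, y) - F (x(j := t), y))\<^sup>2) \<partial>M \<partial>pow I \<partial>M)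
       = (\<integral>\<^sup>+x. \<integral>\<^sup>+y. \<integral>\<^sup>+t. ennreal ((F (x, y) - F (x(j := t), y))\<^sup>2) \<partial>M \<partial>M \<partial>pow I)"
      by (subst IM.Fubini'[symmetric]) measurable
    also have "\<dots> = ?T j"
      unfolding F_def by (subst ins, rule mT) (use j ne[OF j] in \<open>auto simp: fun_upd_twist\<close>)
    finally show "(\<integral>\<^sup>+y. \<integral>\<^sup>+x. \<integral>\<^sup>+t. ennreal ((F (x, y) - F (x(j := t), y))\<^sup>2) \<partial>M \<partial>pow I \<partial>M) = ?T j" .
  qed
  finally have P: "(\<integral>\<^sup>+x. \<integral>\<^sup>+x'. \<integral>\<^sup>+y. ennreal ((F (x, y) - F (x', y))\<^sup>2) \<partial>M \<partial>pow I \<partial>pow I)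
      \<le> (\<Sum>j\<in>I. ?T j)" .
  have "(\<integral>\<^sup>+x. \<integral>\<^sup>+x'. ennreal ((f x - f x')\<^sup>2) \<partial>pow (insert i I) \<partial>pow (insert i I))
      = (\<integral>\<^sup>+x. \<integral>\<^sup>+y. \<integral>\<^sup>+x'. \<integral>\<^sup>+y'. ennreal ((F (x, y) - F (x', y'))\<^sup>2) \<partial>M \<partial>pow I \<partial>M \<partial>pow I)"
  proof -
    have "(\<integral>\<^sup>+x. \<integral>\<^sup>+x'. ennreal ((f x - f x')\<^sup>2) \<partial>pow (insert i I) \<partial>pow (insert i I))
      = (\<integral>\<^sup>+x. \<integral>\<^sup>+x'. \<integral>\<^sup>+y'. ennreal ((f x - f (x'(i := y')))\<^sup>2) \<partial>M \<partial>pow I \<partial>pow (insert i I))"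
      by (rule nn_integral_cong, rule ins, measurable)
    then show ?thesis by (subst (asm) ins, measurable) (simp add: F_def)
  qed
  also have "\<dots> = (\<integral>\<^sup>+x. \<integral>\<^sup>+x'. \<integral>\<^sup>+y. \<integral>\<^sup>+y'. ennreal ((F (x, y) - F (x', y'))\<^sup>2) \<partial>M \<partial>M \<partial>pow I \<partial>pow I)"
    by (rule nn_integral_cong, subst IM.Fubini') auto
  also have "\<dots> \<le> (\<integral>\<^sup>+x. \<integral>\<^sup>+x'. \<integral>\<^sup>+y. ennreal ((F (x, y) - F (x', y))\<^sup>2) \<partial>M \<partial>pow I \<partial>pow I)
      + (\<integral>\<^sup>+x. \<integral>\<^sup>+y. \<integral>\<^sup>+y'. ennreal ((F (x, y) - F (x, y'))\<^sup>2) \<partial>M \<partial>M \<partial>pow I)"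
    by (rule tensorization_nn) (auto intro: prob_space_axioms I.prob_space_axioms)
  also have "\<dots> \<le> (\<Sum>j\<in>I. ?T j) + ?T i" by (intro add_mono P) (simp only: Q)
  finally show ?case by (simp only: sum.insert[OF insert.hyps(1,2)] add.commute)
qed

text \<open>Jensen's inequality in the independent copy, pointwise in \<open>x\<close>. The right
  side equals twice the variance; the lost factor only enters the absolute constants.\<close>

lemma variance_le_nn:
  fixes X :: "'a \<Rightarrow> real"
  assumes [measurable]: "X \<in> borel_measurable M" and X2: "integrable M (\<lambda>x. (X x)\<^sup>2)"
  shows "ennreal (variance X) \<le> (\<integral>\<^sup>+x. \<integral>\<^sup>+x'. ennreal ((X x - X x')\<^sup>2) \<partial>M \<partial>M)"
proof -
  have X: "integrable M X" by (rule square_integrable_imp_integrable) fact+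
  have int: "integrable M (\<lambda>x'. (a - X x')\<^sup>2)" for a
    unfolding power2_diff using X X2 by simp
  have "(X x - expectation X)\<^sup>2 \<le> (\<integral>x'. (X x - X x')\<^sup>2 \<partial>M)" for x
  proof -
    have "(\<integral>x'. (X x - X x')\<^sup>2 \<partial>M) = (X x)\<^sup>2 + (\<integral>x'. (X x')\<^sup>2 \<partial>M) - 2 * X x * expectation X"
      unfolding power2_diff using X X2 by (simp add: prob_space mult.assoc)
    moreover have "(expectation X)\<^sup>2 \<le> (\<integral>x'. (X x')\<^sup>2 \<partial>M)"
      using variance_eq[OF X X2] variance_positive[of X] by simp
    ultimately show ?thesis by (simp add: power2_diff)
  qed
  then have "ennreal ((X x - expectation X)\<^sup>2) \<le> (\<integral>\<^sup>+x'. ennreal ((X x - X x')\<^sup>2) \<partial>M)" for x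
    by (subst nn_integral_eq_integral[OF int]) (auto intro: ennreal_leI)
  then have "(\<integral>\<^sup>+x. ennreal ((X x - expectation X)\<^sup>2) \<partial>M) \<le> (\<integral>\<^sup>+x. \<integral>\<^sup>+x'. ennreal ((X x - X x')\<^sup>2) \<partial>M \<partial>M)"
    by (intro nn_integral_mono)
  moreover have "(\<integral>\<^sup>+x. ennreal ((X x - expectation X)\<^sup>2) \<partial>M) = ennreal (variance X)"
    using int[of "expectation X"]
    by (intro nn_integral_eq_integral) (simp_all add: power2_commute[of _ "expectation X"])
  ultimately show ?thesis by simp
qed

lemma nn_integral_pow_component:
  assumes "i \<in> I" "h \<in> borel_measurable M"
  shows "(\<integral>\<^sup>+x. h (x i) \<partial>pow I) = (\<integral>\<^sup>+t. h t \<partial>M)"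
proof -
  have "(\<integral>\<^sup>+t. h t \<partial>M) = (\<integral>\<^sup>+t. h t \<partial>distr (pow I) M (\<lambda>x. x i))"
    using assms by (subst distr_PiM_component) (auto simp: prob_space_axioms)
  also have "\<dots> = (\<integral>\<^sup>+x. h (x i) \<partial>pow I)" using assms by (subst nn_integral_distr) auto
  finally show ?thesis ..
qed

lemma
  fixes h :: "'a \<Rightarrow> real"
  assumes "i \<in> I" and h: "integrable M h"
  shows integrable_pow_component: "integrable (pow I) (\<lambda>x. h (x i))"
    and integral_pow_component: "(\<integral>x. h (x i) \<partial>pow I) = (\<integral>t. h t \<partial>M)"
proof -
  have d: "distr (pow I) M (\<lambda>x. x i) = M" using assms by (subst distr_PiM_component) (auto simp: prob_space_axioms)
  have [measurable]: "(\<lambda>x. x i) \<in> pow I \<rightarrow>\<^sub>M M" using assms by auto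
  have [measurable]: "h \<in> borel_measurable M" using h by auto
  show "integrable (pow I) (\<lambda>x. h (x i))" using integrable_distr[of "\<lambda>x. x i" "pow I" M h] h d by auto
  show "(\<integral>x. h (x i) \<partial>pow I) = (\<integral>t. h t \<partial>M)" using integral_distr[of "\<lambda>x. x i" "pow I" M h] d by simp
qed

lemma efron_stein:
  fixes f :: "('i \<Rightarrow> 'a) \<Rightarrow> real"
  assumes "finite I" "f \<in> borel_measurable (pow I)" "integrable (pow I) (\<lambda>x. (f x)\<^sup>2)"
  shows "ennreal (prob_space.variance (pow I) f)
    \<le> (\<Sum>i\<in>I. \<integral>\<^sup>+x. \<integral>\<^sup>+t. ennreal ((f x - f (x(i := t)))\<^sup>2) \<partial>M \<partial>pow I)"
  using prob_space.variance_le_nn[OF prob_space_pow assms(2,3)] pow_tensorization[OF assms(1,2)]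
  by (rule order_trans)

text \<open>Both \<open>x\<close> and \<open>x(i := t)\<close> are compared with
  \<open>x(i := c)\<close>. By invariance under resampling the two comparisons have the same
  expectation, which gives the factor \<open>2 + 2\<close>. With \<open>c = 0\<close> the difference
  is the effect of deleting a coordinate from a norm.\<close>

lemma efron_stein_replace:
  fixes f :: "('i \<Rightarrow> 'a) \<Rightarrow> real"
  assumes I: "finite I" and [measurable]: "f \<in> borel_measurable (pow I)"
    and "integrable (pow I) (\<lambda>x. (f x)\<^sup>2)" and c[measurable]: "c \<in> space M"
  shows "ennreal (prob_space.variance (pow I) f)
    \<le> 4 * (\<Sum>i\<in>I. \<integral>\<^sup>+x. ennreal ((f x - f (x(i := c)))\<^sup>2) \<partial>pow I)"
proof -
  have "(\<integral>\<^sup>+x. \<integral>\<^sup>+t. ennreal ((f x - f (x(i := t)))\<^sup>2) \<partial>M \<partial>pow I)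
    \<le> 4 * (\<integral>\<^sup>+x. ennreal ((f x - f (x(i := c)))\<^sup>2) \<partial>pow I)" (is "_ \<le> 4 * ?D")
    if i[measurable]: "i \<in> I" for i
  proof -
    define h where "h x = ennreal ((f x - f (x(i := c)))\<^sup>2)" for x
    have [measurable]: "h \<in> borel_measurable (pow I)" unfolding h_def by measurable
    have "(a - b)\<^sup>2 \<le> 2 * ((a - d)\<^sup>2) + 2 * ((b - d)\<^sup>2)" for a b d :: real
      using zero_le_power2[of "a + b - 2 * d"] by (simp add: power2_eq_square algebra_simps)
    then have "ennreal ((f x - f (x(i := t)))\<^sup>2) \<le> 2 * h x + 2 * h (x(i := t))" for x t
      unfolding h_def by (auto simp: ennreal_plus[symmetric] ennreal_mult[symmetric] numeral_mult_ennreal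
          simp del: ennreal_plus intro!: ennreal_leI)
    then have "(\<integral>\<^sup>+x. \<integral>\<^sup>+t. ennreal ((f x - f (x(i := t)))\<^sup>2) \<partial>M \<partial>pow I)
       \<le> (\<integral>\<^sup>+x. \<integral>\<^sup>+t. 2 * h x + 2 * h (x(i := t)) \<partial>M \<partial>pow I)"
      by (intro nn_integral_mono)
    also have "\<dots> = (\<integral>\<^sup>+x. 2 * h x + 2 * (\<integral>\<^sup>+t. h (x(i := t)) \<partial>M) \<partial>pow I)"
      by (intro nn_integral_cong) (simp add: nn_integral_add nn_integral_cmult emeasure_space_1)
    also have "\<dots> = 2 * (\<integral>\<^sup>+x. h x \<partial>pow I) + 2 * (\<integral>\<^sup>+x. \<integral>\<^sup>+t. h (x(i := t)) \<partial>M \<partial>pow I)"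
      by (simp add: nn_integral_add nn_integral_cmult)
    also have "\<dots> = 4 * (\<integral>\<^sup>+x. h x \<partial>pow I)"
      by (subst nn_integral_pow_upd[OF I i]) (auto simp: distrib_right[symmetric])
    finally show ?thesis by (simp add: h_def)
  qed
  then show ?thesis
    by (intro order_trans[OF efron_stein[OF assms(1-3)]]) (simp add: sum_distrib_left sum_mono)
qed

lemma integrable_square_pow_sum:
  fixes g :: "'a \<Rightarrow> real"
  assumes I: "finite I" and g[measurable]: "g \<in> borel_measurable M" and g2: "integrable M (\<lambda>t. (g t)\<^sup>2)"
  shows "integrable (pow I) (\<lambda>x. (\<Sum>i\<in>I. g (x i))\<^sup>2)"
proof (rule Bochner_Integration.integrable_bound)
  show "integrable (pow I) (\<lambda>x. (\<Sum>i\<in>I. (g (x i))\<^sup>2) * card I)"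
    by (rule Bochner_Integration.integrable_mult_left, rule Bochner_Integration.integrable_sum,
        rule integrable_pow_component[OF _ g2])
  show "(\<lambda>x. (\<Sum>i\<in>I. g (x i))\<^sup>2) \<in> borel_measurable (pow I)"
    by measurable
  have "\<bar>(\<Sum>i\<in>I. g (x i))\<^sup>2\<bar> \<le> \<bar>(\<Sum>i\<in>I. (g (x i))\<^sup>2) * card I\<bar>" for x
  proof -
    have "(\<Sum>i\<in>I. g (x i))\<^sup>2 \<le> (\<Sum>i\<in>I. (g (x i))\<^sup>2) * card I"
      using Cauchy_Schwarz_ineq_sum[of "\<lambda>i. g (x i)" "\<lambda>_. 1" I] by simp
    moreover have "0 \<le> (\<Sum>i\<in>I. g (x i))\<^sup>2" by simp
    ultimately show ?thesis by linarith
  qed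
  then show "AE x in pow I. norm ((\<Sum>i\<in>I. g (x i))\<^sup>2) \<le> norm ((\<Sum>i\<in>I. (g (x i))\<^sup>2) * card I)"
    unfolding real_norm_def by (rule AE_I2)
qed

text \<open>Variances of independent summands add; deduced from Efron-Stein, this costs a constant
  factor but no separate treatment of independence.\<close>

lemma variance_pow_sum_le:
  fixes g :: "'a \<Rightarrow> real"
  assumes I: "finite I" and g[measurable]: "g \<in> borel_measurable M" and g2: "integrable M (\<lambda>t. (g t)\<^sup>2)"
  shows "prob_space.variance (pow I) (\<lambda>x. \<Sum>i\<in>I. g (x i)) \<le> 4 * card I * expectation (\<lambda>t. (g t)\<^sup>2)"
proof -
  have "(\<integral>\<^sup>+x. \<integral>\<^sup>+t. ennreal (((\<Sum>j\<in>I. g (x j)) - (\<Sum>j\<in>I. g ((x(i := t)) j)))\<^sup>2) \<partial>M \<partial>pow I)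
    \<le> ennreal (4 * expectation (\<lambda>t. (g t)\<^sup>2))" if i[measurable]: "i \<in> I" for i
  proof -
    have "(\<Sum>j\<in>I. g (x j)) - (\<Sum>j\<in>I. g ((x(i := t)) j)) = g (x i) - g t" for x t
      using sum.remove[OF I i, of "\<lambda>j. g (x j)"] sum.remove[OF I i, of "\<lambda>j. g ((x(i := t)) j)"] by simp
    moreover have "(g s - g t)\<^sup>2 \<le> 2 * (g s)\<^sup>2 + 2 * (g t)\<^sup>2" for s t
      using zero_le_power2[of "g s + g t"] by (simp add: power2_eq_square algebra_simps)
    ultimately have "(\<integral>\<^sup>+x. \<integral>\<^sup>+t. ennreal (((\<Sum>j\<in>I. g (x j)) - (\<Sum>j\<in>I. g ((x(i := t)) j)))\<^sup>2) \<partial>M \<partial>pow I)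
       \<le> (\<integral>\<^sup>+x. \<integral>\<^sup>+t. ennreal (2 * (g (x i))\<^sup>2 + 2 * (g t)\<^sup>2) \<partial>M \<partial>pow I)"
      by (intro nn_integral_mono ennreal_leI) simp
    also have "\<dots> = (\<integral>\<^sup>+x. ennreal (2 * (g (x i))\<^sup>2 + 2 * expectation (\<lambda>t. (g t)\<^sup>2)) \<partial>pow I)"
      using g2 by (intro nn_integral_cong, subst nn_integral_eq_integral) (auto simp: prob_space)
    also have "\<dots> = (\<integral>\<^sup>+s. ennreal (2 * (g s)\<^sup>2 + 2 * expectation (\<lambda>t. (g t)\<^sup>2)) \<partial>M)"
      by (rule nn_integral_pow_component[OF i, where h = "\<lambda>s. ennreal (2 * (g s)\<^sup>2 + 2 * expectation (\<lambda>t. (g t)\<^sup>2))"]) measurable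
    also have "\<dots> = ennreal (\<integral>s. 2 * (g s)\<^sup>2 + 2 * expectation (\<lambda>t. (g t)\<^sup>2) \<partial>M)"
      by (rule nn_integral_eq_integral) (use g2 in auto)
    also have "(\<integral>s. 2 * (g s)\<^sup>2 + 2 * expectation (\<lambda>t. (g t)\<^sup>2) \<partial>M) = 4 * expectation (\<lambda>t. (g t)\<^sup>2)"
      by (subst Bochner_Integration.integral_add) (use g2 in \<open>auto simp: prob_space\<close>)
    finally show ?thesis .
  qed
  then have "ennreal (prob_space.variance (pow I) (\<lambda>x. \<Sum>i\<in>I. g (x i)))
      \<le> (\<Sum>i\<in>I. ennreal (4 * expectation (\<lambda>t. (g t)\<^sup>2)))"
    by (intro order_trans[OF efron_stein sum_mono] I integrable_square_pow_sum g g2) measurable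
  also have "\<dots> = ennreal (\<Sum>i\<in>I. 4 * expectation (\<lambda>t. (g t)\<^sup>2))"
    by (rule sum_ennreal) simp
  finally have "prob_space.variance (pow I) (\<lambda>x. \<Sum>i\<in>I. g (x i)) \<le> (\<Sum>i\<in>I. 4 * expectation (\<lambda>t. (g t)\<^sup>2))"
    by (subst (asm) ennreal_le_iff) (simp_all add: sum_nonneg)
  then show ?thesis by (simp add: mult_ac)
qed

end

section \<open>One-dimensional Gaussian estimates\<close>

abbreviation gauss :: "real measure" where
  "gauss \<equiv> density lborel (\<lambda>x. ennreal (std_normal_density x))"

lemma prob_space_gauss: "prob_space gauss"
  by (rule prob_space_normal_density) simp

text \<open>The common tool for the one-dimensional estimates below: after an affine substitution an
  integral inequality becomes a pointwise comparison of densities. The art lies in the choice of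
  \<open>b\<close> and \<open>c\<close>.\<close>

lemma gauss_subst_le:
  fixes F G :: "real \<Rightarrow> real"
  assumes [measurable]: "F \<in> borel_measurable borel" "G \<in> borel_measurable borel" and "c \<noteq> 0"
    and le: "\<And>u. \<bar>c\<bar> * (std_normal_density (b + c * u) * F (b + c * u)) \<le> std_normal_density u * G u"
  shows "(\<integral>\<^sup>+x. ennreal (F x) \<partial>gauss) \<le> (\<integral>\<^sup>+x. ennreal (G x) \<partial>gauss)"
proof -
  have "(\<integral>\<^sup>+x. ennreal (F x) \<partial>gauss) = (\<integral>\<^sup>+x. ennreal (std_normal_density x * F x) \<partial>lborel)"
    by (simp add: nn_integral_density ennreal_mult')
  also have "\<dots> = (\<integral>\<^sup>+u. ennreal \<bar>c\<bar> * ennreal (std_normal_density (b + c * u) * F (b + c * u)) \<partial>lborel)"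
    using \<open>c \<noteq> 0\<close> by (subst nn_integral_real_affine[of _ c b]) (auto simp: nn_integral_cmult)
  also have "\<dots> \<le> (\<integral>\<^sup>+u. ennreal (std_normal_density u * G u) \<partial>lborel)"
    by (intro nn_integral_mono) (simp add: ennreal_mult'[symmetric] le ennreal_leI)
  also have "\<dots> = (\<integral>\<^sup>+x. ennreal (G x) \<partial>gauss)"
    by (simp add: nn_integral_density ennreal_mult')
  finally show ?thesis .
qed

lemma nn_integral_gauss_uminus:
  assumes [measurable]: "F \<in> borel_measurable borel"
  shows "(\<integral>\<^sup>+x. F (- x) \<partial>gauss) = (\<integral>\<^sup>+x. F x \<partial>gauss)"
proof -
  have "(\<integral>\<^sup>+x. F x \<partial>gauss) = (\<integral>\<^sup>+x. ennreal (std_normal_density x) * F x \<partial>lborel)"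
    by (simp add: nn_integral_density)
  also have "\<dots> = (\<integral>\<^sup>+x. ennreal (std_normal_density x) * F (- x) \<partial>lborel)"
    by (subst nn_integral_real_affine[of _ "- 1" 0]) (auto simp: std_normal_density_def)
  finally show ?thesis by (simp add: nn_integral_density)
qed

text \<open>Because \<open>F 0 = 0\<close>, the truncation \<open>max 0 x\<close> acts as
  restriction to the positive half-line, where an affine substitution can be used.\<close>

lemma nn_integral_gauss_abs:
  fixes F :: "real \<Rightarrow> ennreal"
  assumes [measurable]: "F \<in> borel_measurable borel" and "F 0 = 0"
  shows "(\<integral>\<^sup>+x. F \<bar>x\<bar> \<partial>gauss) = 2 * (\<integral>\<^sup>+x. F (max 0 x) \<partial>gauss)"
proof -
  have "F \<bar>x\<bar> = F (max 0 x) + F (max 0 (- x))" for x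
    using \<open>F 0 = 0\<close> by (cases "x \<ge> 0") (auto simp: max_def)
  then have "(\<integral>\<^sup>+x. F \<bar>x\<bar> \<partial>gauss) = (\<integral>\<^sup>+x. F (max 0 x) \<partial>gauss) + (\<integral>\<^sup>+x. F (max 0 (- x)) \<partial>gauss)"
    by (simp add: nn_integral_add)
  also have "(\<integral>\<^sup>+x. F (max 0 (- x)) \<partial>gauss) = (\<integral>\<^sup>+x. F (max 0 x) \<partial>gauss)"
    by (rule nn_integral_gauss_uminus) measurable
  finally show ?thesis by (simp add: mult_2)
qed

text \<open>The substitution \<open>x = 2 * u - m\<close> fixes \<open>m\<close> and doubles the
  excess. With \<open>r = u - m\<close> the density ratio gains \<open>exp (- (m * r))\<close>,
  which absorbs the squared excess at the price \<open>16 / m\<^sup>2\<close> and leaves the tail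
  probability as a factor.\<close>

lemma nn_integral_gauss_excess:
  assumes "m > 0"
  shows "(\<integral>\<^sup>+x. ennreal ((max 0 (\<bar>x\<bar> - m))\<^sup>2) \<partial>gauss) \<le> ennreal (16 / m\<^sup>2) * emeasure gauss {x. m < \<bar>x\<bar>}"
proof -
  have "2 * (std_normal_density (- m + 2 * u) * (max 0 (max 0 (- m + 2 * u) - m))\<^sup>2)
    \<le> std_normal_density u * (16 / m\<^sup>2 * indicator {m<..} (max 0 u))" for u
  proof (cases "u > m")
    case True
    define r where "r = u - m"
    have r: "r > 0" "u = m + r" using True by (auto simp: r_def)
    have "(m * r)\<^sup>2 / 2 \<le> exp (m * r)"
      using exp_lower_Taylor_quadratic[of "m * r"] mult_pos_pos[OF assms r(1)] by linarith
    then have "(m * r)\<^sup>2 * exp (- (m * r)) \<le> 2" by (simp add: exp_minus field_simps)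
    then have 1: "8 * r\<^sup>2 * exp (- (m * r)) \<le> 16 / m\<^sup>2"
      using assms by (simp add: field_simps power_mult_distrib)
    have "exp (- (- m + 2 * u)\<^sup>2 / 2) = exp (- u\<^sup>2 / 2 - m * r - 3 / 2 * r\<^sup>2)"
      unfolding r by (rule arg_cong[of _ _ exp]) (simp add: power2_eq_square field_simps)
    also have "\<dots> \<le> exp (- u\<^sup>2 / 2 + - (m * r))" using r by simp
    also have "\<dots> = exp (- u\<^sup>2 / 2) * exp (- (m * r))" by (rule exp_add)
    finally have 2: "exp (- (- m + 2 * u)\<^sup>2 / 2) * (8 * r\<^sup>2) \<le> exp (- u\<^sup>2 / 2) * exp (- (m * r)) * (8 * r\<^sup>2)"
      by (rule mult_right_mono) simp
    have 3: "max 0 (max 0 (- m + 2 * u) - m) = 2 * r" using assms r by (simp add: max_def)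
    have "exp (- (- m + 2 * u)\<^sup>2 / 2) * (8 * r\<^sup>2) \<le> exp (- u\<^sup>2 / 2) * (16 / m\<^sup>2)"
      using 2 mult_left_mono[OF 1, of "exp (- u\<^sup>2 / 2)"] by (simp add: mult_ac)
    then show ?thesis
      using True assms unfolding 3 std_normal_density_def by (simp add: field_simps power_mult_distrib)
  next
    case False
    then have "max 0 (max 0 (- m + 2 * u) - m) = 0" using assms by (auto simp: max_def)
    then show ?thesis by (simp add: indicator_def)
  qed
  then have *: "(\<integral>\<^sup>+x. ennreal ((max 0 (max 0 x - m))\<^sup>2) \<partial>gauss)
      \<le> (\<integral>\<^sup>+x. ennreal (16 / m\<^sup>2 * indicator {m<..} (max 0 x)) \<partial>gauss)"
    by (intro gauss_subst_le[where c = 2 and b = "- m"]) auto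
  have "(\<integral>\<^sup>+x. ennreal ((max 0 (\<bar>x\<bar> - m))\<^sup>2) \<partial>gauss) = 2 * (\<integral>\<^sup>+x. ennreal ((max 0 (max 0 x - m))\<^sup>2) \<partial>gauss)"
    using assms by (intro nn_integral_gauss_abs) auto
  also have "\<dots> \<le> 2 * (\<integral>\<^sup>+x. ennreal (16 / m\<^sup>2 * indicator {m<..} (max 0 x)) \<partial>gauss)"
    by (intro mult_left_mono *) simp
  also have "\<dots> = (\<integral>\<^sup>+x. ennreal (16 / m\<^sup>2 * indicator {m<..} \<bar>x\<bar>) \<partial>gauss)"
    using assms by (intro nn_integral_gauss_abs[symmetric]) auto
  also have "\<dots> = (\<integral>\<^sup>+x. ennreal (16 / m\<^sup>2) * indicator {x. m < \<bar>x\<bar>} x \<partial>gauss)"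
    by (intro nn_integral_cong) (auto simp: indicator_def)
  also have "\<dots> = ennreal (16 / m\<^sup>2) * emeasure gauss {x. m < \<bar>x\<bar>}"
    by (simp add: nn_integral_cmult)
  finally show ?thesis .
qed

text \<open>A plain translation by \<open>s\<close> would have an unbounded density ratio. The
  substitution \<open>x = 2 * u - b - 2 * s\<close> sends \<open>b + s\<close> to \<open>b\<close>
  and also dilates by 2; the extra decay in \<open>r = u - b - s\<close> absorbs the cross term
  \<open>r * s\<close>.\<close>

lemma gauss_tail_shift:
  assumes "b \<ge> 0" "s \<ge> 0"
  shows "measure gauss {x. b < \<bar>x\<bar>} \<le> 2 * exp (b * s + s\<^sup>2) * measure gauss {x. b + s < \<bar>x\<bar>}"
proof -
  interpret prob_space gauss by (rule prob_space_gauss)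
  let ?K = "2 * exp (b * s + s\<^sup>2)"
  have "2 * (std_normal_density (- b - 2 * s + 2 * u) * indicator {b<..} (max 0 (- b - 2 * s + 2 * u)))
    \<le> std_normal_density u * (?K * indicator {b + s<..} (max 0 u))" for u
  proof (cases "u > b + s")
    case True
    define r where "r = u - b - s"
    have r: "r > 0" "u = b + s + r" using True by (auto simp: r_def)
    have "0 \<le> (s - r)\<^sup>2" by simp
    then have rs: "2 * (r * s) \<le> s\<^sup>2 + r\<^sup>2" by (simp add: power2_eq_square algebra_simps)
    have "- (- b - 2 * s + 2 * u)\<^sup>2 / 2 = - u\<^sup>2 / 2 + (b * s + s\<^sup>2 / 2 + r * s - b * r - 3 / 2 * r\<^sup>2)"
      unfolding r by (simp add: power2_eq_square field_simps)
    also have "\<dots> \<le> - u\<^sup>2 / 2 + (b * s + s\<^sup>2)"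
    proof -
      have "0 \<le> b * r" "0 \<le> r\<^sup>2" using assms r by auto
      then show ?thesis using rs by linarith
    qed
    finally have "exp (- (- b - 2 * s + 2 * u)\<^sup>2 / 2) \<le> exp (- u\<^sup>2 / 2) * exp (b * s + s\<^sup>2)"
      by (simp flip: exp_add)
    moreover have "indicator {b<..} (max 0 (- b - 2 * s + 2 * u)) \<le> (1::real)" by (simp add: indicator_def)
    ultimately have "exp (- (- b - 2 * s + 2 * u)\<^sup>2 / 2) * indicator {b<..} (max 0 (- b - 2 * s + 2 * u))
        \<le> exp (- u\<^sup>2 / 2) * exp (b * s + s\<^sup>2) * 1"
      by (intro mult_mono) auto
    then show ?thesis
      using True assms unfolding std_normal_density_def by (simp add: field_simps)
  next
    case False
    then have "indicator {b<..} (max 0 (- b - 2 * s + 2 * u)) = (0::real)"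
      using assms by (auto simp: indicator_def max_def)
    then show ?thesis by (simp add: indicator_def)
  qed
  then have *: "(\<integral>\<^sup>+x. ennreal (indicator {b<..} (max 0 x)) \<partial>gauss)
      \<le> (\<integral>\<^sup>+x. ennreal (?K * indicator {b + s<..} (max 0 x)) \<partial>gauss)"
    by (intro gauss_subst_le[where c = 2 and b = "- b - 2 * s"]) auto
  have "emeasure gauss {x. b < \<bar>x\<bar>} = (\<integral>\<^sup>+x. ennreal (indicator {b<..} \<bar>x\<bar>) \<partial>gauss)"
    by (subst nn_integral_indicator[symmetric], simp, intro nn_integral_cong) (auto simp: indicator_def)
  also have "\<dots> = 2 * (\<integral>\<^sup>+x. ennreal (indicator {b<..} (max 0 x)) \<partial>gauss)"
    using assms by (intro nn_integral_gauss_abs) auto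
  also have "\<dots> \<le> 2 * (\<integral>\<^sup>+x. ennreal (?K * indicator {b + s<..} (max 0 x)) \<partial>gauss)"
    by (intro mult_left_mono *) simp
  also have "\<dots> = (\<integral>\<^sup>+x. ennreal (?K * indicator {b + s<..} \<bar>x\<bar>) \<partial>gauss)"
    using assms by (intro nn_integral_gauss_abs[symmetric]) auto
  also have "\<dots> = (\<integral>\<^sup>+x. ennreal ?K * indicator {x. b + s < \<bar>x\<bar>} x \<partial>gauss)"
    by (intro nn_integral_cong) (auto simp: indicator_def)
  also have "\<dots> = ennreal ?K * emeasure gauss {x. b + s < \<bar>x\<bar>}"
    by (rule nn_integral_cmult_indicator) simp
  finally show ?thesis by (simp add: emeasure_eq_measure ennreal_mult'[symmetric])
qed

text \<open>Half of the Gaussian exponent survives, and rescaling by \<open>sqrt 2\<close> restores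
  the density. This single exponential moment yields the tail bound and the second moment of the
  maximum.\<close>

lemma nn_integral_gauss_exp_square: "(\<integral>\<^sup>+x. ennreal (exp (x\<^sup>2 / 4)) \<partial>gauss) \<le> 2"
proof -
  interpret prob_space gauss by (rule prob_space_gauss)
  have "(\<integral>\<^sup>+x. ennreal (exp (x\<^sup>2 / 4)) \<partial>gauss) \<le> (\<integral>\<^sup>+x. ennreal (sqrt 2) \<partial>gauss)"
  proof (rule gauss_subst_le[where c = "sqrt 2" and b = 0])
    fix u :: real
    have "exp (- (sqrt 2 * u)\<^sup>2 / 2) * exp ((sqrt 2 * u)\<^sup>2 / 4) = exp (- u\<^sup>2 / 2)"
      by (simp add: power_mult_distrib flip: exp_add)
    then show "\<bar>sqrt 2\<bar> * (std_normal_density (0 + sqrt 2 * u) * exp ((0 + sqrt 2 * u)\<^sup>2 / 4)) \<le> std_normal_density u * sqrt 2"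
      by (simp add: std_normal_density_def mult.commute)
  qed auto
  also have "\<dots> \<le> ennreal 2"
    using emeasure_space_1 by (simp add: real_sqrt_le_iff ennreal_le_iff2 real_le_lsqrt flip: ennreal_numeral)
  finally show ?thesis by simp
qed

lemma gauss_tail_le:
  assumes "t \<ge> 0"
  shows "measure gauss {x. t < \<bar>x\<bar>} \<le> 2 * exp (- t\<^sup>2 / 4)"
proof -
  interpret prob_space gauss by (rule prob_space_gauss)
  have "emeasure gauss {x. t < \<bar>x\<bar>} = (\<integral>\<^sup>+x. indicator {x. t < \<bar>x\<bar>} x \<partial>gauss)" by simp
  also have "\<dots> \<le> (\<integral>\<^sup>+x. ennreal (exp (- t\<^sup>2 / 4)) * ennreal (exp (x\<^sup>2 / 4)) \<partial>gauss)"
  proof (intro nn_integral_mono)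
    fix x :: real
    have "1 \<le> exp (- t\<^sup>2 / 4) * exp (x\<^sup>2 / 4)" if "t < \<bar>x\<bar>"
      using that assms power_mono[of t "\<bar>x\<bar>" 2] by (simp flip: exp_add)
    then have "1 \<le> ennreal (exp (- t\<^sup>2 / 4)) * ennreal (exp (x\<^sup>2 / 4))" if "t < \<bar>x\<bar>"
      using that by (simp flip: ennreal_mult ennreal_1)
    then show "indicator {x. t < \<bar>x\<bar>} x \<le> ennreal (exp (- t\<^sup>2 / 4)) * ennreal (exp (x\<^sup>2 / 4))"
      by (auto simp: indicator_def)
  qed
  also have "\<dots> \<le> ennreal (exp (- t\<^sup>2 / 4)) * 2"
    by (subst nn_integral_cmult) (auto intro!: mult_left_mono nn_integral_gauss_exp_square)
  also have "\<dots> = ennreal (2 * exp (- t\<^sup>2 / 4))"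
    by (simp add: ennreal_mult mult.commute)
  finally show ?thesis by (simp add: emeasure_eq_measure)
qed


section \<open>Absolute moments of a Gaussian\<close>

text \<open>The maximum of \<open>t powr q * exp (- t\<^sup>2 / 2)\<close> over positive
  \<open>t\<close>, attained at \<open>t = sqrt q\<close>. The absolute moment of order
  \<open>q\<close> agrees with it up to constant factors.\<close>

definition moment_scale :: "real \<Rightarrow> real" where
  "moment_scale q = (q / exp 1) powr (q / 2)"

definition window_const :: real where
  "window_const = exp (- 3 / 2) / sqrt (2 * pi)"

lemma window_const_pos: "0 < window_const"
  by (simp add: window_const_def)

lemma window_const_le_1: "window_const \<le> 1"
proof -
  have "1 \<le> sqrt (2 * pi)" using pi_gt3 by simp
  moreover have "exp (- 3 / 2 :: real) \<le> 1" by simp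
  ultimately have "exp (- 3 / 2) \<le> sqrt (2 * pi)" by linarith
  then show ?thesis using pi_gt_zero by (simp add: window_const_def)
qed

lemma moment_scale_pos: "q > 0 \<Longrightarrow> 0 < moment_scale q"
  by (simp add: moment_scale_def)

lemma moment_scale_exp: "q > 0 \<Longrightarrow> moment_scale q = exp (q / 2 * ln q - q / 2)"
  by (simp add: moment_scale_def powr_def ln_div right_diff_distrib)

text \<open>The source of the factor \<open>2 powr p\<close> in the theorem: it is the ratio of the
  moment of order \<open>2 * p\<close> to the squared moment of order \<open>p\<close>, up to
  constants.\<close>

lemma moment_scale_double:
  assumes "q > 0"
  shows "moment_scale (2 * q) = 2 powr q * (moment_scale q)\<^sup>2"
proof -
  have "2 * q / 2 * ln (2 * q) - 2 * q / 2 = q * ln 2 + 2 * (q / 2 * ln q - q / 2)"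
    using assms by (simp add: ln_mult distrib_left right_diff_distrib)
  then show ?thesis
    using assms by (simp only: moment_scale_exp powr_def exp_add flip: exp_double) simp
qed

lemma moment_scale_root: "q > 0 \<Longrightarrow> moment_scale q powr (2 / q) = q / exp 1"
  by (simp add: moment_scale_def powr_powr)

text \<open>The tangent to \<open>ln\<close> at the maximizer \<open>sqrt q\<close> puts the
  integrand below a Gaussian bump centered there, so that a translation bounds the moment without a
  Gamma function.\<close>

lemma moment_integrand_le:
  assumes "q > 0" "t > 0"
  shows "std_normal_density t * t powr q \<le> moment_scale q * std_normal_density (t - sqrt q)"
proof -
  define s where "s = sqrt q"
  have s: "s > 0" "q = s\<^sup>2" using assms by (auto simp: s_def)
  have "ln (t / s) \<le> t / s - 1" using assms s by (intro ln_le_minus_one) auto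
  then have "q * (ln t - ln s) \<le> q * (t / s - 1)"
    using assms s by (intro mult_left_mono) (auto simp: ln_div)
  moreover have "q * (t / s) = s * t" "ln q = 2 * ln s" using s by (auto simp: power2_eq_square ln_mult)
  ultimately have "- t\<^sup>2 / 2 + q * ln t \<le> (q / 2 * ln q - q / 2) + - (t - s)\<^sup>2 / 2"
    unfolding s(2) by (simp add: power2_diff field_simps)
  then have "exp (- t\<^sup>2 / 2) * t powr q \<le> moment_scale q * exp (- (t - s)\<^sup>2 / 2)"
    using assms by (simp add: moment_scale_exp powr_def flip: exp_add)
  then have "exp (- t\<^sup>2 / 2) * t powr q / sqrt (2 * pi) \<le> moment_scale q * exp (- (t - s)\<^sup>2 / 2) / sqrt (2 * pi)"
    by (rule divide_right_mono) simp
  then show ?thesis by (simp add: std_normal_density_def s_def)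
qed

text \<open>The integrand keeps its order of magnitude on a unit interval to the right of its
  maximizer, uniformly in \<open>q\<close>. At \<open>t = sqrt q + r\<close> the density costs
  \<open>r\<^sup>2 / 2\<close> and the bound \<open>ln (1 + y) \<ge> y - y\<^sup>2\<close> costs
  \<open>r\<^sup>2\<close>, whence the \<open>3 / 2\<close> in \<open>window_const\<close>.\<close>

lemma window_integrand_ge:
  assumes "q \<ge> 1" "sqrt q \<le> t" "t \<le> sqrt q + 1"
  shows "window_const * moment_scale q \<le> std_normal_density t * t powr q"
proof -
  define s where "s = sqrt q"
  have s: "s \<ge> 1" "q = s\<^sup>2" using assms by (auto simp: s_def)
  define r where "r = t - s"
  have r: "0 \<le> r" "r \<le> 1" "t = s + r" using assms by (auto simp: r_def s_def)
  have "r / s - (r / s)\<^sup>2 \<le> ln (1 + r / s)"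
    using r s by (intro ln_one_plus_pos_lower_bound) auto
  also have "1 + r / s = t / s" using r s by (simp add: field_simps)
  finally have "q * (r / s - (r / s)\<^sup>2) \<le> q * (ln t - ln s)"
    using r s by (intro mult_left_mono) (auto simp: ln_div)
  moreover have "q * (r / s - (r / s)\<^sup>2) = s * r - r\<^sup>2" "ln q = 2 * ln s"
    using s by (auto simp: power2_eq_square ln_mult field_simps)
  moreover have "r\<^sup>2 \<le> 1" using r by (simp add: power_le_one)
  ultimately have "- 3 / 2 + (q / 2 * ln q - q / 2) \<le> - t\<^sup>2 / 2 + q * ln t"
    unfolding s(2) r(3) by (simp add: power2_sum right_diff_distrib) (simp add: field_simps)
  then have "exp (- 3 / 2) * moment_scale q \<le> exp (- t\<^sup>2 / 2) * t powr q"
    using assms s r by (simp add: moment_scale_exp powr_def flip: exp_add)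
  then have "exp (- 3 / 2) * moment_scale q / sqrt (2 * pi) \<le> exp (- t\<^sup>2 / 2) * t powr q / sqrt (2 * pi)"
    by (rule divide_right_mono) simp
  then show ?thesis by (simp add: std_normal_density_def window_const_def)
qed

lemma nn_integral_gauss_powr_le:
  assumes "q > 0"
  shows "(\<integral>\<^sup>+x. ennreal (\<bar>x\<bar> powr q) \<partial>gauss) \<le> ennreal (2 * moment_scale q)"
proof -
  interpret prob_space gauss by (rule prob_space_gauss)
  have "\<bar>1\<bar> * (std_normal_density (sqrt q + 1 * u) * (max 0 (sqrt q + 1 * u)) powr q)
      \<le> std_normal_density u * moment_scale q" for u
    using moment_integrand_le[OF assms, of "sqrt q + u"] moment_scale_pos[OF assms]
    by (cases "sqrt q + u > 0") (auto simp: max_def mult.commute)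
  then have *: "(\<integral>\<^sup>+x. ennreal ((max 0 x) powr q) \<partial>gauss) \<le> (\<integral>\<^sup>+x. ennreal (moment_scale q) \<partial>gauss)"
    by (intro gauss_subst_le[where c = 1 and b = "sqrt q"]) auto
  have "(\<integral>\<^sup>+x. ennreal (\<bar>x\<bar> powr q) \<partial>gauss) = 2 * (\<integral>\<^sup>+x. ennreal ((max 0 x) powr q) \<partial>gauss)"
    using assms by (intro nn_integral_gauss_abs) auto
  also have "\<dots> \<le> 2 * (\<integral>\<^sup>+x. ennreal (moment_scale q) \<partial>gauss)" by (intro mult_left_mono *) simp
  also have "\<dots> = ennreal (2 * moment_scale q)"
    using emeasure_space_1 by (simp add: ennreal_mult')
  finally show ?thesis .
qed

lemma
  assumes "q > 0"
  shows integrable_gauss_powr: "integrable gauss (\<lambda>x. \<bar>x\<bar> powr q)"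
    and integral_gauss_powr_le: "(\<integral>x. \<bar>x\<bar> powr q \<partial>gauss) \<le> 2 * moment_scale q"
proof -
  show "integrable gauss (\<lambda>x. \<bar>x\<bar> powr q)"
    using nn_integral_gauss_powr_le[OF assms]
    by (intro integrableI_nonneg) (auto intro: le_less_trans)
  then show "(\<integral>x. \<bar>x\<bar> powr q \<partial>gauss) \<le> 2 * moment_scale q"
    using nn_integral_gauss_powr_le[OF assms] moment_scale_pos[OF assms]
    by (subst (asm) nn_integral_eq_integral) auto
qed

lemma gauss_unit_interval_ge:
  fixes F :: "real \<Rightarrow> real"
  assumes [measurable]: "F \<in> borel_measurable borel"
    and "\<And>x. 0 \<le> F x" "\<And>x. a \<le> x \<Longrightarrow> x \<le> a + 1 \<Longrightarrow> k \<le> std_normal_density x * F x" "k \<ge> 0"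
  shows "ennreal k \<le> (\<integral>\<^sup>+x. ennreal (F x) \<partial>gauss)"
proof -
  have "ennreal k = (\<integral>\<^sup>+x. ennreal k * indicator {a..a + 1} x \<partial>lborel)"
    by (simp add: nn_integral_cmult_indicator)
  also have "\<dots> \<le> (\<integral>\<^sup>+x. ennreal (std_normal_density x * F x) \<partial>lborel)"
    using assms by (intro nn_integral_mono) (auto simp: indicator_def intro: ennreal_leI)
  also have "\<dots> = (\<integral>\<^sup>+x. ennreal (F x) \<partial>gauss)"
    using assms by (simp add: nn_integral_density ennreal_mult')
  finally show ?thesis .
qed

abbreviation window :: "real \<Rightarrow> real set" where
  "window q \<equiv> {sqrt q..sqrt q + 1}"

lemma integral_window_ge:
  assumes "q \<ge> 1"
  shows "window_const * moment_scale q \<le> (\<integral>x. \<bar>x\<bar> powr q * indicator (window q) x \<partial>gauss)"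
proof -
  have int: "integrable gauss (\<lambda>x. \<bar>x\<bar> powr q * indicator (window q) x)"
    using integrable_gauss_powr[of q] assms by (intro integrable_real_mult_indicator) auto
  have "ennreal (window_const * moment_scale q) \<le> (\<integral>\<^sup>+x. ennreal (\<bar>x\<bar> powr q * indicator (window q) x) \<partial>gauss)"
  proof (rule gauss_unit_interval_ge[where a = "sqrt q"])
    fix x assume x: "sqrt q \<le> x" "x \<le> sqrt q + 1"
    moreover have "0 < sqrt q" using assms by simp
    ultimately have "\<bar>x\<bar> = x" by linarith
    then show "window_const * moment_scale q \<le> std_normal_density x * (\<bar>x\<bar> powr q * indicator (window q) x)"
      using window_integrand_ge[OF assms x] x by simp
  qed (use window_const_pos moment_scale_pos[of q] assms in auto)
  also have "\<dots> = ennreal (\<integral>x. \<bar>x\<bar> powr q * indicator (window q) x \<partial>gauss)"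
    by (rule nn_integral_eq_integral[OF int]) simp
  finally show ?thesis by (subst (asm) ennreal_le_iff) (auto intro!: integral_nonneg_AE)
qed

lemma integral_gauss_powr_ge:
  assumes "q \<ge> 1"
  shows "window_const * moment_scale q \<le> (\<integral>x. \<bar>x\<bar> powr q \<partial>gauss)"
proof -
  have "(\<integral>x. \<bar>x\<bar> powr q * indicator (window q) x \<partial>gauss) \<le> (\<integral>x. \<bar>x\<bar> powr q \<partial>gauss)"
    using integrable_gauss_powr[of q] assms
    by (intro integral_mono integrable_real_mult_indicator) (auto simp: indicator_def)
  then show ?thesis using integral_window_ge[OF assms] by linarith
qed

lemma gauss_tail_ge:
  assumes "a \<ge> 0"
  shows "exp (- (a + 1)\<^sup>2 / 2) / sqrt (2 * pi) \<le> measure gauss {x. a \<le> \<bar>x\<bar>}"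
proof -
  interpret prob_space gauss by (rule prob_space_gauss)
  have "ennreal (exp (- (a + 1)\<^sup>2 / 2) / sqrt (2 * pi)) \<le> (\<integral>\<^sup>+x. ennreal (indicator {x. a \<le> \<bar>x\<bar>} x) \<partial>gauss)"
  proof (rule gauss_unit_interval_ge[where a = a])
    fix x assume x: "a \<le> x" "x \<le> a + 1"
    then have "x\<^sup>2 \<le> (a + 1)\<^sup>2" using assms by (intro power_mono) auto
    then show "exp (- (a + 1)\<^sup>2 / 2) / sqrt (2 * pi) \<le> std_normal_density x * indicator {x. a \<le> \<bar>x\<bar>} x"
      using x assms by (simp add: std_normal_density_def divide_right_mono)
  qed auto
  also have "\<dots> = emeasure gauss {x. a \<le> \<bar>x\<bar>}" by (simp add: ennreal_indicator)
  finally show ?thesis by (simp add: emeasure_eq_measure)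
qed

section \<open>Removing a coordinate from a norm\<close>

lemma powr_le_tangent:
  fixes t :: real
  assumes "0 \<le> t" "0 \<le> \<theta>" "\<theta> \<le> 1"
  shows "t powr \<theta> \<le> 1 + \<theta> * (t - 1)"
proof (cases "t = 0")
  case False
  then show ?thesis
    using Youngs_inequality_0[of \<theta> "1 - \<theta>" t 1] assms by (simp add: algebra_simps)
qed (use assms in simp)

lemma
  fixes A B :: real
  assumes "0 \<le> \<theta>" "\<theta> \<le> 1" "0 \<le> A" "0 \<le> B"
  shows powr_diff_le: "0 < B \<Longrightarrow> A powr \<theta> - B powr \<theta> \<le> \<theta> * B powr \<theta> * ((A - B) / B)"
    and powr_diff_ge: "0 < A \<Longrightarrow> \<theta> * A powr \<theta> * ((A - B) / A) \<le> A powr \<theta> - B powr \<theta>"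
proof -
  assume B: "0 < B"
  have "A powr \<theta> - B powr \<theta> = B powr \<theta> * ((A / B) powr \<theta> - 1)"
    using assms B by (simp add: powr_divide field_simps)
  also have "\<dots> \<le> B powr \<theta> * (\<theta> * (A / B - 1))"
    using powr_le_tangent[of "A / B" \<theta>] assms by (intro mult_left_mono) auto
  finally show "A powr \<theta> - B powr \<theta> \<le> \<theta> * B powr \<theta> * ((A - B) / B)"
    using B by (simp add: diff_divide_distrib mult_ac)
next
  assume A: "0 < A"
  have "B powr \<theta> - A powr \<theta> = A powr \<theta> * ((B / A) powr \<theta> - 1)"
    using assms A by (simp add: powr_divide field_simps)
  also have "\<dots> \<le> A powr \<theta> * (\<theta> * (B / A - 1))"
    using powr_le_tangent[of "B / A" \<theta>] assms by (intro mult_left_mono) auto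
  also have "\<dots> = - (\<theta> * A powr \<theta> * ((A - B) / A))"
    using A by (simp add: field_simps)
  finally show "\<theta> * A powr \<theta> * ((A - B) / A) \<le> A powr \<theta> - B powr \<theta>" by linarith
qed

text \<open>An arbitrary index set is allowed so that the remaining coordinates after a deletion are
  the instance \<open>I - {i}\<close>.\<close>

definition max_abs :: "nat set \<Rightarrow> (nat \<Rightarrow> real) \<Rightarrow> real" where
  "max_abs I x = Max ((\<lambda>i. \<bar>x i\<bar>) ` I)"

definition pow_sum :: "nat set \<Rightarrow> real \<Rightarrow> (nat \<Rightarrow> real) \<Rightarrow> real" where
  "pow_sum I p x = (\<Sum>i\<in>I. \<bar>x i\<bar> powr p)"

lemma lp_norm_infinity: "lp_norm n \<infinity> x = max_abs {..<n} x"
  by (simp add: lp_norm_def max_abs_def)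

lemma lp_norm_real: "lp_norm n (ereal p) x = pow_sum {..<n} p x powr (1 / p)"
  by (simp add: lp_norm_def pow_sum_def)

lemma pow_sum_nonneg: "0 \<le> pow_sum I p x"
  by (simp add: pow_sum_def sum_nonneg)

lemma pow_sum_remove:
  assumes "finite I" "i \<in> I"
  shows "pow_sum I p x = \<bar>x i\<bar> powr p + pow_sum (I - {i}) p x"
  using assms by (simp add: pow_sum_def sum.remove)

lemma pow_sum_upd:
  assumes "finite I" "i \<in> I"
  shows "pow_sum I p (x(i := t)) = \<bar>t\<bar> powr p + pow_sum (I - {i}) p x"
  unfolding pow_sum_remove[OF assms] by (simp add: pow_sum_def)

lemma abs_le_max_abs: "finite I \<Longrightarrow> i \<in> I \<Longrightarrow> \<bar>x i\<bar> \<le> max_abs I x"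
  by (auto simp: max_abs_def)

lemma max_abs_attained:
  assumes "finite I" "I \<noteq> {}"
  obtains i where "i \<in> I" "max_abs I x = \<bar>x i\<bar>"
proof -
  have "Max ((\<lambda>i. \<bar>x i\<bar>) ` I) \<in> (\<lambda>i. \<bar>x i\<bar>) ` I" using assms by (intro Max_in) auto
  then show thesis using that by (auto simp: max_abs_def)
qed

lemma max_abs_nonneg: "finite I \<Longrightarrow> I \<noteq> {} \<Longrightarrow> 0 \<le> max_abs I x"
  using max_abs_attained[of I x] by (metis abs_ge_zero)

lemma max_abs_upd_other: "max_abs (I - {i}) (x(i := t)) = max_abs (I - {i}) x"
  unfolding max_abs_def by (intro arg_cong[of _ _ Max] image_cong) auto

lemma powr_root:
  fixes a :: real
  assumes "0 \<le> a" "p \<noteq> 0"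
  shows "(a powr p) powr (1 / p) = a"
  using assms by (simp add: powr_powr)

lemma max_abs_le_pow_sum_root:
  assumes "finite I" "I \<noteq> {}" "p > 0"
  shows "max_abs I x \<le> pow_sum I p x powr (1 / p)"
proof -
  obtain i where i: "i \<in> I" "max_abs I x = \<bar>x i\<bar>" using assms max_abs_attained by blast
  have "\<bar>x i\<bar> powr p \<le> pow_sum I p x"
    using assms i unfolding pow_sum_def by (intro member_le_sum) auto
  then have "(\<bar>x i\<bar> powr p) powr (1 / p) \<le> pow_sum I p x powr (1 / p)"
    using assms by (intro powr_mono2) auto
  then show ?thesis using assms i by (simp add: powr_root)
qed

lemma pow_sum_root_le_max_abs:
  assumes "finite I" "I \<noteq> {}" "p > 0"
  shows "pow_sum I p x powr (1 / p) \<le> real (card I) powr (1 / p) * max_abs I x"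
proof -
  have "pow_sum I p x \<le> (\<Sum>i\<in>I. max_abs I x powr p)"
    unfolding pow_sum_def using assms abs_le_max_abs by (intro sum_mono powr_mono2) auto
  then have "pow_sum I p x powr (1 / p) \<le> (real (card I) * max_abs I x powr p) powr (1 / p)"
    using assms by (intro powr_mono2) (auto simp: pow_sum_nonneg)
  also have "\<dots> = real (card I) powr (1 / p) * max_abs I x"
    using assms max_abs_nonneg[of I x] by (simp add: powr_mult powr_root)
  finally show ?thesis .
qed

text \<open>One bound for all exponents from \<open>r\<close> on, infinity included; the factor
  stays bounded as soon as \<open>r\<close> has order \<open>ln n\<close>.\<close>

lemma lp_norm_le_max_abs:
  assumes "n > 0" "r > 0" "ereal r \<le> p"
  shows "lp_norm n p x \<le> real n powr (1 / r) * max_abs {..<n} x"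
proof (cases p)
  case (real q)
  have "lp_norm n p x \<le> real n powr (1 / q) * max_abs {..<n} x"
    using pow_sum_root_le_max_abs[of "{..<n}" q x] assms real by (auto simp: lp_norm_real)
  also have "\<dots> \<le> real n powr (1 / r) * max_abs {..<n} x"
    using assms real by (intro mult_right_mono powr_mono max_abs_nonneg) (auto simp: frac_le)
  finally show ?thesis .
next
  case PInf
  have "1 * max_abs {..<n} x \<le> real n powr (1 / r) * max_abs {..<n} x"
    using assms by (intro mult_right_mono max_abs_nonneg ge_one_powr_ge_zero) auto
  then show ?thesis by (simp add: PInf lp_norm_infinity)
qed (use assms in auto)

lemma max_abs_le_lp_norm:
  assumes "n > 0" "0 < p"
  shows "max_abs {..<n} x \<le> lp_norm n p x"
  using assms max_abs_le_pow_sum_root[of "{..<n}" _ x]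
  by (cases p) (auto simp: lp_norm_infinity lp_norm_real)

lemma lp_norm_nonneg:
  assumes "n > 0" "0 < p"
  shows "0 \<le> lp_norm n p x"
  using max_abs_le_lp_norm[OF assms, of x] max_abs_nonneg[of "{..<n}" x] assms
  by (simp add: lessThan_empty_iff bot_nat_def)

text \<open>The concave root is linearized at the larger of the two parts
  \<open>\<bar>x i\<bar> powr p\<close> and the power sum of the rest. If the rest is larger, the
  increment is at most \<open>1 / p\<close> times the norm times a ratio bounded by twice the share
  of coordinate \<open>i\<close>. If \<open>\<bar>x i\<bar> powr p\<close> is larger, the norm
  exceeds \<open>\<bar>x i\<bar>\<close> by such a term only, and what remains is the excess of
  \<open>\<bar>x i\<bar>\<close> over the norm of the rest, which is at least the maximum of the
  rest.\<close>

lemma pow_sum_root_drop_le: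
  fixes x :: "nat \<Rightarrow> real"
  assumes I: "finite I" "i \<in> I" "I - {i} \<noteq> {}" and p: "p \<ge> 1"
  defines "N \<equiv> pow_sum I p x powr (1 / p)"
  shows "N - pow_sum (I - {i}) p x powr (1 / p)
    \<le> max 0 (\<bar>x i\<bar> - max_abs (I - {i}) x) + 2 * N / p * (\<bar>x i\<bar> powr p / pow_sum I p x)"
proof -
  define a where "a = \<bar>x i\<bar>"
  define T where "T = pow_sum (I - {i}) p x"
  define S where "S = pow_sum I p x"
  have S: "S = a powr p + T" unfolding S_def T_def a_def by (rule pow_sum_remove[OF I(1,2)])
  have T0: "0 \<le> T" unfolding T_def by (rule pow_sum_nonneg)
  have a0: "0 \<le> a" by (simp add: a_def)
  have N: "N = S powr (1 / p)" by (simp add: N_def S_def)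
  have N0: "0 \<le> N" by (simp add: N)
  have R: "max_abs (I - {i}) x \<le> T powr (1 / p)"
    unfolding T_def using I p by (intro max_abs_le_pow_sum_root) auto
  have "N - T powr (1 / p) \<le> max 0 (a - T powr (1 / p)) + 2 * N / p * (a powr p / S)"
  proof (cases "a powr p \<le> T")
    case True
    show ?thesis
    proof (cases "T = 0")
      case T: True
      then show ?thesis using True S p by (simp add: N)
    next
      case False
      then have T: "T > 0" using T0 by simp
      have "N - T powr (1 / p) \<le> 1 / p * T powr (1 / p) * ((S - T) / T)"
        unfolding N using p T S by (intro powr_diff_le) auto
      also have "\<dots> \<le> 1 / p * N * (2 * (a powr p / S))"
      proof (intro mult_mono)
        show "T powr (1 / p) \<le> N" unfolding N using S p T by (intro powr_mono2) auto
        have "a powr p * S \<le> a powr p * (2 * T)" using S True by (intro mult_left_mono) auto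
        moreover have "0 < S" using S T by (simp add: add_nonneg_pos)
        ultimately show "(S - T) / T \<le> 2 * (a powr p / S)"
          using S T by (simp add: field_simps)
      qed (use p S T N0 in auto)
      finally show ?thesis by (simp add: mult_ac add_increasing)
    qed
  next
    case False
    then have ap: "a powr p > 0" "a > 0" "S > 0" using T0 S a0 by (auto intro!: neq_le_trans)
    have "S powr (1 / p) - (a powr p) powr (1 / p) \<le> 1 / p * (a powr p) powr (1 / p) * ((S - a powr p) / a powr p)"
      using p ap by (intro powr_diff_le) auto
    then have "N - a \<le> 1 / p * a * (T / a powr p)"
      using p a0 S unfolding N by (simp add: powr_root)
    also have "\<dots> \<le> 1 / p * N * (2 * (a powr p / S))"
    proof (intro mult_mono)
      have "(a powr p) powr (1 / p) \<le> N" unfolding N using S p T0 by (intro powr_mono2) auto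
      then show "a \<le> N" using a0 p by (simp add: powr_root)
      have "T / a powr p \<le> 1" using False ap by simp
      also have "1 \<le> 2 * (a powr p / S)" using False ap S by (simp add: field_simps)
      finally show "T / a powr p \<le> 2 * (a powr p / S)" .
    qed (use p T0 N0 a0 in auto)
    finally show ?thesis by (simp add: mult_ac)
  qed
  also have "max 0 (a - T powr (1 / p)) \<le> max 0 (a - max_abs (I - {i}) x)" using R by auto
  finally show ?thesis by (simp add: a_def S_def T_def)
qed

lemma max_abs_drop_le:
  assumes I: "finite I" "i \<in> I" "I - {i} \<noteq> {}"
  shows "max_abs I x - max_abs I (x(i := 0)) \<le> max 0 (\<bar>x i\<bar> - max_abs (I - {i}) x)"
proof -
  obtain j where j: "j \<in> I" "max_abs I x = \<bar>x j\<bar>" using I max_abs_attained[of I x] by blast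
  obtain k where k: "k \<in> I - {i}" "max_abs (I - {i}) x = \<bar>x k\<bar>" using I max_abs_attained[of "I - {i}" x] by blast
  have 1: "\<bar>x k\<bar> \<le> max_abs I (x(i := 0))"
    using abs_le_max_abs[of I k "x(i := 0)"] I k by simp
  show ?thesis
  proof (cases "j = i")
    case False
    then have "\<bar>x j\<bar> \<le> max_abs I (x(i := 0))" using abs_le_max_abs[of I j "x(i := 0)"] I j by simp
    then show ?thesis using j by simp
  qed (use j k 1 in auto)
qed

lemma max_abs_mono_upd:
  assumes I: "finite I" "i \<in> I"
  shows "max_abs I (x(i := 0)) \<le> max_abs I x"
proof -
  obtain j where j: "j \<in> I" "max_abs I (x(i := 0)) = \<bar>(x(i := 0)) j\<bar>"
    using I max_abs_attained[of I "x(i := 0)"] by blast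
  have "\<bar>(x(i := 0)) j\<bar> \<le> \<bar>x j\<bar>" by simp
  also have "\<dots> \<le> max_abs I x" using I j abs_le_max_abs by blast
  finally show ?thesis using j by simp
qed

text \<open>The shares \<open>w i\<close> of the power sum are at most one and sum to at most one,
  so their squares do too. Hence the second term carries no factor \<open>n\<close>. For
  \<open>p = \<infinity>\<close> only the excess occurs.\<close>

lemma lp_norm_drop_sum_le:
  assumes n: "n \<ge> 2" and r: "r \<ge> 1" "ereal r \<le> p"
  shows "(\<Sum>i<n. (lp_norm n p x - lp_norm n p (x(i := 0)))\<^sup>2)
    \<le> 2 * (\<Sum>i<n. (max 0 (\<bar>x i\<bar> - max_abs ({..<n} - {i}) x))\<^sup>2) + 8 / r\<^sup>2 * (lp_norm n p x)\<^sup>2"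
proof (cases p)
  case (real q)
  define N where "N = lp_norm n p x"
  define S where "S = pow_sum {..<n} q x"
  have q: "q \<ge> r" using r real by simp
  define w where "w i = \<bar>x i\<bar> powr q / S" for i
  have S0: "S \<ge> 0" by (simp add: S_def pow_sum_nonneg)
  have w: "0 \<le> w i" for i using S0 by (simp add: w_def)
  have "(\<Sum>i<n. w i) = S / S" unfolding w_def S_def pow_sum_def by (rule sum_divide_distrib[symmetric])
  \<comment> \<open>Only an inequality: for \<open>S = 0\<close> the quotient \<open>S / S\<close>
    is \<open>0\<close>.\<close>
  then have sw: "(\<Sum>i<n. w i) \<le> 1" by simp
  have "w i \<le> 1" if "i < n" for i
    using member_le_sum[of i "{..<n}" w] w sw that by simp
  then have "(\<Sum>i<n. (w i)\<^sup>2) \<le> (\<Sum>i<n. w i)"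
    using w by (intro sum_mono) (auto simp: power2_eq_square mult_left_le)
  then have sw2: "(\<Sum>i<n. (w i)\<^sup>2) \<le> 1" using sw by simp
  have "(lp_norm n p x - lp_norm n p (x(i := 0)))\<^sup>2
      \<le> 2 * (max 0 (\<bar>x i\<bar> - max_abs ({..<n} - {i}) x))\<^sup>2 + 8 / r\<^sup>2 * N\<^sup>2 * (w i)\<^sup>2" if i: "i < n" for i
  proof -
    have "(if i = 0 then 1 else 0) \<in> {..<n} - {i}" using n by auto
    then have "{..<n} - {i} \<noteq> {}" by blast
    then have *: "lp_norm n p x - lp_norm n p (x(i := 0)) \<le> max 0 (\<bar>x i\<bar> - max_abs ({..<n} - {i}) x) + 2 * N / q * w i"
      using pow_sum_root_drop_le[of "{..<n}" i q x] q r i pow_sum_upd[of "{..<n}" i q x 0] 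
      by (simp add: real lp_norm_real N_def w_def S_def)
    have "2 * N / q * w i \<le> 2 * N / r * w i"
      using q r w[of i] by (intro mult_right_mono divide_left_mono) (auto simp: N_def real lp_norm_real)
    moreover have "pow_sum {..<n} q (x(i := 0)) \<le> pow_sum {..<n} q x"
      using i by (simp add: pow_sum_upd pow_sum_remove[of "{..<n}" i q x])
    then have "0 \<le> lp_norm n p x - lp_norm n p (x(i := 0))"
      unfolding real lp_norm_real using q r pow_sum_nonneg by (simp add: powr_mono2)
    ultimately have "(lp_norm n p x - lp_norm n p (x(i := 0)))\<^sup>2
        \<le> (max 0 (\<bar>x i\<bar> - max_abs ({..<n} - {i}) x) + 2 * N / r * w i)\<^sup>2"
      using * by (intro power_mono) auto
    also have "\<dots> \<le> 2 * (max 0 (\<bar>x i\<bar> - max_abs ({..<n} - {i}) x))\<^sup>2 + 2 * (2 * N / r * w i)\<^sup>2"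
      using sum_squares_bound[of "max 0 (\<bar>x i\<bar> - max_abs ({..<n} - {i}) x)" "2 * N / r * w i"]
      by (simp add: power2_sum)
    finally show ?thesis by (simp add: power_mult_distrib power_divide)
  qed
  then have "(\<Sum>i<n. (lp_norm n p x - lp_norm n p (x(i := 0)))\<^sup>2)
    \<le> (\<Sum>i<n. 2 * (max 0 (\<bar>x i\<bar> - max_abs ({..<n} - {i}) x))\<^sup>2 + 8 / r\<^sup>2 * N\<^sup>2 * (w i)\<^sup>2)"
    by (intro sum_mono) auto
  also have "\<dots> = 2 * (\<Sum>i<n. (max 0 (\<bar>x i\<bar> - max_abs ({..<n} - {i}) x))\<^sup>2) + 8 / r\<^sup>2 * N\<^sup>2 * (\<Sum>i<n. (w i)\<^sup>2)"
    by (simp add: sum.distrib sum_distrib_left)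
  also have "8 / r\<^sup>2 * N\<^sup>2 * (\<Sum>i<n. (w i)\<^sup>2) \<le> 8 / r\<^sup>2 * N\<^sup>2 * 1"
    by (intro mult_left_mono sw2) simp
  finally show ?thesis by (simp add: N_def)
next
  case PInf
  have "(lp_norm n p x - lp_norm n p (x(i := 0)))\<^sup>2 \<le> (max 0 (\<bar>x i\<bar> - max_abs ({..<n} - {i}) x))\<^sup>2"
    if i: "i < n" for i
  proof -
    have "(if i = 0 then 1 else 0) \<in> {..<n} - {i}" using n by auto
    then have "{..<n} - {i} \<noteq> {}" by blast
    then show ?thesis
      using max_abs_drop_le[of "{..<n}" i x] max_abs_mono_upd[of "{..<n}" i x] i
      by (intro power_mono) (auto simp: PInf lp_norm_infinity)
  qed
  then have "(\<Sum>i<n. (lp_norm n p x - lp_norm n p (x(i := 0)))\<^sup>2)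
      \<le> (\<Sum>i<n. (max 0 (\<bar>x i\<bar> - max_abs ({..<n} - {i}) x))\<^sup>2)" by (intro sum_mono) auto
  moreover have "0 \<le> (\<Sum>i<n. (max 0 (\<bar>x i\<bar> - max_abs ({..<n} - {i}) x))\<^sup>2)" by (simp add: sum_nonneg)
  moreover have "0 \<le> 8 / r\<^sup>2 * (lp_norm n p x)\<^sup>2" by simp
  ultimately show ?thesis by linarith
qed (use r in auto)

section \<open>Large exponents: upper bound\<close>

abbreviation gauss_pow :: "nat set \<Rightarrow> (nat \<Rightarrow> real) measure" where
  "gauss_pow I \<equiv> \<Pi>\<^sub>M i\<in>I. gauss"

lemma std_gaussian_eq: "std_gaussian n = gauss_pow {..<n}"
  by (simp add: std_gaussian_def)

lemma measurable_max_abs: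
  assumes "finite I" "I \<noteq> {}" "I \<subseteq> J"
  shows "max_abs I \<in> borel_measurable (gauss_pow J)"
proof -
  have "(\<lambda>x. \<bar>x i\<bar>) \<in> borel_measurable (gauss_pow J)" if "i \<in> I" for i
    using assms that by (auto intro!: borel_measurable_abs measurable_component_singleton)
  then show ?thesis
    unfolding max_abs_def[abs_def] using assms by (intro borel_measurable_Max) auto
qed

lemma measurable_pow_sum:
  assumes "I \<subseteq> J"
  shows "pow_sum I p \<in> borel_measurable (gauss_pow J)"
proof -
  have "(\<lambda>x. \<bar>x i\<bar> powr p) \<in> borel_measurable (gauss_pow J)" if "i \<in> I" for i
  proof -
    have [measurable]: "(\<lambda>x. x i) \<in> borel_measurable (gauss_pow J)"
      using assms that by (auto intro!: measurable_component_singleton)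
    show ?thesis by measurable
  qed
  then show ?thesis unfolding pow_sum_def[abs_def] by (intro borel_measurable_sum) auto
qed

lemma measurable_lp_norm:
  assumes "n > 0" "p \<ge> 1"
  shows "lp_norm n p \<in> borel_measurable (gauss_pow {..<n})"
proof (cases p)
  case (real q)
  have [measurable]: "pow_sum {..<n} q \<in> borel_measurable (gauss_pow {..<n})" by (rule measurable_pow_sum) simp
  show ?thesis unfolding real lp_norm_real[abs_def] by measurable
next
  case PInf
  then show ?thesis
    using assms measurable_max_abs[of "{..<n}" "{..<n}"]
    by (simp add: lp_norm_infinity[abs_def] lessThan_empty_iff bot_nat_def)
qed (use assms in auto)

text \<open>A union bound in integrated form: the maximum is one of the values.\<close>

lemma max_abs_image_le_sum:
  assumes "finite I" "I \<noteq> {}" "\<And>t. 0 \<le> F \<bar>t\<bar>"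
  shows "F (max_abs I x) \<le> (\<Sum>i\<in>I. (F \<bar>x i\<bar> :: real))"
proof -
  obtain i where "i \<in> I" "max_abs I x = \<bar>x i\<bar>" using assms max_abs_attained by blast
  then show ?thesis using member_le_sum[of i I "\<lambda>i. F \<bar>x i\<bar>"] assms by simp
qed

lemma integrable_gauss_square: "integrable gauss (\<lambda>x. x\<^sup>2)"
  using integrable_gauss_powr[of 2] by (simp add: powr_numeral)

lemma lp_norm_square_integrable:
  assumes n: "n > 0" and p: "p \<ge> 1"
  shows "integrable (gauss_pow {..<n}) (\<lambda>x. (lp_norm n p x)\<^sup>2)"
proof (rule Bochner_Integration.integrable_bound)
  interpret prob_space gauss by (rule prob_space_gauss)
  note [measurable] = measurable_lp_norm[OF assms]
  show "integrable (gauss_pow {..<n}) (\<lambda>x. (real n)\<^sup>2 * (\<Sum>i<n. (x i)\<^sup>2))"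
    by (rule Bochner_Integration.integrable_mult_right, rule Bochner_Integration.integrable_sum,
        rule integrable_pow_component[OF _ integrable_gauss_square])
  show "(\<lambda>x. (lp_norm n p x)\<^sup>2) \<in> borel_measurable (gauss_pow {..<n})" by measurable
  have "norm ((lp_norm n p x)\<^sup>2) \<le> norm ((real n)\<^sup>2 * (\<Sum>i<n. (x i)\<^sup>2))" for x
  proof -
    have ne: "{..<n} \<noteq> {}" using n by auto
    have "0 < p" using p by (rule order_less_le_trans[rotated]) simp
    then have "(lp_norm n p x)\<^sup>2 \<le> (real n powr (1 / 1) * max_abs {..<n} x)\<^sup>2"
      using n p by (intro power_mono lp_norm_le_max_abs lp_norm_nonneg) (auto simp: one_ereal_def)
    also have "\<dots> = (real n)\<^sup>2 * (max_abs {..<n} x)\<^sup>2" by (simp add: power_mult_distrib)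
    also have "\<dots> \<le> (real n)\<^sup>2 * (\<Sum>i<n. \<bar>x i\<bar>\<^sup>2)"
      using ne by (intro mult_left_mono max_abs_image_le_sum) auto
    finally show ?thesis by (simp add: sum_nonneg)
  qed
  then show "AE x in gauss_pow {..<n}. norm ((lp_norm n p x)\<^sup>2) \<le> norm ((real n)\<^sup>2 * (\<Sum>i<n. (x i)\<^sup>2))"
    by (rule AE_I2)
qed

lemma nn_integral_max_abs_square_le:
  assumes "n > 0"
  shows "(\<integral>\<^sup>+x. ennreal ((max_abs {..<n} x)\<^sup>2) \<partial>gauss_pow {..<n}) \<le> ennreal (4 * ln (real n) + 8)"
proof -
  interpret prob_space gauss by (rule prob_space_gauss)
  interpret P: prob_space "gauss_pow {..<n}" by (rule prob_space_pow)
  have ne: "{..<n} \<noteq> {}" using assms by auto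
  have ln: "0 \<le> ln (real n)" using assms by simp
  \<comment> \<open>This is \<open>y \<le> exp y\<close> at \<open>y = t\<^sup>2 / 4 - ln n\<close>.
    Applied to the maximum, the exponential is bounded by a sum of \<open>n\<close> terms, each of
    expectation at most 2, and the factor \<open>4 / n\<close> turns this into the constant
    8.\<close>
  have le: "t\<^sup>2 \<le> 4 * ln (real n) + 4 / n * exp (t\<^sup>2 / 4)" for t :: real
  proof -
    have "t\<^sup>2 / 4 - ln (real n) \<le> exp (t\<^sup>2 / 4 - ln (real n))"
      using exp_ge_add_one_self[of "t\<^sup>2 / 4 - ln (real n)"] by linarith
    also have "\<dots> = exp (t\<^sup>2 / 4) / n" using assms by (simp add: exp_diff)
    finally show ?thesis by simp
  qed
  have "(max_abs {..<n} x)\<^sup>2 \<le> 4 * ln (real n) + (\<Sum>i<n. 4 / n * exp (\<bar>x i\<bar>\<^sup>2 / 4))" for x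
    using le[of "max_abs {..<n} x"] max_abs_image_le_sum[of "{..<n}" "\<lambda>t. 4 / n * exp (t\<^sup>2 / 4)" x] ne
    by fastforce
  then have "(\<integral>\<^sup>+x. ennreal ((max_abs {..<n} x)\<^sup>2) \<partial>gauss_pow {..<n})
     \<le> (\<integral>\<^sup>+x. ennreal (4 * ln (real n)) + (\<Sum>i<n. ennreal (4 / n) * ennreal (exp ((x i)\<^sup>2 / 4))) \<partial>gauss_pow {..<n})"
    using ln by (intro nn_integral_mono) (auto simp: ennreal_mult'[symmetric] sum_nonneg simp flip: ennreal_plus intro!: ennreal_leI)
  also have "\<dots> = ennreal (4 * ln (real n)) + (\<Sum>i<n. ennreal (4 / n) * (\<integral>\<^sup>+x. ennreal (exp ((x i)\<^sup>2 / 4)) \<partial>gauss_pow {..<n}))"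
    by (simp add: nn_integral_add nn_integral_sum nn_integral_cmult P.emeasure_space_1)
  also have "\<dots> = ennreal (4 * ln (real n)) + (\<Sum>i<n. ennreal (4 / n) * (\<integral>\<^sup>+t. ennreal (exp (t\<^sup>2 / 4)) \<partial>gauss))"
    by (intro arg_cong2[where f = "(+)"] sum.cong refl arg_cong2[where f = "(*)"]
        nn_integral_pow_component[where h = "\<lambda>t. ennreal (exp (t\<^sup>2 / 4))"]) auto
  also have "\<dots> \<le> ennreal (4 * ln (real n)) + (\<Sum>i<n. ennreal (4 / n) * ennreal 2)"
    using nn_integral_gauss_exp_square by (intro add_left_mono sum_mono mult_left_mono) auto
  also have "(\<Sum>i<n. ennreal (4 / n) * ennreal 2) = (\<Sum>i<n. ennreal (8 / n))"
    by (intro sum.cong refl, subst ennreal_mult'[symmetric]) auto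
  also have "\<dots> = ennreal (\<Sum>i<n. 8 / n)" by (rule sum_ennreal) simp
  also have "(\<Sum>i<n. 8 / n) = 8" using assms by simp
  also have "ennreal (4 * ln (real n)) + ennreal 8 = ennreal (4 * ln (real n) + 8)"
    using ln by (intro ennreal_plus[symmetric]) auto
  finally show ?thesis .
qed

section \<open>Excess of one coordinate over the maximum of the others\<close>

lemma nn_integral_gauss_excess_le_2:
  assumes "m \<ge> 0"
  shows "(\<integral>\<^sup>+x. ennreal ((max 0 (\<bar>x\<bar> - m))\<^sup>2) \<partial>gauss) \<le> 2"
proof -
  have "2 / exp 1 \<le> (1::real)" using exp_ge_add_one_self[of "1::real"] by simp
  then have "moment_scale 2 \<le> 1" by (simp add: moment_scale_def)
  have "(\<integral>\<^sup>+x. ennreal ((max 0 (\<bar>x\<bar> - m))\<^sup>2) \<partial>gauss) \<le> (\<integral>\<^sup>+x. ennreal (\<bar>x\<bar> powr 2) \<partial>gauss)"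
  proof (intro nn_integral_mono ennreal_leI)
    fix x :: real
    have "(max 0 (\<bar>x\<bar> - m))\<^sup>2 \<le> \<bar>x\<bar>\<^sup>2" using assms by (intro power_mono) auto
    then show "(max 0 (\<bar>x\<bar> - m))\<^sup>2 \<le> \<bar>x\<bar> powr 2" by (simp add: powr_numeral)
  qed
  also have "\<dots> \<le> ennreal (2 * moment_scale 2)" by (rule nn_integral_gauss_powr_le) simp
  also have "\<dots> \<le> ennreal 2" using \<open>moment_scale 2 \<le> 1\<close> by (intro ennreal_leI) simp
  finally show ?thesis by simp
qed

text \<open>Two coordinates cannot each be strictly larger than all others; a tie leaves no
  winner.\<close>

lemma sum_winner_le_1:
  assumes "finite I"
  shows "(\<Sum>i\<in>I. indicator {x. max_abs (I - {i}) x < \<bar>x i\<bar>} x) \<le> (1 :: ennreal)"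
proof (cases "\<exists>k\<in>I. max_abs (I - {k}) x < \<bar>x k\<bar>")
  case True
  then obtain k where k: "k \<in> I" "max_abs (I - {k}) x < \<bar>x k\<bar>" by blast
  have "\<not> max_abs (I - {i}) x < \<bar>x i\<bar>" if "i \<in> I - {k}" for i
  proof -
    have "\<bar>x i\<bar> \<le> max_abs (I - {k}) x" "\<bar>x k\<bar> \<le> max_abs (I - {i}) x"
      using that k assms by (auto intro!: abs_le_max_abs)
    then show ?thesis using k by linarith
  qed
  then have "(\<Sum>i\<in>I - {k}. indicator {x. max_abs (I - {i}) x < \<bar>x i\<bar>} x) = (0 :: ennreal)"
    by (intro sum.neutral) (auto simp: indicator_def)
  then show ?thesis using k by (simp add: sum.remove[OF assms k(1)] indicator_def)
next
  case False
  then have "(\<Sum>i\<in>I. indicator {x. max_abs (I - {i}) x < \<bar>x i\<bar>} x) = (0 :: ennreal)"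
    by (intro sum.neutral) (auto simp: indicator_def)
  then show ?thesis by simp
qed

lemma emeasure_max_abs_rest_less:
  assumes I: "finite I" "i \<in> I" "I - {i} \<noteq> {}"
  shows "(\<integral>\<^sup>+x. indicator {x. max_abs (I - {i}) x < a} x \<partial>gauss_pow I)
    \<le> ennreal ((1 - measure gauss {t. a \<le> \<bar>t\<bar>}) ^ (card I - 1))"
proof -
  interpret prob_space gauss by (rule prob_space_gauss)
  interpret P: product_prob_space "\<lambda>_. gauss" by (rule product_prob_space_pow)
  \<comment> \<open>The constant factor 1 at index \<open>i\<close> extends the product to all of
    \<open>I\<close>, so that it can be integrated over the full product space.\<close>
  define f where "f j t = (if j = i then 1 else indicator {t. \<bar>t\<bar> < a} t :: ennreal)" for j t
  have [measurable]: "f j \<in> borel_measurable borel" for j unfolding f_def by (cases "j = i") auto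
  have "indicator {x. max_abs (I - {i}) x < a} x \<le> (\<Prod>j\<in>I. f j (x j))" for x
  proof (cases "max_abs (I - {i}) x < a")
    case True
    then have "f j (x j) = 1" if "j \<in> I" for j
      using abs_le_max_abs[of "I - {i}" j x] that I by (auto simp: f_def)
    then show ?thesis by (simp add: indicator_def)
  qed simp
  then have "(\<integral>\<^sup>+x. indicator {x. max_abs (I - {i}) x < a} x \<partial>gauss_pow I)
     \<le> (\<integral>\<^sup>+x. (\<Prod>j\<in>I. f j (x j)) \<partial>gauss_pow I)" by (intro nn_integral_mono)
  also have "\<dots> = (\<Prod>j\<in>I. \<integral>\<^sup>+t. f j t \<partial>gauss)"
    by (rule P.product_nn_integral_prod) (auto simp: I)
  also have "\<dots> = (\<integral>\<^sup>+t. f i t \<partial>gauss) * (\<Prod>j\<in>I - {i}. \<integral>\<^sup>+t. f j t \<partial>gauss)"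
    using I by (simp add: prod.remove)
  also have "(\<Prod>j\<in>I - {i}. \<integral>\<^sup>+t. f j t \<partial>gauss) = (\<Prod>j\<in>I - {i}. emeasure gauss {t. \<bar>t\<bar> < a})"
    by (intro prod.cong) (auto simp: f_def nn_integral_indicator)
  also have "(\<integral>\<^sup>+t. f i t \<partial>gauss) = 1" using emeasure_space_1 by (simp add: f_def)
  also have "emeasure gauss {t. \<bar>t\<bar> < a} = ennreal (1 - prob {t. a \<le> \<bar>t\<bar>})"
  proof -
    have "prob {t. \<bar>t\<bar> < a} = 1 - prob {t. a \<le> \<bar>t\<bar>}"
      using prob_compl[of "{t. a \<le> \<bar>t\<bar>}"] by (simp add: Compl_eq_Diff_UNIV[symmetric] Collect_neg_eq[symmetric] not_le)
    then show ?thesis by (simp add: emeasure_eq_measure)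
  qed
  finally show ?thesis using I by (simp add: ennreal_power)
qed

text \<open>Given the other coordinates, with maximum \<open>R\<close>, the squared excess is at
  most \<open>16 / (R x)\<^sup>2\<close> times the conditional probability that \<open>i\<close> is
  the strict maximizer. These probabilities sum to at most one over \<open>i\<close>, so the main
  term carries no factor \<open>card I\<close>. Where \<open>R x < a\<close>, the crude bound 2 is
  multiplied by the small probability of that event.\<close>

lemma sum_excess_le:
  assumes I: "finite I" "card I \<ge> 2" and a: "a > 0"
  shows "(\<Sum>i\<in>I. \<integral>\<^sup>+x. ennreal ((max 0 (\<bar>x i\<bar> - max_abs (I - {i}) x))\<^sup>2) \<partial>gauss_pow I)
    \<le> ennreal (16 / a\<^sup>2 + 2 * real (card I) * (1 - measure gauss {t. a \<le> \<bar>t\<bar>}) ^ (card I - 1))"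
proof -
  interpret prob_space gauss by (rule prob_space_gauss)
  interpret P: prob_space "gauss_pow I" by (rule prob_space_pow)
  let ?q = "(1 - measure gauss {t. a \<le> \<bar>t\<bar>}) ^ (card I - 1)"
  have q0: "0 \<le> ?q" by simp
  have ne: "I - {i} \<noteq> {}" if "i \<in> I" for i
  proof
    assume "I - {i} = {}"
    then have "I = {i}" using that by auto
    then have "card I = 1" by simp
    then show False using I by simp
  qed
  have W: "(\<lambda>x. indicator {x. max_abs (I - {i}) x < \<bar>x i\<bar>} x :: ennreal) \<in> borel_measurable (gauss_pow I)"
    if i[measurable]: "i \<in> I" for i
  proof -
    have [measurable]: "max_abs (I - {i}) \<in> borel_measurable (gauss_pow I)"
      using I ne[OF i] by (intro measurable_max_abs) auto
    have "(\<lambda>x. if max_abs (I - {i}) x < \<bar>x i\<bar> then 1 else 0 :: ennreal) \<in> borel_measurable (gauss_pow I)"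
      by measurable
    then show ?thesis by (simp add: indicator_def of_bool_def)
  qed
  have one: "(\<integral>\<^sup>+x. ennreal ((max 0 (\<bar>x i\<bar> - max_abs (I - {i}) x))\<^sup>2) \<partial>gauss_pow I)
     \<le> ennreal (16 / a\<^sup>2) * (\<integral>\<^sup>+x. indicator {x. max_abs (I - {i}) x < \<bar>x i\<bar>} x \<partial>gauss_pow I)
       + ennreal (2 * ?q)" if i[measurable]: "i \<in> I" for i
  proof -
    define R where "R = max_abs (I - {i})"
    have R[measurable]: "R \<in> borel_measurable (gauss_pow I)"
      unfolding R_def using I ne[OF i] by (intro measurable_max_abs) auto
    have R0: "0 \<le> R x" for x unfolding R_def using I ne[OF i] by (intro max_abs_nonneg) auto
    have Ru: "R (x(i := t)) = R x" for x t unfolding R_def by (rule max_abs_upd_other)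
    note Wi = W[OF i, folded R_def]
    have in_le: "(\<integral>\<^sup>+t. ennreal ((max 0 (\<bar>t\<bar> - R x))\<^sup>2) \<partial>gauss)
      \<le> ennreal (16 / a\<^sup>2) * (\<integral>\<^sup>+t. indicator {x. R x < \<bar>x i\<bar>} (x(i := t)) \<partial>gauss) + 2 * indicator {x. R x < a} x" for x
    proof (cases "R x < a")
      case True
      have "(\<integral>\<^sup>+t. ennreal ((max 0 (\<bar>t\<bar> - R x))\<^sup>2) \<partial>gauss) \<le> 2"
        by (rule nn_integral_gauss_excess_le_2[OF R0])
      then show ?thesis using True by (simp add: add_increasing)
    next
      case False
      then have "(\<integral>\<^sup>+t. ennreal ((max 0 (\<bar>t\<bar> - R x))\<^sup>2) \<partial>gauss)
          \<le> ennreal (16 / (R x)\<^sup>2) * emeasure gauss {t. R x < \<bar>t\<bar>}"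
        using a by (intro nn_integral_gauss_excess) auto
      also have "\<dots> \<le> ennreal (16 / a\<^sup>2) * emeasure gauss {t. R x < \<bar>t\<bar>}"
        using a False by (intro mult_right_mono ennreal_leI divide_left_mono power_mono) auto
      also have "emeasure gauss {t. R x < \<bar>t\<bar>} = (\<integral>\<^sup>+t. indicator {x. R x < \<bar>x i\<bar>} (x(i := t)) \<partial>gauss)"
        by (subst nn_integral_indicator[symmetric], simp, intro nn_integral_cong) (simp add: indicator_def Ru)
      finally show ?thesis by (simp add: add_increasing2)
    qed
    have "(\<integral>\<^sup>+x. ennreal ((max 0 (\<bar>x i\<bar> - R x))\<^sup>2) \<partial>gauss_pow I)
       = (\<integral>\<^sup>+x. \<integral>\<^sup>+t. ennreal ((max 0 (\<bar>(x(i := t)) i\<bar> - R (x(i := t))))\<^sup>2) \<partial>gauss \<partial>gauss_pow I)"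
      by (rule nn_integral_pow_upd[OF I(1) i, symmetric]) measurable
    also have "\<dots> = (\<integral>\<^sup>+x. \<integral>\<^sup>+t. ennreal ((max 0 (\<bar>t\<bar> - R x))\<^sup>2) \<partial>gauss \<partial>gauss_pow I)" by (simp add: Ru)
    also have "\<dots> \<le> (\<integral>\<^sup>+x. ennreal (16 / a\<^sup>2) * (\<integral>\<^sup>+t. indicator {x. R x < \<bar>x i\<bar>} (x(i := t)) \<partial>gauss)
        + 2 * indicator {x. R x < a} x \<partial>gauss_pow I)"
      by (intro nn_integral_mono in_le)
    also have "\<dots> = ennreal (16 / a\<^sup>2) * (\<integral>\<^sup>+x. \<integral>\<^sup>+t. indicator {x. R x < \<bar>x i\<bar>} (x(i := t)) \<partial>gauss \<partial>gauss_pow I)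
        + 2 * (\<integral>\<^sup>+x. indicator {x. R x < a} x \<partial>gauss_pow I)"
    proof -
      have [measurable]: "(\<lambda>x. indicator {x. R x < a} x :: ennreal) \<in> borel_measurable (gauss_pow I)"
      proof -
        have "(\<lambda>x. if R x < a then 1 else 0 :: ennreal) \<in> borel_measurable (gauss_pow I)" by measurable
        then show ?thesis by (simp add: indicator_def of_bool_def)
      qed
      note [measurable] = Wi
      have [measurable]: "(\<lambda>x. \<integral>\<^sup>+t. indicator {x. R x < \<bar>x i\<bar>} (x(i := t)) \<partial>gauss) \<in> borel_measurable (gauss_pow I)"
        by measurable
      show ?thesis by (simp add: nn_integral_add nn_integral_cmult)
    qed
    \<comment> \<open>Resampling coordinate \<open>i\<close> turns the averaged conditional
      probability back into the probability that \<open>i\<close> is the maximizer.\<close>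
    also have "(\<integral>\<^sup>+x. \<integral>\<^sup>+t. indicator {x. R x < \<bar>x i\<bar>} (x(i := t)) \<partial>gauss \<partial>gauss_pow I)
        = (\<integral>\<^sup>+x. indicator {x. R x < \<bar>x i\<bar>} x \<partial>gauss_pow I)"
      by (rule nn_integral_pow_upd[OF I(1) i Wi])
    finally have "(\<integral>\<^sup>+x. ennreal ((max 0 (\<bar>x i\<bar> - R x))\<^sup>2) \<partial>gauss_pow I)
      \<le> ennreal (16 / a\<^sup>2) * (\<integral>\<^sup>+x. indicator {x. R x < \<bar>x i\<bar>} x \<partial>gauss_pow I) + 2 * (\<integral>\<^sup>+x. indicator {x. R x < a} x \<partial>gauss_pow I)" .
    also have "\<dots> \<le> ennreal (16 / a\<^sup>2) * (\<integral>\<^sup>+x. indicator {x. R x < \<bar>x i\<bar>} x \<partial>gauss_pow I) + 2 * ennreal ?q"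
      unfolding R_def by (intro add_left_mono mult_left_mono emeasure_max_abs_rest_less I(1) i ne) simp
    finally show ?thesis by (simp add: R_def ennreal_mult')
  qed
  have "(\<Sum>i\<in>I. \<integral>\<^sup>+x. ennreal ((max 0 (\<bar>x i\<bar> - max_abs (I - {i}) x))\<^sup>2) \<partial>gauss_pow I)
    \<le> (\<Sum>i\<in>I. ennreal (16 / a\<^sup>2) * (\<integral>\<^sup>+x. indicator {x. max_abs (I - {i}) x < \<bar>x i\<bar>} x \<partial>gauss_pow I)
       + ennreal (2 * ?q))"
    by (intro sum_mono one)
  also have "\<dots> = ennreal (16 / a\<^sup>2) * (\<Sum>i\<in>I. \<integral>\<^sup>+x. indicator {x. max_abs (I - {i}) x < \<bar>x i\<bar>} x \<partial>gauss_pow I)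
      + (\<Sum>i\<in>I. ennreal (2 * ?q))"
    by (simp add: sum.distrib sum_distrib_left)
  also have "(\<Sum>i\<in>I. \<integral>\<^sup>+x. indicator {x. max_abs (I - {i}) x < \<bar>x i\<bar>} x \<partial>gauss_pow I)
      = (\<integral>\<^sup>+x. (\<Sum>i\<in>I. indicator {x. max_abs (I - {i}) x < \<bar>x i\<bar>} x) \<partial>gauss_pow I)"
    by (rule nn_integral_sum[symmetric]) (rule W)
  also have "ennreal (16 / a\<^sup>2) * \<dots> \<le> ennreal (16 / a\<^sup>2) * (\<integral>\<^sup>+x. 1 \<partial>gauss_pow I)"
    by (intro mult_left_mono nn_integral_mono sum_winner_le_1 I) simp
  also have "\<dots> = ennreal (16 / a\<^sup>2)" using P.emeasure_space_1 by simp
  also have "(\<Sum>i\<in>I. ennreal (2 * ?q)) = ennreal (\<Sum>i\<in>I. 2 * ?q)" by (rule sum_ennreal) simp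
  also have "ennreal (16 / a\<^sup>2) + ennreal (\<Sum>i\<in>I. 2 * ?q) = ennreal (16 / a\<^sup>2 + (\<Sum>i\<in>I. 2 * ?q))"
    by (rule ennreal_plus[symmetric]) (use q0 in auto)
  also have "(\<Sum>i\<in>I. 2 * ?q) = 2 * card I * ?q" by simp
  finally show ?thesis by (simp add: add_left_mono)
qed

lemma var_lp_norm_eq:
  "var_lp_norm n p = prob_space.variance (gauss_pow {..<n}) (lp_norm n p)"
  by (simp add: var_lp_norm_def std_gaussian_eq)

text \<open>Two parameters stay free: \<open>a\<close> should be a level that the maximum exceeds
  with overwhelming probability, \<open>r\<close> an exponent of order \<open>ln n\<close>. The
  factors 8 and 32 are the 4 from setting a coordinate to zero times the 2 and 8 of
  \<open>lp_norm_drop_sum_le\<close>.\<close>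

lemma var_lp_norm_le:
  assumes n: "n \<ge> 2" and r: "r \<ge> 1" "ereal r \<le> p" and a: "a > 0"
  shows "var_lp_norm n p \<le> 8 * (16 / a\<^sup>2 + 2 * real n * (1 - measure gauss {t. a \<le> \<bar>t\<bar>}) ^ (n - 1))
    + 32 / r\<^sup>2 * real n powr (2 / r) * (4 * ln (real n) + 8)"
proof -
  interpret prob_space gauss by (rule prob_space_gauss)
  have p: "p \<ge> 1" using r by (metis ereal_less_eq(3) one_ereal_def order_trans)
  have p0: "0 < p" using p by (rule order_less_le_trans[rotated]) simp
  have n0: "n > 0" using n by simp
  have ne: "{..<n} \<noteq> {}" using n0 by auto
  note [measurable] = measurable_lp_norm[OF n0 p]
  have M[measurable]: "max_abs {..<n} \<in> borel_measurable (gauss_pow {..<n})"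
    using ne by (intro measurable_max_abs) auto
  define e where "e i x = (max 0 (\<bar>x i\<bar> - max_abs ({..<n} - {i}) x))\<^sup>2" for i x
  have [measurable]: "e i \<in> borel_measurable (gauss_pow {..<n})" if "i < n" for i
  proof -
    have "(if i = 0 then 1 else 0) \<in> {..<n} - {i}" using n by auto
    then have "max_abs ({..<n} - {i}) \<in> borel_measurable (gauss_pow {..<n})"
      by (intro measurable_max_abs) auto
    note [measurable] = this
    have [measurable]: "i \<in> {..<n}" using that by simp
    show ?thesis unfolding e_def by measurable
  qed
  let ?X = "16 / a\<^sup>2 + 2 * real n * (1 - prob {t. a \<le> \<bar>t\<bar>}) ^ (n - 1)"
  let ?Y = "8 / r\<^sup>2 * real n powr (2 / r)"
  have X0: "0 \<le> ?X" by simp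
  have "ennreal (var_lp_norm n p)
      \<le> 4 * (\<Sum>i<n. \<integral>\<^sup>+x. ennreal ((lp_norm n p x - lp_norm n p (x(i := 0)))\<^sup>2) \<partial>gauss_pow {..<n})"
    unfolding var_lp_norm_eq
    by (rule efron_stein_replace) (use n0 p in \<open>auto intro: measurable_lp_norm lp_norm_square_integrable\<close>)
  also have "(\<Sum>i<n. \<integral>\<^sup>+x. ennreal ((lp_norm n p x - lp_norm n p (x(i := 0)))\<^sup>2) \<partial>gauss_pow {..<n})
     = (\<integral>\<^sup>+x. ennreal (\<Sum>i<n. (lp_norm n p x - lp_norm n p (x(i := 0)))\<^sup>2) \<partial>gauss_pow {..<n})"
  proof (subst nn_integral_sum[symmetric])
    fix i assume [measurable]: "i \<in> {..<n}"
    show "(\<lambda>x. ennreal ((lp_norm n p x - lp_norm n p (x(i := 0)))\<^sup>2)) \<in> borel_measurable (gauss_pow {..<n})"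
      by measurable
  qed (simp add: sum_ennreal)
  also have "\<dots> \<le> (\<integral>\<^sup>+x. ennreal 2 * (\<Sum>i<n. ennreal (e i x)) + ennreal ?Y * ennreal ((max_abs {..<n} x)\<^sup>2) \<partial>gauss_pow {..<n})"
  proof (intro nn_integral_mono)
    fix x :: "nat \<Rightarrow> real"
    have "(lp_norm n p x)\<^sup>2 \<le> (real n powr (1 / r) * max_abs {..<n} x)\<^sup>2"
      using n0 r p0 by (intro power_mono lp_norm_le_max_abs lp_norm_nonneg) auto
    also have "\<dots> = real n powr (2 / r) * (max_abs {..<n} x)\<^sup>2"
      using n0 by (simp add: power_mult_distrib powr_power)
    finally have "8 / r\<^sup>2 * (lp_norm n p x)\<^sup>2 \<le> 8 / r\<^sup>2 * (real n powr (2 / r) * (max_abs {..<n} x)\<^sup>2)"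
      by (intro mult_left_mono) auto
    then have "(\<Sum>i<n. (lp_norm n p x - lp_norm n p (x(i := 0)))\<^sup>2) \<le> 2 * (\<Sum>i<n. e i x) + ?Y * (max_abs {..<n} x)\<^sup>2"
      using lp_norm_drop_sum_le[OF n r, of x] by (simp add: e_def mult.assoc)
    then have "ennreal (\<Sum>i<n. (lp_norm n p x - lp_norm n p (x(i := 0)))\<^sup>2)
        \<le> ennreal (2 * (\<Sum>i<n. e i x) + ?Y * (max_abs {..<n} x)\<^sup>2)" by (rule ennreal_leI)
    also have "\<dots> = ennreal (2 * (\<Sum>i<n. e i x)) + ennreal (?Y * (max_abs {..<n} x)\<^sup>2)"
      by (rule ennreal_plus) (auto simp: e_def sum_nonneg)
    also have "ennreal (2 * (\<Sum>i<n. e i x)) = ennreal 2 * (\<Sum>i<n. ennreal (e i x))"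
      by (subst sum_ennreal) (auto simp: e_def ennreal_mult')
    also have "ennreal (?Y * (max_abs {..<n} x)\<^sup>2) = ennreal ?Y * ennreal ((max_abs {..<n} x)\<^sup>2)"
      by (rule ennreal_mult') simp
    finally show "ennreal (\<Sum>i<n. (lp_norm n p x - lp_norm n p (x(i := 0)))\<^sup>2)
        \<le> ennreal 2 * (\<Sum>i<n. ennreal (e i x)) + ennreal ?Y * ennreal ((max_abs {..<n} x)\<^sup>2)" .
  qed
  also have "\<dots> = ennreal 2 * (\<Sum>i<n. \<integral>\<^sup>+x. ennreal (e i x) \<partial>gauss_pow {..<n})
      + ennreal ?Y * (\<integral>\<^sup>+x. ennreal ((max_abs {..<n} x)\<^sup>2) \<partial>gauss_pow {..<n})"
  proof -
    have s: "(\<integral>\<^sup>+x. (\<Sum>i<n. ennreal (e i x)) \<partial>gauss_pow {..<n}) = (\<Sum>i<n. \<integral>\<^sup>+x. ennreal (e i x) \<partial>gauss_pow {..<n})"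
      by (rule nn_integral_sum) auto
    have [measurable]: "(\<lambda>x. \<Sum>i<n. ennreal (e i x)) \<in> borel_measurable (gauss_pow {..<n})"
      by (rule borel_measurable_sum) auto
    show ?thesis by (subst nn_integral_add, measurable, subst nn_integral_cmult, measurable,
        subst nn_integral_cmult, measurable, simp only: s)
  qed
  also have "\<dots> \<le> ennreal 2 * ennreal ?X + ennreal ?Y * ennreal (4 * ln (real n) + 8)"
    unfolding e_def using sum_excess_le[of "{..<n}" a] n a nn_integral_max_abs_square_le[OF n0]
    by (intro add_mono mult_left_mono) auto
  also have "\<dots> = ennreal (2 * ?X + ?Y * (4 * ln (real n) + 8))"
    using X0 n0 by (subst (1 2) ennreal_mult'[symmetric], simp, simp, subst ennreal_plus[symmetric]) auto
  finally have "ennreal (var_lp_norm n p) \<le> 4 * ennreal (2 * ?X + ?Y * (4 * ln (real n) + 8))"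
    by (simp add: mult_left_mono)
  also have "\<dots> = ennreal (4 * (2 * ?X + ?Y * (4 * ln (real n) + 8)))"
    by (subst ennreal_mult') auto
  finally have "var_lp_norm n p \<le> 4 * (2 * ?X + ?Y * (4 * ln (real n) + 8))"
    using X0 n0 by (subst (asm) ennreal_le_iff) auto
  then show ?thesis by (simp add: algebra_simps)
qed

lemma sqrt_2pi_le_3: "sqrt (2 * pi) \<le> 3"
  using pi_less_4 by (intro real_le_lsqrt) auto

lemma var_lp_norm_large_exponent:
  "\<exists>C>0. \<forall>\<^sub>F n in sequentially. \<forall>p. p > ereal (1 / 4 * ln (real n)) \<longrightarrow> var_lp_norm n p \<le> C / ln (real n)"
proof (intro exI conjI)
  \<comment> \<open>With \<open>L = ln n\<close>: 65 is 64 from \<open>16 / a\<^sup>2\<close> plus 1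
    from the event that the other coordinates stay below \<open>a\<close>. In the second summand
    \<open>r = L / 4\<close> gives 16 from \<open>1 / r\<^sup>2\<close> and \<open>exp 8\<close>
    from \<open>real n powr (2 / r)\<close>, and 12 comes from
    \<open>4 * L + 8 \<le> 12 * L\<close>.\<close>
  let ?C = "8 * 65 + 32 * 16 * exp 8 * 12 :: real"
  show "?C > 0" by (simp add: add_pos_pos)
  have asym: "\<forall>\<^sub>F n in sequentially. 2 * real n * exp (- sqrt (real n) / 6) \<le> 1 / ln (real n)"
    by real_asymp
  have "\<forall>\<^sub>F n in sequentially. 4 \<le> ln (real n)" by real_asymp
  then show "\<forall>\<^sub>F n in sequentially. \<forall>p. p > ereal (1 / 4 * ln (real n)) \<longrightarrow> var_lp_norm n p \<le> ?C / ln (real n)"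
    using asym eventually_ge_at_top[of 2]
  proof eventually_elim
    case (elim n)
    define L where "L = ln (real n)"
    have L: "L \<ge> 4" "real n = exp L" using elim by (auto simp: L_def)
    \<comment> \<open>The unit interval from \<open>a\<close> to \<open>sqrt L\<close> already has
      mass of order \<open>exp (- L / 2) = 1 / sqrt n\<close>, so the expected number of coordinates
      beyond \<open>a\<close> is at least of order \<open>sqrt n\<close>, while \<open>a\<close>
      itself still has order \<open>sqrt L\<close>.\<close>
    define a where "a = sqrt L - 1"
    have sL: "sqrt L \<ge> 2" using L by (intro real_le_rsqrt) auto
    have a: "a > 0" "sqrt L / 2 \<le> a" using sL L by (auto simp: a_def)
    have "(sqrt L / 2)\<^sup>2 \<le> a\<^sup>2" using a sL L by (intro power_mono) auto
    then have "L / 4 \<le> a\<^sup>2" using L by (simp add: power_divide)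
    then have "16 / a\<^sup>2 \<le> 16 / (L / 4)" using L a by (intro divide_left_mono) auto
    then have A: "16 / a\<^sup>2 \<le> 64 / L" by simp
    define \<psi> where "\<psi> = measure gauss {t. a \<le> \<bar>t\<bar>}"
    interpret prob_space gauss by (rule prob_space_gauss)
    have aL: "(a + 1)\<^sup>2 = L" using L by (simp add: a_def)
    have "exp (- L / 2) / 3 \<le> exp (- L / 2) / sqrt (2 * pi)"
      using sqrt_2pi_le_3 by (intro divide_left_mono) auto
    also have "\<dots> \<le> \<psi>" unfolding \<psi>_def aL[symmetric] using a by (intro gauss_tail_ge) simp
    finally have psi: "exp (- L / 2) / 3 \<le> \<psi>" .
    have psi1: "0 \<le> 1 - \<psi>" unfolding \<psi>_def by simp
    have "sqrt (real n) = exp (L / 2)"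
      unfolding L(2) by (intro real_sqrt_unique) (auto simp flip: exp_double)
    moreover have "exp L * exp (- L / 2) = exp (L / 2)" by (simp flip: exp_add)
    \<comment> \<open>Half of \<open>n = exp L\<close> is at most \<open>n - 1\<close>, because
      \<open>n \<ge> 2\<close>.\<close>
    ultimately have "sqrt (real n) / 6 = exp L / 2 * (exp (- L / 2) / 3)" by simp
    also have "\<dots> \<le> real (n - 1) * \<psi>"
      using elim psi by (intro mult_mono) (auto simp flip: L(2) simp: of_nat_diff)
    finally have "- (real (n - 1) * \<psi>) \<le> - sqrt (real n) / 6" by simp
    have "(1 - \<psi>) ^ (n - 1) \<le> exp (- \<psi>) ^ (n - 1)"
      using exp_ge_add_one_self[of "- \<psi>"] psi1 by (intro power_mono) auto
    also have "\<dots> = exp (- (real (n - 1) * \<psi>))" by (simp flip: exp_of_nat_mult)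
    also have "\<dots> \<le> exp (- sqrt (real n) / 6)" by (simp only: exp_le_cancel_iff) fact
    finally have "2 * real n * (1 - \<psi>) ^ (n - 1) \<le> 2 * real n * exp (- sqrt (real n) / 6)"
      by (intro mult_left_mono) auto
    also have "\<dots> \<le> 1 / L" using elim by (simp only: L_def)
    finally have B: "2 * real n * (1 - \<psi>) ^ (n - 1) \<le> 1 / L" by simp
    show ?case
    proof (intro allI impI)
      fix p assume p: "p > ereal (1 / 4 * ln (real n))"
      have "var_lp_norm n p \<le> 8 * (16 / a\<^sup>2 + 2 * real n * (1 - \<psi>) ^ (n - 1))
          + 32 / (L / 4)\<^sup>2 * real n powr (2 / (L / 4)) * (4 * ln (real n) + 8)"
        unfolding \<psi>_def
      proof (rule var_lp_norm_le)
        have "1 / 4 * ln (real n) = L / 4" by (simp add: L_def)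
        then show "ereal (L / 4) \<le> p" using p by (simp add: less_imp_le)
      qed (use elim L a in auto)
      also have "real n powr (2 / (L / 4)) = exp 8" using L by (simp add: powr_def)
      also have "8 * (16 / a\<^sup>2 + 2 * real n * (1 - \<psi>) ^ (n - 1)) \<le> 8 * 65 / L" using A B by (simp add: add_divide_distrib)
      also have "32 / (L / 4)\<^sup>2 * exp 8 * (4 * ln (real n) + 8) \<le> 32 / (L / 4)\<^sup>2 * exp 8 * (12 * L)"
        using L by (intro mult_left_mono) (auto simp: L_def[symmetric])
      also have "32 / (L / 4)\<^sup>2 * exp 8 * (12 * L) = 32 * 16 * exp 8 * 12 / L"
        using L by (simp add: power2_eq_square field_simps)
      finally show "var_lp_norm n p \<le> ?C / ln (real n)"
        by (simp add: L_def add_divide_distrib)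
    qed
  qed
qed

section \<open>Large exponents: lower bound\<close>

text \<open>The mean is at distance at least \<open>(v - u) / 2\<close> from one of the half-lines
  below \<open>u\<close> and above \<open>v\<close>; Chebyshev's inequality, read as a lower bound
  for the variance, does the rest.\<close>

lemma (in prob_space) variance_ge_two_values:
  fixes X :: "'a \<Rightarrow> real"
  assumes [measurable]: "X \<in> borel_measurable M" and X2: "integrable M (\<lambda>x. (X x)\<^sup>2)" and uv: "u < v"
    and c: "c \<le> prob {x \<in> space M. X x \<le> u}" "c \<le> prob {x \<in> space M. v \<le> X x}"
  shows "c * (v - u)\<^sup>2 / 4 \<le> variance X"
proof -
  define d where "d = (v - u) / 2"
  have d: "d > 0" using uv by (simp add: d_def)
  have "c \<le> prob {x \<in> space M. d \<le> \<bar>X x - expectation X\<bar>}"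
  proof (cases "expectation X \<ge> (u + v) / 2")
    case True
    have "prob {x \<in> space M. X x \<le> u} \<le> prob {x \<in> space M. d \<le> \<bar>X x - expectation X\<bar>}"
      using True by (intro finite_measure_mono) (auto simp: d_def abs_if field_simps)
    then show ?thesis using c by simp
  next
    case False
    have "prob {x \<in> space M. v \<le> X x} \<le> prob {x \<in> space M. d \<le> \<bar>X x - expectation X\<bar>}"
      using False by (intro finite_measure_mono) (auto simp: d_def abs_if field_simps)
    then show ?thesis using c by simp
  qed
  also have "\<dots> \<le> variance X / d\<^sup>2"
    using Chebyshev_inequality[OF assms(1) X2 d] by simp
  finally have "c * d\<^sup>2 \<le> variance X" using d by (simp add: field_simps)
  then show ?thesis by (simp add: d_def power_divide)
qed

lemma measure_gauss_pow_cube: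
  assumes "finite I"
  shows "measure (gauss_pow I) (\<Pi>\<^sub>E i\<in>I. {t. \<bar>t\<bar> \<le> b}) = (1 - measure gauss {t. b < \<bar>t\<bar>}) ^ card I"
proof -
  interpret prob_space gauss by (rule prob_space_gauss)
  interpret P: product_prob_space "\<lambda>_. gauss" by (rule product_prob_space_pow)
  have "prob {t. \<bar>t\<bar> \<le> b} = 1 - prob {t. b < \<bar>t\<bar>}"
    using prob_compl[of "{t. b < \<bar>t\<bar>}"] by (simp add: Compl_eq_Diff_UNIV[symmetric] Collect_neg_eq[symmetric] not_less)
  then have "emeasure (gauss_pow I) (\<Pi>\<^sub>E i\<in>I. {t. \<bar>t\<bar> \<le> b}) = ennreal ((1 - prob {t. b < \<bar>t\<bar>}) ^ card I)"
    using assms by (subst P.emeasure_PiM) (auto simp: emeasure_eq_measure ennreal_power)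
  then show ?thesis by (simp add: measure_def[of "gauss_pow I"])
qed

lemma one_minus_inverse_power_ge:
  assumes "n \<ge> 2"
  shows "exp (- 2) \<le> (1 - 1 / real n) ^ n"
proof -
  have n: "real n \<ge> 2" using assms by simp
  then have "- (1 / real n) - 2 * (1 / real n)\<^sup>2 \<le> ln (1 - 1 / real n)"
    by (intro ln_one_minus_pos_lower_bound) auto
  then have "real n * (- (1 / real n) - 2 * (1 / real n)\<^sup>2) \<le> real n * ln (1 - 1 / real n)"
    by (intro mult_left_mono) auto
  moreover have "real n * (- (1 / real n) - 2 * (1 / real n)\<^sup>2) = - 1 - 2 / real n"
    using n by (simp add: power2_eq_square field_simps)
  moreover have "2 / real n \<le> 1" using n by simp
  ultimately have "- 2 \<le> real n * ln (1 - 1 / real n)" by linarith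
  then have "exp (- 2) \<le> exp (real n * ln (1 - 1 / real n))" by simp
  also have "\<dots> = (1 - 1 / real n) ^ n" using n by (simp add: exp_of_nat_mult)
  finally show ?thesis .
qed

text \<open>A grid point of mesh \<^term>\<open>1 / sqrt (ln (real n))\<close> replaces the exact quantile of order
  \<^term>\<open>1 / real n\<close>.\<close>

lemma gauss_tail_grid_point:
  assumes n: "ln (real n) \<ge> 4"
  defines "s \<equiv> sqrt (ln (real n))"
  obtains b where "0 \<le> b" "b \<le> 3 * s" "1 / real n \<le> measure gauss {t. b < \<bar>t\<bar>}"
    "measure gauss {t. b + 1 / s < \<bar>t\<bar>} \<le> 1 / real n"
proof -
  interpret prob_space gauss by (rule prob_space_gauss)
  define \<psi> where "\<psi> b = measure gauss {t. b < \<bar>t\<bar>}" for b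
  have n0: "n > 0" using n by (cases n) auto
  have s: "s \<ge> 2" "ln (real n) = s\<^sup>2" using n unfolding s_def by (auto intro: real_le_rsqrt)
  have en: "real n = exp (s\<^sup>2)" using s(2) n0 by (simp flip: s(2))
  have lt: "2 * exp (- t\<^sup>2 / 4) < 1 / real n" if "t \<ge> 3 * s" for t
  proof -
    have "(3 * s)\<^sup>2 \<le> t\<^sup>2" using that s by (intro power_mono) auto
    then have "9 * s\<^sup>2 \<le> t\<^sup>2" by (simp add: power_mult_distrib)
    moreover have "4 \<le> s\<^sup>2" using n s by simp
    \<comment> \<open>The summand 1 absorbs the prefactor 2 of the tail bound through
      \<open>2 \<le> exp 1\<close>.\<close>
    ultimately have "1 + - t\<^sup>2 / 4 < - s\<^sup>2" by simp
    then have "exp (1 + - t\<^sup>2 / 4) < exp (- s\<^sup>2)" by (simp only: exp_less_cancel_iff)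
    moreover have "2 \<le> exp (1::real)" using exp_ge_add_one_self[of "1::real"] by simp
    then have "2 * exp (- t\<^sup>2 / 4) \<le> exp 1 * exp (- t\<^sup>2 / 4)" by (intro mult_right_mono) auto
    moreover have "exp (1 + - t\<^sup>2 / 4) = exp 1 * exp (- t\<^sup>2 / 4)" by (rule exp_add)
    moreover have "1 / real n = exp (- s\<^sup>2)" by (simp add: en exp_minus field_simps)
    ultimately show ?thesis by linarith
  qed
  have small: "\<psi> t \<le> 1 / real n" if "t \<ge> 3 * s" for t
    using gauss_tail_le[of t] lt[OF that] that s unfolding \<psi>_def by simp
  \<comment> \<open>Grid index 0 does not qualify, so the least qualifying index has a predecessor;
    that predecessor is the point \<open>b\<close>.\<close>
  have zero: "\<not> \<psi> 0 \<le> 1 / real n"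
  proof -
    have "exp (- (1 + 1)\<^sup>2 / 2) / sqrt (2 * pi) \<le> prob {t. 1 \<le> \<bar>t\<bar>}" by (rule gauss_tail_ge) simp
    also have "\<dots> \<le> \<psi> 0" unfolding \<psi>_def by (intro finite_measure_mono) auto
    finally have 1: "exp (- 2) / sqrt (2 * pi) \<le> \<psi> 0" by simp
    have "3 < exp (2::real)" using exp_lower_Taylor_quadratic[of "2::real"] by simp
    then have "sqrt (2 * pi) < exp 2" using sqrt_2pi_le_3 by linarith
    then have "exp (- 4) < exp (- 2) / sqrt (2 * pi)"
      by (simp add: exp_minus field_simps flip: exp_add) (simp add: exp_add[of 2 2, simplified])
    moreover have "1 / real n \<le> exp (- 4)" using n s by (simp add: en exp_minus field_simps)
    ultimately show ?thesis using 1 by linarith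
  qed
  have K: "\<psi> (real (nat \<lceil>3 * s * s\<rceil>) / s) \<le> 1 / real n"
    using s real_nat_ceiling_ge[of "3 * s * s"] by (intro small) (simp add: pos_le_divide_eq)
  obtain k where k: "\<And>i. i < k \<Longrightarrow> \<not> \<psi> (real i / s) \<le> 1 / real n" "\<psi> (real k / s) \<le> 1 / real n"
    using ex_least_nat_le[of "\<lambda>k. \<psi> (real k / s) \<le> 1 / real n", OF K] by blast
  have "k \<noteq> 0" using k zero by (metis div_0 of_nat_0)
  then obtain j where j: "k = Suc j" by (cases k) auto
  show thesis
  proof (rule that[of "real j / s"])
    show "1 / real n \<le> measure gauss {t. real j / s < \<bar>t\<bar>}" using k(1)[of j] j by (simp add: \<psi>_def)
    have "\<not> real j / s \<ge> 3 * s" using k(1)[of j] j small by auto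
    then show "real j / s \<le> 3 * s" by simp
    have "real j / s + 1 / s = real k / s" using j by (simp add: add_divide_distrib add.commute)
    then show "measure gauss {t. real j / s + 1 / s < \<bar>t\<bar>} \<le> 1 / real n" using k(2) by (simp add: \<psi>_def)
  qed (use s in auto)
qed

lemma var_lp_norm_ge_large_exponent:
  "\<exists>c>0. \<forall>\<^sub>F n in sequentially. \<forall>p. p \<ge> ereal ((ln (real n))\<^sup>2) \<longrightarrow> c / ln (real n) \<le> var_lp_norm n p"
proof (intro exI conjI)
  \<comment> \<open>Raising the level from \<open>b\<close> to \<open>b + 10 / s\<close> costs the
    tail at most a factor \<open>2 * exp 130\<close>: \<open>b * (10 / s) \<le> 30\<close> since
    \<open>b \<le> 3 * s\<close>, and \<open>(10 / s)\<^sup>2 \<le> 100\<close>. Hence the tail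
    beyond \<open>v\<close> is at least \<open>h / n\<close>.\<close>
  define h where "h = exp (- 130) / (2::real)"
  let ?c = "min (exp (- 2)) (1 - exp (- h)) / 4"
  show "?c > 0" by (simp add: h_def)
  have "\<forall>\<^sub>F n in sequentially. 4 \<le> ln (real n)" by real_asymp
  then show "\<forall>\<^sub>F n in sequentially. \<forall>p. p \<ge> ereal ((ln (real n))\<^sup>2) \<longrightarrow> ?c / ln (real n) \<le> var_lp_norm n p"
    using eventually_ge_at_top[of 2]
  proof (eventually_elim, intro allI impI)
    fix n :: nat and p :: ereal assume n: "4 \<le> ln (real n)" "2 \<le> n" and p: "ereal ((ln (real n))\<^sup>2) \<le> p"
    interpret prob_space gauss by (rule prob_space_gauss)
    interpret P: prob_space "gauss_pow {..<n}" by (rule prob_space_pow)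
    define s where "s = sqrt (ln (real n))"
    have s: "s \<ge> 2" "ln (real n) = s\<^sup>2" using n unfolding s_def by (auto intro: real_le_rsqrt)
    have s4: "s\<^sup>2 \<ge> 4" using n s by simp
    have en: "real n = exp (s\<^sup>2)" using s(2) n by (simp flip: s(2))
    obtain b where b: "0 \<le> b" "b \<le> 3 * s" "1 / real n \<le> measure gauss {t. b < \<bar>t\<bar>}"
      "measure gauss {t. b + 1 / s < \<bar>t\<bar>} \<le> 1 / real n"
      using gauss_tail_grid_point[OF n(1)] unfolding s_def by blast
    have "1 \<le> (ln (real n))\<^sup>2" using n(1) by (simp add: one_le_power)
    then have "ereal 1 \<le> p" using p by (metis ereal_less_eq(3) order_trans)
    then have p1: "1 \<le> p" by (simp add: one_ereal_def)
    have p0: "0 < p" using p1 by (rule order_less_le_trans[rotated]) simp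
    have n0: "n > 0" using n by simp
    have ne: "{..<n} \<noteq> {}" using n0 by auto
    note [measurable] = measurable_lp_norm[OF n0 p1]
    \<comment> \<open>On the event that all coordinates are at most
      \<open>b + 1 / s \<le> 4 * s\<close>, the norm is larger by a factor of at most
      \<open>1 + 2 / s\<^sup>2\<close>, that is, by at most \<open>8 / s\<close>. This makes
      \<open>9 / s\<close> in \<open>u\<close>; one further step \<open>1 / s\<close> gives
      \<open>v\<close> and the gap that determines the variance.\<close>
    define u where "u = b + 9 / s"
    define v where "v = b + 10 / s"
    have lower: "exp (- 2) \<le> P.prob {x \<in> space (gauss_pow {..<n}). lp_norm n p x \<le> u}"
    proof -
      have "exp (- 2) \<le> (1 - 1 / real n) ^ n" by (rule one_minus_inverse_power_ge) fact
      also have "\<dots> \<le> (1 - prob {t. b + 1 / s < \<bar>t\<bar>}) ^ n" using b n by (intro power_mono) auto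
      also have "\<dots> = P.prob (\<Pi>\<^sub>E i\<in>{..<n}. {t. \<bar>t\<bar> \<le> b + 1 / s})"
        by (simp add: measure_gauss_pow_cube)
      also have "\<dots> \<le> P.prob {x \<in> space (gauss_pow {..<n}). lp_norm n p x \<le> u}"
      proof (intro P.finite_measure_mono subsetI CollectI conjI)
        fix x assume x: "x \<in> (\<Pi>\<^sub>E i\<in>{..<n}. {t. \<bar>t\<bar> \<le> b + 1 / s})"
        then show "x \<in> space (gauss_pow {..<n})" by (auto simp: space_PiM PiE_iff)
        obtain i where "i \<in> {..<n}" "max_abs {..<n} x = \<bar>x i\<bar>" using max_abs_attained ne by blast
        then have "max_abs {..<n} x \<le> b + 1 / s" using x by (auto simp: PiE_iff)
        then have "real n powr (1 / (ln (real n))\<^sup>2) * max_abs {..<n} x \<le> exp (1 / s\<^sup>2) * (b + 1 / s)"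
          using n s by (intro mult_mono) (auto simp: powr_def power2_eq_square intro!: max_abs_nonneg ne)
        moreover have "lp_norm n p x \<le> real n powr (1 / (ln (real n))\<^sup>2) * max_abs {..<n} x"
          using n p by (intro lp_norm_le_max_abs) auto
        moreover have "exp (1 / s\<^sup>2) * (b + 1 / s) \<le> (1 + 2 / s\<^sup>2) * (b + 1 / s)"
        proof (intro mult_right_mono)
          have le1: "1 / s\<^sup>2 \<le> 1" using s4 by (subst divide_le_eq_1_pos) auto
          then have "exp (1 / s\<^sup>2) \<le> 1 + 1 / s\<^sup>2 + (1 / s\<^sup>2)\<^sup>2" by (intro exp_bound) auto
          also have "(1 / s\<^sup>2)\<^sup>2 \<le> 1 / s\<^sup>2 * 1"
            unfolding power2_eq_square[of "1 / s\<^sup>2"] using le1 by (intro mult_left_mono) auto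
          finally show "exp (1 / s\<^sup>2) \<le> 1 + 2 / s\<^sup>2" by simp
        qed (use b s in auto)
        moreover have "(1 + 2 / s\<^sup>2) * (b + 1 / s) \<le> u"
        proof -
          have "1 / s \<le> s" using s s4 by (simp add: field_simps power2_eq_square)
          then have "2 / s\<^sup>2 * (b + 1 / s) \<le> 2 / s\<^sup>2 * (4 * s)" using b s by (intro mult_left_mono) auto
          also have "\<dots> = 8 / s" using s by (simp add: power2_eq_square)
          finally show ?thesis by (simp add: u_def distrib_right add_divide_distrib)
        qed
        ultimately show "lp_norm n p x \<le> u" by linarith
      qed measurable
      finally show ?thesis .
    qed
    have upper: "1 - exp (- h) \<le> P.prob {x \<in> space (gauss_pow {..<n}). v \<le> lp_norm n p x}"
    proof -
      have "1 / real n \<le> 2 * exp (b * (10 / s) + (10 / s)\<^sup>2) * prob {t. v < \<bar>t\<bar>}"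
        using gauss_tail_shift[of b "10 / s"] b s by (simp add: v_def)
      also have "\<dots> \<le> 2 * exp 130 * prob {t. v < \<bar>t\<bar>}"
      proof (intro mult_right_mono mult_left_mono)
        have "b * (10 / s) \<le> 30" using b s by (simp add: field_simps)
        moreover have "100 / s\<^sup>2 \<le> 100 / 1" using s4 by (intro divide_left_mono) auto
        then have "(10 / s)\<^sup>2 \<le> 100" by (simp add: power_divide)
        ultimately show "exp (b * (10 / s) + (10 / s)\<^sup>2) \<le> exp 130" by simp
      qed auto
      finally have "h / real n \<le> prob {t. v < \<bar>t\<bar>}"
        using n by (simp add: h_def exp_minus field_simps)
      then have "(1 - prob {t. v < \<bar>t\<bar>}) ^ n \<le> (exp (- h / real n)) ^ n"
        using exp_ge_add_one_self[of "- h / real n"] by (intro power_mono) auto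
      also have "\<dots> = exp (- h)" using n by (simp flip: exp_of_nat_mult)
      finally have "1 - exp (- h) \<le> 1 - P.prob (\<Pi>\<^sub>E i\<in>{..<n}. {t. \<bar>t\<bar> \<le> v})"
        by (simp add: measure_gauss_pow_cube)
      also have "\<dots> = P.prob (space (gauss_pow {..<n}) - (\<Pi>\<^sub>E i\<in>{..<n}. {t. \<bar>t\<bar> \<le> v}))"
        by (rule P.prob_compl[symmetric]) (auto intro!: sets_PiM_I_finite)
      also have "\<dots> \<le> P.prob {x \<in> space (gauss_pow {..<n}). v \<le> lp_norm n p x}"
      proof (intro P.finite_measure_mono subsetI CollectI conjI)
        fix x assume x: "x \<in> space (gauss_pow {..<n}) - (\<Pi>\<^sub>E i\<in>{..<n}. {t. \<bar>t\<bar> \<le> v})"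
        then show "x \<in> space (gauss_pow {..<n})" by simp
        obtain i where i: "i < n" "v < \<bar>x i\<bar>" using x by (auto simp: space_PiM PiE_iff)
        then have "v < max_abs {..<n} x" using abs_le_max_abs[of "{..<n}" i x] by simp
        then show "v \<le> lp_norm n p x" using max_abs_le_lp_norm[OF n0 p0, of x] by simp
      qed measurable
      finally show ?thesis .
    qed
    have "min (exp (- 2)) (1 - exp (- h)) * (v - u)\<^sup>2 / 4 \<le> var_lp_norm n p"
      unfolding var_lp_norm_eq
    proof (rule P.variance_ge_two_values)
      show "u < v" using s by (simp add: u_def v_def divide_strict_right_mono)
      show "integrable (gauss_pow {..<n}) (\<lambda>x. (lp_norm n p x)\<^sup>2)" by (rule lp_norm_square_integrable[OF n0 p1])
    qed (use lower upper in auto)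
    moreover have "(v - u)\<^sup>2 = 1 / s\<^sup>2" by (simp add: u_def v_def power_divide flip: diff_divide_distrib)
    ultimately show "?c / ln (real n) \<le> var_lp_norm n p" by (simp add: s(2))
  qed
qed

section \<open>Small exponents\<close>

lemma exp_minus_le_quadratic:
  fixes u :: real
  assumes "u \<ge> 0"
  shows "exp (- u) \<le> 1 - u + u\<^sup>2 / 2"
proof -
  have pos: "0 < 1 - u + u\<^sup>2 / 2"
    using zero_le_power2[of "u - 1"] by (simp add: power2_eq_square algebra_simps)
  \<comment> \<open>The product equals \<open>1 + u ^ 4 / 4\<close>.\<close>
  have "1 \<le> (1 + u + u\<^sup>2 / 2) * (1 - u + u\<^sup>2 / 2)"
    using zero_le_power2[of "u\<^sup>2"] by (simp add: power2_eq_square algebra_simps)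
  also have "\<dots> \<le> exp u * (1 - u + u\<^sup>2 / 2)"
    using exp_lower_Taylor_quadratic[OF assms] pos by (intro mult_right_mono) auto
  finally show ?thesis by (simp add: exp_minus field_simps)
qed

context prob_space
begin

text \<open>For non-negative summands the Laplace transform at negative arguments is controlled by
  two moments alone, through \<open>exp (- y) \<le> 1 - y + y\<^sup>2 / 2\<close>. The lower tail is
  therefore exponentially small although powers of Gaussians have a heavy upper tail.\<close>

lemma pow_component_sum_lower_tail:
  fixes h :: "'a \<Rightarrow> real"
  assumes I: "finite I" and h[measurable]: "h \<in> borel_measurable M" and h0: "\<And>t. 0 \<le> h t"
    and h2: "integrable M (\<lambda>t. (h t)\<^sup>2)" and v: "expectation (\<lambda>t. (h t)\<^sup>2) > 0"
  shows "measure (pow I) {x \<in> space (pow I). (\<Sum>i\<in>I. h (x i)) < card I * expectation h / 2}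
    \<le> exp (- (card I * (expectation h)\<^sup>2 / (8 * expectation (\<lambda>t. (h t)\<^sup>2))))"
proof -
  interpret P: product_prob_space "\<lambda>_. M" by (rule product_prob_space_pow)
  interpret pI: prob_space "pow I" by (rule prob_space_pow)
  define \<mu> where "\<mu> = expectation h"
  define v where "v = expectation (\<lambda>t. (h t)\<^sup>2)"
  \<comment> \<open>The minimizer of the exponent \<open>- l * \<mu> / 2 + l\<^sup>2 * v / 2\<close>
    per summand.\<close>
  define l where "l = \<mu> / (2 * v)"
  have v0: "v > 0" using assms by (simp add: v_def)
  have mu0: "\<mu> \<ge> 0" unfolding \<mu>_def using h0 by simp
  have l0: "l \<ge> 0" using v0 mu0 by (simp add: l_def)
  have hi: "integrable M h" by (rule square_integrable_imp_integrable[OF h h2])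
  let ?A = "{x \<in> space (pow I). (\<Sum>i\<in>I. h (x i)) < card I * \<mu> / 2}"
  have [measurable]: "?A \<in> sets (pow I)" by measurable
  have one: "(\<integral>\<^sup>+t. ennreal (exp (- (l * h t))) \<partial>M) \<le> ennreal (exp (- l * \<mu> + l\<^sup>2 * v / 2))"
  proof -
    have "(\<integral>\<^sup>+t. ennreal (exp (- (l * h t))) \<partial>M) \<le> (\<integral>\<^sup>+t. ennreal (1 - l * h t + (l\<^sup>2 / 2) * (h t)\<^sup>2) \<partial>M)"
      using exp_minus_le_quadratic[of "l * h _"] l0 h0
      by (intro nn_integral_mono ennreal_leI) (simp add: power_mult_distrib)
    also have "\<dots> = ennreal (\<integral>t. 1 - l * h t + (l\<^sup>2 / 2) * (h t)\<^sup>2 \<partial>M)"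
    proof (rule nn_integral_eq_integral)
      show "AE t in M. 0 \<le> 1 - l * h t + (l\<^sup>2 / 2) * (h t)\<^sup>2"
      proof (rule AE_I2)
        fix t show "0 \<le> 1 - l * h t + (l\<^sup>2 / 2) * (h t)\<^sup>2"
          using order_trans[OF exp_ge_zero exp_minus_le_quadratic[of "l * h t"]] l0 h0
          by (simp add: power_mult_distrib)
      qed
    qed (use hi h2 in simp)
    also have "(\<integral>t. 1 - l * h t + (l\<^sup>2 / 2) * (h t)\<^sup>2 \<partial>M) = 1 - l * \<mu> + l\<^sup>2 * v / 2"
      using hi h2 by (simp add: \<mu>_def v_def prob_space)
    also have "ennreal \<dots> \<le> ennreal (exp (- l * \<mu> + l\<^sup>2 * v / 2))"
      using exp_ge_add_one_self[of "- l * \<mu> + l\<^sup>2 * v / 2"] by (intro ennreal_leI) linarith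
    finally show ?thesis .
  qed
  have "emeasure (pow I) ?A = (\<integral>\<^sup>+x. indicator ?A x \<partial>pow I)" by simp
  also have "\<dots> \<le> (\<integral>\<^sup>+x. ennreal (exp (l * (card I * \<mu> / 2))) * (\<Prod>i\<in>I. ennreal (exp (- (l * h (x i))))) \<partial>pow I)"
  proof (intro nn_integral_mono)
    fix x
    have "(\<Prod>i\<in>I. ennreal (exp (- (l * h (x i))))) = ennreal (exp (- l * (\<Sum>i\<in>I. h (x i))))"
      using I by (simp add: prod_ennreal exp_sum sum_distrib_left sum_negf flip: exp_sum)
    moreover have "1 \<le> exp (l * (card I * \<mu> / 2)) * exp (- l * (\<Sum>i\<in>I. h (x i)))" if "x \<in> ?A"
    proof -
      have "l * (\<Sum>i\<in>I. h (x i)) \<le> l * (card I * \<mu> / 2)" using that l0 by (intro mult_left_mono) auto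
      then show ?thesis by (simp flip: exp_add)
    qed
    ultimately show "indicator ?A x \<le> ennreal (exp (l * (card I * \<mu> / 2))) * (\<Prod>i\<in>I. ennreal (exp (- (l * h (x i)))))"
      by (auto simp: indicator_def simp flip: ennreal_mult ennreal_1 simp del: mult_minus_left)
  qed
  also have "\<dots> = ennreal (exp (l * (card I * \<mu> / 2))) * (\<integral>\<^sup>+x. (\<Prod>i\<in>I. ennreal (exp (- (l * h (x i))))) \<partial>pow I)"
    by (rule nn_integral_cmult) (auto intro!: borel_measurable_prod_ennreal)
  also have "(\<integral>\<^sup>+x. (\<Prod>i\<in>I. ennreal (exp (- (l * h (x i))))) \<partial>pow I) = (\<Prod>i\<in>I. \<integral>\<^sup>+t. ennreal (exp (- (l * h t))) \<partial>M)"
    by (rule P.product_nn_integral_prod) (auto simp: I)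
  also have "\<dots> \<le> (\<Prod>i\<in>I. ennreal (exp (- l * \<mu> + l\<^sup>2 * v / 2)))"
    using one by (intro prod_mono_ennreal) auto
  also have "\<dots> = ennreal (exp (card I * (- l * \<mu> + l\<^sup>2 * v / 2)))"
    by (simp add: ennreal_power exp_of_nat_mult)
  also have "ennreal (exp (l * (card I * \<mu> / 2))) * ennreal (exp (card I * (- l * \<mu> + l\<^sup>2 * v / 2)))
      = ennreal (exp (l * (card I * \<mu> / 2) + card I * (- l * \<mu> + l\<^sup>2 * v / 2)))"
    by (simp add: exp_add ennreal_mult)
  also have "l * (card I * \<mu> / 2) + card I * (- l * \<mu> + l\<^sup>2 * v / 2) = - (card I * \<mu>\<^sup>2 / (8 * v))"
    using v0 by (simp add: l_def power2_eq_square field_simps)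
  finally have "emeasure (pow I) ?A \<le> ennreal (exp (- (card I * \<mu>\<^sup>2 / (8 * v))))"
    by (simp add: mult_left_mono)
  then show ?thesis by (simp add: finite_measure.emeasure_eq_measure[OF prob_space.finite_measure[OF prob_space_pow]] \<mu>_def v_def)
qed

lemma variance_le_centered:
  fixes X :: "'a \<Rightarrow> real"
  assumes "X \<in> borel_measurable M" and X2: "integrable M (\<lambda>x. (X x)\<^sup>2)"
  shows "variance X \<le> expectation (\<lambda>x. (X x - m)\<^sup>2)"
proof -
  have X: "integrable M X" by (rule square_integrable_imp_integrable) fact+
  have "expectation (\<lambda>x. (X x - m)\<^sup>2) = expectation (\<lambda>x. (X x)\<^sup>2) + m\<^sup>2 - 2 * expectation X * m"
    unfolding power2_diff using X X2 by (simp add: prob_space)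
  moreover have "0 \<le> (expectation X - m)\<^sup>2" by simp
  ultimately show ?thesis unfolding variance_eq[OF X X2] by (simp add: power2_diff)
qed

lemma integrable_mult_of_squares:
  fixes F G :: "'a \<Rightarrow> real"
  assumes F: "F \<in> borel_measurable M" "integrable M (\<lambda>x. (F x)\<^sup>2)"
    and G: "G \<in> borel_measurable M" "integrable M (\<lambda>x. (G x)\<^sup>2)"
  shows "integrable M (\<lambda>x. F x * G x)"
proof (rule Bochner_Integration.integrable_bound)
  show "integrable M (\<lambda>x. (F x)\<^sup>2 + (G x)\<^sup>2)" using F G by simp
  show "(\<lambda>x. F x * G x) \<in> borel_measurable M" using F G by simp
  have "\<bar>F x * G x\<bar> \<le> (F x)\<^sup>2 + (G x)\<^sup>2" for x
  proof -
    have "2 * \<bar>F x\<bar> * \<bar>G x\<bar> \<le> (F x)\<^sup>2 + (G x)\<^sup>2"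
      using sum_squares_bound[of "\<bar>F x\<bar>" "\<bar>G x\<bar>"] by simp
    moreover have "0 \<le> \<bar>F x\<bar> * \<bar>G x\<bar>" by simp
    ultimately show ?thesis unfolding abs_mult by linarith
  qed
  then show "AE x in M. norm (F x * G x) \<le> norm ((F x)\<^sup>2 + (G x)\<^sup>2)" by (intro AE_I2) simp
qed

lemma variance_ge_covariance:
  fixes F G :: "'a \<Rightarrow> real"
  assumes F: "F \<in> borel_measurable M" "integrable M (\<lambda>x. (F x)\<^sup>2)"
    and G: "G \<in> borel_measurable M" "integrable M (\<lambda>x. (G x)\<^sup>2)"
    and G0: "expectation G = 0" and B: "expectation (\<lambda>x. (G x)\<^sup>2) \<le> B" "B > 0"
    and a: "a \<ge> 0" "a \<le> expectation (\<lambda>x. F x * G x)"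
  shows "a\<^sup>2 / B \<le> variance F"
proof -
  have Fi: "integrable M F" by (rule square_integrable_imp_integrable) fact+
  have Gi: "integrable M G" by (rule square_integrable_imp_integrable) fact+
  have FG: "integrable M (\<lambda>x. F x * G x)" by (rule integrable_mult_of_squares) fact+
  \<comment> \<open>The value that maximizes \<open>2 * l * a - l\<^sup>2 * B\<close>, the lower
    bound extracted from the square.\<close>
  define l where "l = a / B"
  define m where "m = expectation F"
  have l0: "l \<ge> 0" using a B by (simp add: l_def)
  have "0 \<le> expectation (\<lambda>x. (F x - m - l * G x)\<^sup>2)" by simp
  also have "(\<lambda>x. (F x - m - l * G x)\<^sup>2)
      = (\<lambda>x. (F x)\<^sup>2 + m\<^sup>2 + l\<^sup>2 * (G x)\<^sup>2 - 2 * m * F x - 2 * l * (F x * G x) + 2 * l * m * G x)"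
    by (rule ext) (simp add: power2_eq_square algebra_simps)
  also have "expectation \<dots> = (expectation (\<lambda>x. (F x)\<^sup>2) - m\<^sup>2) + l\<^sup>2 * expectation (\<lambda>x. (G x)\<^sup>2)
      - 2 * l * expectation (\<lambda>x. F x * G x)"
    using F G Fi Gi FG G0 by (simp add: prob_space m_def[symmetric]) (simp add: power2_eq_square)
  also have "expectation (\<lambda>x. (F x)\<^sup>2) - m\<^sup>2 = variance F"
    using variance_eq[OF Fi F(2)] by (simp add: m_def)
  finally have "0 \<le> variance F + l\<^sup>2 * expectation (\<lambda>x. (G x)\<^sup>2) - 2 * l * expectation (\<lambda>x. F x * G x)" .
  moreover have "l\<^sup>2 * expectation (\<lambda>x. (G x)\<^sup>2) \<le> l\<^sup>2 * B" using B by (intro mult_left_mono) auto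
  moreover have "2 * l * a \<le> 2 * l * expectation (\<lambda>x. F x * G x)" using a l0 by (intro mult_left_mono) auto
  ultimately have "2 * l * a - l\<^sup>2 * B \<le> variance F" by linarith
  moreover have "2 * l * a - l\<^sup>2 * B = a\<^sup>2 / B" using B by (simp add: l_def power2_eq_square field_simps)
  ultimately show ?thesis by simp
qed

end

section \<open>Small exponents: upper bound by moments\<close>

definition abs_moment :: "real \<Rightarrow> real" where
  "abs_moment q = (\<integral>t. \<bar>t\<bar> powr q \<partial>gauss)"

lemma abs_moment_ge: "q \<ge> 1 \<Longrightarrow> window_const * moment_scale q \<le> abs_moment q"
  unfolding abs_moment_def by (rule integral_gauss_powr_ge)

lemma abs_moment_le: "q > 0 \<Longrightarrow> abs_moment q \<le> 2 * moment_scale q"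
  unfolding abs_moment_def by (rule integral_gauss_powr_le)

lemma abs_moment_pos: "q \<ge> 1 \<Longrightarrow> 0 < abs_moment q"
  using abs_moment_ge[of q] mult_pos_pos[OF window_const_pos, of "moment_scale q"] moment_scale_pos[of q]
  by (smt (verit))

lemma powr_square: "(\<bar>t\<bar> powr p)\<^sup>2 = \<bar>t::real\<bar> powr (2 * p)"
  by (simp add: power2_eq_square flip: powr_add)

lemma integrable_gauss_powr_square: "p \<ge> 1 \<Longrightarrow> integrable gauss (\<lambda>t. (\<bar>t\<bar> powr p)\<^sup>2)"
  unfolding powr_square by (rule integrable_gauss_powr) simp

text \<open>Away from zero the root has Lipschitz constant of order \<open>1 / p\<close>; squared,
  this is the gain \<open>1 / p\<^sup>2\<close> in the variance. The restriction
  \<open>1 / 2 \<le> t\<close> marks where the lower tail has to be treated separately.\<close>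

lemma root_deviation_le:
  fixes t :: real
  assumes t: "1 / 2 \<le> t" and p: "p \<ge> 1"
  shows "\<bar>t powr (1 / p) - 1\<bar> \<le> 2 / p * \<bar>t - 1\<bar>"
proof -
  have "t powr (1 / p) - 1 powr (1 / p) \<le> 1 / p * 1 powr (1 / p) * ((t - 1) / 1)"
    using t p by (intro powr_diff_le) auto
  then have 1: "t powr (1 / p) - 1 \<le> (t - 1) / p" by simp
  have "1 powr (1 / p) - t powr (1 / p) \<le> 1 / p * t powr (1 / p) * ((1 - t) / t)"
    using t p by (intro powr_diff_le) auto
  then have 2: "1 - t powr (1 / p) \<le> 1 / p * (t powr (1 / p) * ((1 - t) / t))" by simp
  show ?thesis
  proof (cases "t \<ge> 1")
    case True
    have "1 \<le> t powr (1 / p)" using True p by (intro ge_one_powr_ge_zero) auto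
    moreover have "(t - 1) / p \<le> 2 / p * (t - 1)" using True p by (simp add: field_simps)
    ultimately show ?thesis using 1 True by simp
  next
    case False
    have a: "t powr (1 / p) \<le> 1" using False t p by (intro powr_le1) auto
    have "1 / p * (t powr (1 / p) * ((1 - t) / t)) \<le> 1 / p * (1 * (2 * (1 - t)))"
    proof (intro mult_left_mono mult_mono)
      have "(1 - t) * 1 \<le> (1 - t) * (2 * t)" using False t by (intro mult_left_mono) auto
      then show "(1 - t) / t \<le> 2 * (1 - t)" using t by (simp add: field_simps)
    qed (use a t p False in auto)
    then show ?thesis using 2 a False by simp
  qed
qed

text \<open>The variance is bounded by the second moment around \<open>m\<close>, the root of the
  mean power sum, instead of the mean of the norm. The 16 combines \<open>(2 / p)\<^sup>2\<close>
  from the Lipschitz bound with the 4 of \<open>variance_pow_sum_le\<close>.\<close>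

lemma var_lp_norm_le_moments:
  assumes n: "n > 0" and p: "p \<ge> 1"
  defines "\<sigma> \<equiv> abs_moment p" and "v \<equiv> abs_moment (2 * p)"
  shows "var_lp_norm n (ereal p) \<le> (n * \<sigma>) powr (2 / p)
    * (16 / p\<^sup>2 * (v / (n * \<sigma>\<^sup>2)) + exp (- (n * \<sigma>\<^sup>2 / (8 * v))))"
proof -
  interpret prob_space gauss by (rule prob_space_gauss)
  interpret P: prob_space "gauss_pow {..<n}" by (rule prob_space_pow)
  define A where "A = n * \<sigma>"
  define m where "m = A powr (1 / p)"
  define S where "S = pow_sum {..<n} p"
  have s0: "\<sigma> > 0" and v0: "v > 0" using p by (auto simp: \<sigma>_def v_def intro: abs_moment_pos)
  have A0: "A > 0" using n s0 by (simp add: A_def)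
  have Sdef: "S x = (\<Sum>i<n. \<bar>x i\<bar> powr p)" for x by (simp add: S_def pow_sum_def)
  have S0: "0 \<le> S x" for x by (simp add: S_def pow_sum_nonneg)
  have p1: "1 \<le> ereal p" using p by (simp add: one_ereal_def)
  note [measurable] = measurable_lp_norm[OF n p1]
  have [measurable]: "S \<in> borel_measurable (gauss_pow {..<n})" unfolding S_def by (rule measurable_pow_sum) simp
  have g2: "integrable gauss (\<lambda>t. (\<bar>t\<bar> powr p)\<^sup>2)" by (rule integrable_gauss_powr_square[OF p])
  have S2: "integrable (gauss_pow {..<n}) (\<lambda>x. (S x)\<^sup>2)"
    unfolding Sdef by (intro integrable_square_pow_sum g2) auto
  have S1: "integrable (gauss_pow {..<n}) S" by (rule P.square_integrable_imp_integrable[OF _ S2]) measurable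
  have ES: "P.expectation S = A"
  proof -
    have "integrable (gauss_pow {..<n}) (\<lambda>x. \<bar>x i\<bar> powr p)" "(\<integral>x. \<bar>x i\<bar> powr p \<partial>gauss_pow {..<n}) = \<sigma>" if "i < n" for i
      using that integrable_gauss_powr[of p] p
      by (auto simp: \<sigma>_def abs_moment_def intro: integrable_pow_component integral_pow_component)
    then show ?thesis unfolding Sdef[abs_def] A_def by (subst Bochner_Integration.integral_sum) auto
  qed
  have VS: "P.variance S \<le> 4 * n * v"
    using variance_pow_sum_le[of "{..<n}" "\<lambda>t. \<bar>t\<bar> powr p", OF _ _ g2]
    by (simp add: Sdef[abs_def] v_def abs_moment_def powr_square)
  have ind: "P.prob {x \<in> space (gauss_pow {..<n}). S x < A / 2} \<le> exp (- (n * \<sigma>\<^sup>2 / (8 * v)))"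
    using pow_component_sum_lower_tail[of "{..<n}" "\<lambda>t. \<bar>t\<bar> powr p", OF _ _ _ g2] v0
    by (simp add: Sdef A_def v_def \<sigma>_def abs_moment_def powr_square)
  \<comment> \<open>The exceptional event. There the normalized root lies between 0 and 1, so its
    squared deviation from 1 is at most 1 and only the probability of \<open>B\<close>
    counts.\<close>
  define B where "B = {x \<in> space (gauss_pow {..<n}). S x < A / 2}"
  have [measurable]: "B \<in> sets (gauss_pow {..<n})" unfolding B_def by measurable
  have indB: "integrable (gauss_pow {..<n}) (indicat_real B)"
    by (rule integrable_real_indicator) (auto simp: P.emeasure_eq_measure)
  have "var_lp_norm n (ereal p) \<le> P.expectation (\<lambda>x. (lp_norm n (ereal p) x - m)\<^sup>2)"
    unfolding var_lp_norm_eq by (rule P.variance_le_centered[OF _ lp_norm_square_integrable[OF n p1]]) measurable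
  also have "\<dots> \<le> P.expectation (\<lambda>x. m\<^sup>2 * (4 / p\<^sup>2 / A\<^sup>2 * (S x - A)\<^sup>2 + indicator B x))"
  proof (rule integral_mono)
    have N1: "integrable (gauss_pow {..<n}) (lp_norm n (ereal p))"
      by (rule P.square_integrable_imp_integrable[OF _ lp_norm_square_integrable[OF n p1]]) measurable
    show "integrable (gauss_pow {..<n}) (\<lambda>x. (lp_norm n (ereal p) x - m)\<^sup>2)"
      unfolding power2_diff using N1 lp_norm_square_integrable[OF n p1] by simp
    have "integrable (gauss_pow {..<n}) (\<lambda>x. (S x - A)\<^sup>2)" unfolding power2_diff using S1 S2 by simp
    then show "integrable (gauss_pow {..<n}) (\<lambda>x. m\<^sup>2 * (4 / p\<^sup>2 / A\<^sup>2 * (S x - A)\<^sup>2 + indicator B x))"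
      by (intro Bochner_Integration.integrable_mult_right Bochner_Integration.integrable_add indB)
    fix x assume x: "x \<in> space (gauss_pow {..<n})"
    define t where "t = S x / A"
    have St: "S x = A * t" using A0 by (simp add: t_def)
    have t0: "t \<ge> 0" using S0 A0 by (simp add: t_def)
    have N: "lp_norm n (ereal p) x = m * t powr (1 / p)"
      using A0 t0 by (simp add: lp_norm_real flip: S_def) (simp add: St m_def powr_mult)
    have "(t powr (1 / p) - 1)\<^sup>2 \<le> 4 / p\<^sup>2 * (t - 1)\<^sup>2 + indicator B x"
    proof (cases "t < 1 / 2")
      case True
      then have "x \<in> B" using A0 x by (simp add: B_def St)
      have "t powr (1 / p) \<le> 1" "0 \<le> t powr (1 / p)" using True t0 p by (auto intro: powr_le1)
      then have "(t powr (1 / p) - 1)\<^sup>2 \<le> 1" by (intro power_le_one_iff[THEN iffD2] abs_square_le_1[THEN iffD2]) auto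
      then show ?thesis using \<open>x \<in> B\<close> by (simp add: add_increasing)
    next
      case False
      then have "\<bar>t powr (1 / p) - 1\<bar>\<^sup>2 \<le> (2 / p * \<bar>t - 1\<bar>)\<^sup>2"
        using p by (intro power_mono root_deviation_le) auto
      also have "\<dots> = 4 / p\<^sup>2 * (t - 1)\<^sup>2" by (simp add: power_mult_distrib power_divide)
      finally show ?thesis by (simp add: add_increasing2)
    qed
    then have "m\<^sup>2 * (t powr (1 / p) - 1)\<^sup>2 \<le> m\<^sup>2 * (4 / p\<^sup>2 * (t - 1)\<^sup>2 + indicator B x)"
      by (rule mult_left_mono) simp
    moreover have "(lp_norm n (ereal p) x - m)\<^sup>2 = m\<^sup>2 * (t powr (1 / p) - 1)\<^sup>2"
      unfolding N by (simp add: power2_eq_square algebra_simps)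
    moreover have "(t - 1)\<^sup>2 = (S x - A)\<^sup>2 / A\<^sup>2" using A0 by (simp add: t_def diff_divide_distrib flip: power_divide)
    ultimately show "(lp_norm n (ereal p) x - m)\<^sup>2 \<le> m\<^sup>2 * (4 / p\<^sup>2 / A\<^sup>2 * (S x - A)\<^sup>2 + indicator B x)"
      by simp
  qed
  also have "\<dots> = m\<^sup>2 * (4 / p\<^sup>2 / A\<^sup>2 * P.variance S + P.prob B)"
  proof -
    have "integrable (gauss_pow {..<n}) (\<lambda>x. (S x - A)\<^sup>2)" unfolding power2_diff using S1 S2 by simp
    then show ?thesis unfolding ES using indB by simp
  qed
  also have "\<dots> \<le> m\<^sup>2 * (4 / p\<^sup>2 / A\<^sup>2 * (4 * n * v) + exp (- (n * \<sigma>\<^sup>2 / (8 * v))))"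
    using VS ind unfolding B_def by (intro mult_left_mono add_mono) auto
  also have "m\<^sup>2 = A powr (2 / p)" using A0 by (simp add: m_def powr_power)
  also have "4 / p\<^sup>2 / A\<^sup>2 * (4 * n * v) = 16 / p\<^sup>2 * (v / (n * \<sigma>\<^sup>2))"
    using n s0 p by (simp add: A_def power2_eq_square field_simps)
  finally show ?thesis by (simp add: A_def)
qed

section \<open>Small exponents: lower bound by a test function\<close>

definition center_mass :: real where
  "center_mass = measure gauss {-1..1}"

definition window_weight :: "real \<Rightarrow> real" where
  "window_weight p = (\<integral>t. \<bar>t\<bar> powr p * indicator (window (2 * p)) t \<partial>gauss)"

text \<open>The test function is concentrated where the \<^term>\<open>2 * p\<close>-th moment of a Gaussian lives; its
  negative part near the origin makes it centered.\<close>

definition test_fun :: "real \<Rightarrow> real \<Rightarrow> real" where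
  "test_fun p t = \<bar>t\<bar> powr p * indicator (window (2 * p)) t - window_weight p / center_mass * indicator {-1..1} t"

definition window_moment :: "real \<Rightarrow> real" where
  "window_moment p = (\<integral>t. \<bar>t\<bar> powr (2 * p) * indicator (window (2 * p)) t \<partial>gauss)"

lemma center_mass_pos: "0 < center_mass"
proof -
  interpret prob_space gauss by (rule prob_space_gauss)
  have "ennreal (exp (- 1 / 2) / sqrt (2 * pi)) \<le> (\<integral>\<^sup>+x. ennreal (indicator {-1..1} x) \<partial>gauss)"
  proof (rule gauss_unit_interval_ge[where a = 0])
    fix x :: real assume x: "0 \<le> x" "x \<le> 0 + 1"
    then have "x\<^sup>2 \<le> 1\<^sup>2" by (intro power_mono) auto
    then show "exp (- 1 / 2) / sqrt (2 * pi) \<le> std_normal_density x * indicator {-1..1} x"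
      using x by (simp add: std_normal_density_def divide_right_mono)
  qed auto
  also have "\<dots> = ennreal center_mass" by (simp add: ennreal_indicator center_mass_def emeasure_eq_measure)
  finally have "exp (- 1 / 2) / sqrt (2 * pi) \<le> center_mass"
    by (subst (asm) ennreal_le_iff) (auto simp: center_mass_def)
  moreover have "0 < exp (- 1 / 2) / sqrt (2 * pi)" by simp
  ultimately show ?thesis by linarith
qed

lemma window_moment_ge: "p \<ge> 1 \<Longrightarrow> window_const * moment_scale (2 * p) \<le> window_moment p"
  unfolding window_moment_def by (rule integral_window_ge) simp

lemma window_moment_pos: "p \<ge> 1 \<Longrightarrow> 0 < window_moment p"
  using window_moment_ge[of p] mult_pos_pos[OF window_const_pos, of "moment_scale (2 * p)"] moment_scale_pos[of "2 * p"]
  by (smt (verit))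

lemma window_weight_nonneg: "0 \<le> window_weight p"
  unfolding window_weight_def by (intro integral_nonneg_AE) auto

lemma window_disjoint_center:
  assumes "p \<ge> 1" "t \<in> window (2 * p)"
  shows "sqrt 2 \<le> t" "t \<notin> {-1..1}"
proof -
  have "sqrt 2 \<le> sqrt (2 * p)" using assms by simp
  also have "\<dots> \<le> t" using assms by simp
  finally show *: "sqrt 2 \<le> t" .
  have "1 < sqrt (2::real)" by simp
  then have "1 < t" using * by linarith
  then show "t \<notin> {-1..1}" by simp
qed

lemma
  assumes p: "p \<ge> 1"
  shows integrable_window: "q > 0 \<Longrightarrow> integrable gauss (\<lambda>t. \<bar>t\<bar> powr q * indicator (window (2 * p)) t)"
    and test_fun_measurable: "test_fun p \<in> borel_measurable borel"
    and test_fun_square_integrable: "integrable gauss (\<lambda>t. (test_fun p t)\<^sup>2)"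
    and test_fun_centered: "(\<integral>t. test_fun p t \<partial>gauss) = 0"
    and test_fun_square_le: "(\<integral>t. (test_fun p t)\<^sup>2 \<partial>gauss) \<le> window_moment p * (1 + 1 / center_mass)"
proof -
  interpret prob_space gauss by (rule prob_space_gauss)
  have int: "integrable gauss (\<lambda>t. \<bar>t\<bar> powr q * indicator (window (2 * p)) t)" if "q > 0" for q
    using integrable_gauss_powr[OF that] by (intro integrable_real_mult_indicator) auto
  then show "q > 0 \<Longrightarrow> integrable gauss (\<lambda>t. \<bar>t\<bar> powr q * indicator (window (2 * p)) t)" .
  have ind: "integrable gauss (indicat_real {-1..1})"
    by (rule integrable_real_indicator) (auto simp: emeasure_eq_measure)
  show [measurable]: "test_fun p \<in> borel_measurable borel" unfolding test_fun_def[abs_def] by measurable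
  define k where "k = window_weight p / center_mass"
  have sq: "(test_fun p t)\<^sup>2 = \<bar>t\<bar> powr (2 * p) * indicator (window (2 * p)) t + k\<^sup>2 * indicator {-1..1} t" for t
    using window_disjoint_center[OF p, of t]
    by (cases "t \<in> window (2 * p)") (auto simp: test_fun_def k_def powr_square power_mult_distrib indicator_def)
  show "integrable gauss (\<lambda>t. (test_fun p t)\<^sup>2)" unfolding sq using int[of "2 * p"] ind p by simp
  show "(\<integral>t. test_fun p t \<partial>gauss) = 0"
    unfolding test_fun_def using int[of p] ind p center_mass_pos
    by (simp add: window_weight_def center_mass_def)
  have "(\<integral>t. (test_fun p t)\<^sup>2 \<partial>gauss) = window_moment p + k\<^sup>2 * center_mass"
    unfolding sq using int[of "2 * p"] ind p by (simp add: window_moment_def center_mass_def)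
  also have "k\<^sup>2 * center_mass = (window_weight p)\<^sup>2 * (1 / center_mass)"
    using center_mass_pos by (simp add: k_def power2_eq_square)
  \<comment> \<open>Cauchy-Schwarz, as non-negativity of a variance. It keeps the centering part of
    the test function from dominating its second moment.\<close>
  also have "(window_weight p)\<^sup>2 \<le> window_moment p"
  proof -
    have sq': "(\<bar>t\<bar> powr p * indicator (window (2 * p)) t)\<^sup>2 = \<bar>t\<bar> powr (2 * p) * indicator (window (2 * p)) t" for t
      by (simp add: power_mult_distrib powr_square indicator_def)
    have "variance (\<lambda>t. \<bar>t\<bar> powr p * indicator (window (2 * p)) t) = window_moment p - (window_weight p)\<^sup>2"
      using int[of p] int[of "2 * p"] p by (subst variance_eq) (auto simp: sq' window_moment_def window_weight_def)
    moreover have "0 \<le> variance (\<lambda>t. \<bar>t\<bar> powr p * indicator (window (2 * p)) t)" by (rule variance_positive)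
    ultimately show ?thesis by linarith
  qed
  then have "(window_weight p)\<^sup>2 * (1 / center_mass) \<le> window_moment p * (1 / center_mass)"
    using center_mass_pos by (intro mult_right_mono) auto
  finally show "(\<integral>t. (test_fun p t)\<^sup>2 \<partial>gauss) \<le> window_moment p * (1 + 1 / center_mass)"
    by (simp add: distrib_left)
qed

text \<open>The covariance in a single coordinate, with the power sum \<open>T\<close> of the others
  frozen. Let \<open>h t\<close> be the root. Since the test function is centered,
  \<open>h 1\<close> may be subtracted; then \<open>h t - h 1\<close> and the test function never
  have opposite signs, on the window or near the origin. Hypothesis \<open>K\<close> says that a
  coordinate in the window adds at most \<open>A\<close> to the power sum, so the root still has the
  slope belonging to scale \<open>A\<close>. The factor \<open>1 - T / (2 * A)\<close> is affine in
  \<open>T\<close>, hence averaging it requires only the mean of \<open>T\<close>.\<close>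

lemma integral_root_test_fun_ge:
  assumes p: "p \<ge> 1" and T: "T \<ge> 0" and A: "A > 0" and K: "(sqrt (2 * p) + 1) powr p \<le> A"
  shows "A powr (1 / p) / (12 * p * A) * window_moment p * (1 - T / (2 * A))
      \<le> (\<integral>t. (\<bar>t\<bar> powr p + T) powr (1 / p) * test_fun p t \<partial>gauss)"
proof -
  interpret prob_space gauss by (rule prob_space_gauss)
  note [measurable] = test_fun_measurable[OF p]
  define h where "h t = (\<bar>t\<bar> powr p + T) powr (1 / p)" for t
  define d where "d = A powr (1 / p) / (12 * p * A)"
  define k where "k = window_weight p / center_mass"
  have k0: "k \<ge> 0" using window_weight_nonneg center_mass_pos by (simp add: k_def less_imp_le)
  have d0: "d > 0" using A p by (simp add: d_def)
  have [measurable]: "h \<in> borel_measurable borel" unfolding h_def[abs_def] by measurable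
  have h0: "0 \<le> h t" for t by (simp add: h_def)
  have mono: "h s \<le> h t" if "\<bar>s\<bar> \<le> \<bar>t\<bar>" for s t
    unfolding h_def using that p T by (intro powr_mono2 add_right_mono) auto
  let ?K = "sqrt (2 * p) + 1"
  have K1: "1 \<le> ?K" using p by simp
  have test_W: "test_fun p t = \<bar>t\<bar> powr p" if "t \<in> window (2 * p)" for t
    using window_disjoint_center[OF p that] that by (simp add: test_fun_def)
  have test_V: "test_fun p t = - k" "t \<notin> window (2 * p)" if "t \<in> {-1..1}" for t
  proof -
    show "t \<notin> window (2 * p)" using window_disjoint_center(2)[OF p, of t] that by blast
    then show "test_fun p t = - k" using that by (simp add: test_fun_def k_def)
  qed
  have test_0: "test_fun p t = 0" if "t \<notin> window (2 * p)" "t \<notin> {-1..1}" for t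
    using that by (simp add: test_fun_def)
  have bnd: "\<bar>h t * test_fun p t\<bar> \<le> h ?K * (?K powr p + k)" for t
  proof -
    have "\<bar>h t\<bar> * \<bar>test_fun p t\<bar> \<le> h ?K * (?K powr p + k)" if t: "t \<in> window (2 * p) \<or> t \<in> {-1..1}"
    proof (intro mult_mono)
      have "0 \<le> sqrt (2 * p)" using p by simp
      then have tK: "\<bar>t\<bar> \<le> ?K" using t unfolding atLeastAtMost_iff by linarith
      then show "\<bar>h t\<bar> \<le> h ?K" using mono[of t ?K] h0[of t] K1 by simp
      have "\<bar>t\<bar> powr p \<le> ?K powr p" using tK p by (intro powr_mono2) auto
      then show "\<bar>test_fun p t\<bar> \<le> ?K powr p + k"
        using t test_W[of t] test_V[of t] k0 by auto
    qed (use h0 in auto)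
    moreover have "0 \<le> h ?K * (?K powr p + k)" using h0 k0 by simp
    ultimately show ?thesis using test_0[of t] unfolding abs_mult by (cases "t \<in> window (2 * p) \<or> t \<in> {-1..1}") auto
  qed
  have int: "integrable gauss (\<lambda>t. h t * test_fun p t)"
    by (rule integrable_const_bound[where B = "h ?K * (?K powr p + k)"]) (use bnd in auto)
  have test_int: "integrable gauss (test_fun p)"
    by (rule square_integrable_imp_integrable[OF _ test_fun_square_integrable[OF p]]) measurable
  have pw: "d * (1 - T / (2 * A)) * (\<bar>t\<bar> powr (2 * p) * indicator (window (2 * p)) t) \<le> h t * test_fun p t - h 1 * test_fun p t" for t
  proof -
    consider (W) "t \<in> window (2 * p)" | (V) "t \<in> {-1..1}" | (none) "t \<notin> window (2 * p)" "t \<notin> {-1..1}" by blast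
    then show ?thesis
    proof cases
      case W
      define s where "s = \<bar>t\<bar> powr p"
      have t: "sqrt 2 \<le> t" using window_disjoint_center(1)[OF p W] .
      \<comment> \<open>From \<open>s \<ge> 4 / 3\<close> follows \<open>s - 1 \<ge> s / 4\<close>.
        This 4 and the 3 in \<open>X \<le> 3 * A\<close> make up the 12 in \<open>d\<close>.\<close>
      have "4 / 3 \<le> sqrt (2::real)" by (rule real_le_rsqrt) (simp add: power2_eq_square)
      then have t43: "4 / 3 \<le> t" using t by linarith
      have "t powr 1 \<le> t powr p" using t43 p by (intro powr_mono) auto
      then have s43: "4 / 3 \<le> s" using t43 by (simp add: s_def)
      have "s \<le> ?K powr p" unfolding s_def using W t43 p by (intro powr_mono2) auto
      then have sA: "s \<le> A" using K by simp
      have "h 1 \<le> h t" using t43 by (intro mono) auto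
      have "d * (1 - T / (2 * A)) * s \<le> h t - h 1"
      \<comment> \<open>For large \<open>T\<close> the affine factor is negative and monotonicity of
        the root suffices; otherwise \<open>X\<close> is at most \<open>3 * A\<close>, which bounds
        the slope from below.\<close>
      proof (cases "T > 2 * A")
        case True
        then have "1 - T / (2 * A) \<le> 0" using A by simp
        then have "d * (1 - T / (2 * A)) * s \<le> 0"
          using d0 s43 by (intro mult_nonpos_nonneg mult_nonneg_nonpos) auto
        then show ?thesis using \<open>h 1 \<le> h t\<close> by linarith
      next
        case False
        define X where "X = s + T"
        have X: "0 < X" "X \<le> 3 * A" using s43 T sA False by (auto simp: X_def)
        have "1 / p * X powr (1 / p) * ((X - (1 + T)) / X) \<le> X powr (1 / p) - (1 + T) powr (1 / p)"
          using p X T by (intro powr_diff_ge) auto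
        then have 1: "1 / p * (X powr (1 / p) / X) * (s - 1) \<le> h t - h 1"
          by (simp add: h_def s_def X_def)
        have "A powr (1 / p) / (3 * A) \<le> X powr (1 / p) / X"
        proof -
          have "3 powr (- 1) * A powr (1 / p - 1) \<le> 3 powr (1 / p - 1) * A powr (1 / p - 1)"
            using p by (intro mult_right_mono powr_mono) auto
          also have "\<dots> = (3 * A) powr (1 / p - 1)" using A by (simp add: powr_mult)
          also have "\<dots> \<le> X powr (1 / p - 1)" using X p by (intro powr_mono2') auto
          finally show ?thesis using A X by (simp add: powr_diff powr_minus field_simps)
        qed
        then have "1 / p * (A powr (1 / p) / (3 * A)) * (s / 4) \<le> 1 / p * (X powr (1 / p) / X) * (s - 1)"
          using p s43 X A by (intro mult_mono) auto
        moreover have "1 / p * (A powr (1 / p) / (3 * A)) * (s / 4) = d * s" by (simp add: d_def)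
        moreover have "d * (1 - T / (2 * A)) * s \<le> d * 1 * s"
          using d0 s43 T A by (intro mult_right_mono mult_left_mono) auto
        ultimately show ?thesis using 1 by simp
      qed
      then have "d * (1 - T / (2 * A)) * s * s \<le> (h t - h 1) * s" using s43 by (intro mult_right_mono) auto
      moreover have "s * s = \<bar>t\<bar> powr (2 * p)" by (simp add: s_def flip: power2_eq_square powr_square)
      ultimately show ?thesis using W test_W[OF W] by (simp add: s_def[symmetric] left_diff_distrib mult.assoc)
    next
      case V
      then have "h t \<le> h 1" by (intro mono) auto
      then have "0 \<le> k * (h 1 - h t)" using k0 by simp
      then show ?thesis using test_V[OF V] by (simp add: algebra_simps)
    next
      case none
      then show ?thesis using test_0[OF none] by simp
    qed
  qed
  have "(\<integral>t. d * (1 - T / (2 * A)) * (\<bar>t\<bar> powr (2 * p) * indicator (window (2 * p)) t) \<partial>gauss)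
      \<le> (\<integral>t. h t * test_fun p t - h 1 * test_fun p t \<partial>gauss)"
    using int test_int integrable_window[OF p, of "2 * p"] p by (intro integral_mono pw) auto
  also have "\<dots> = (\<integral>t. h t * test_fun p t \<partial>gauss)"
    using int test_int by (simp add: test_fun_centered[OF p])
  finally show "A powr (1 / p) / (12 * p * A) * window_moment p * (1 - T / (2 * A))
      \<le> (\<integral>t. (\<bar>t\<bar> powr p + T) powr (1 / p) * test_fun p t \<partial>gauss)"
    by (simp only: integral_mult_right_zero flip: window_moment_def h_def d_def)
      (simp only: mult_ac)
qed

text \<open>The covariance of the norm with \<open>G\<close> adds up over the coordinates to order
  \<open>n * d * Q\<close>, while the second moment of \<open>G\<close> has only order
  \<open>n * Q\<close>. The quotient therefore has order \<open>n * d\<^sup>2 * Q\<close>.\<close>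

lemma var_lp_norm_ge_moments:
  assumes n: "n > 0" and p: "p \<ge> 1" and K: "(sqrt (2 * p) + 1) powr p \<le> n * abs_moment p"
  defines "\<sigma> \<equiv> abs_moment p"
  shows "(n * \<sigma>) powr (2 / p) * window_moment p / (2304 * (1 + 1 / center_mass) * p\<^sup>2 * n * \<sigma>\<^sup>2)
    \<le> var_lp_norm n (ereal p)"
proof -
  interpret prob_space gauss by (rule prob_space_gauss)
  interpret P: prob_space "gauss_pow {..<n}" by (rule prob_space_pow)
  note [measurable] = test_fun_measurable[OF p]
  have p1: "1 \<le> ereal p" using p by (simp add: one_ereal_def)
  note [measurable] = measurable_lp_norm[OF n p1]
  have s0: "\<sigma> > 0" using p by (auto simp: \<sigma>_def intro: abs_moment_pos)
  define A where "A = n * \<sigma>"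
  have A0: "A > 0" using n s0 by (simp add: A_def)
  have KA: "(sqrt (2 * p) + 1) powr p \<le> A" using K by (simp add: A_def \<sigma>_def)
  define d where "d = A powr (1 / p) / (12 * p * A)"
  have d0: "d > 0" using A0 p by (simp add: d_def)
  define Q where "Q = window_moment p"
  have Q0: "Q > 0" unfolding Q_def by (rule window_moment_pos[OF p])
  define F where "F = lp_norm n (ereal p)"
  define G where "G x = (\<Sum>i<n. test_fun p (x i))" for x
  have [measurable]: "F \<in> borel_measurable (gauss_pow {..<n})" unfolding F_def by measurable
  have [measurable]: "G \<in> borel_measurable (gauss_pow {..<n})" unfolding G_def[abs_def] by measurable
  have F2: "integrable (gauss_pow {..<n}) (\<lambda>x. (F x)\<^sup>2)" unfolding F_def by (rule lp_norm_square_integrable[OF n p1])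
  note t2 = test_fun_square_integrable[OF p]
  have t1: "integrable gauss (test_fun p)"
    by (rule square_integrable_imp_integrable[OF _ t2]) measurable
  have G2: "integrable (gauss_pow {..<n}) (\<lambda>x. (G x)\<^sup>2)"
    unfolding G_def by (intro integrable_square_pow_sum t2) auto
  have G1: "integrable (gauss_pow {..<n}) G" by (rule P.square_integrable_imp_integrable[OF _ G2]) measurable
  have EG: "P.expectation G = 0"
    unfolding G_def[abs_def]
  proof (subst Bochner_Integration.integral_sum)
    show "integrable (gauss_pow {..<n}) (\<lambda>x. test_fun p (x i))" if "i \<in> {..<n}" for i
      using that by (rule integrable_pow_component[OF _ t1])
    show "(\<Sum>i<n. \<integral>x. test_fun p (x i) \<partial>gauss_pow {..<n}) = 0"
      using integral_pow_component[OF _ t1, of _ "{..<n}"] test_fun_centered[OF p] by (intro sum.neutral) auto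
  qed
  define B where "B = 4 * n * (Q * (1 + 1 / center_mass))"
  have cm: "0 < 1 + 1 / center_mass" using center_mass_pos by (simp add: add_pos_pos)
  have B0: "B > 0" using n Q0 cm by (simp add: B_def)
  have EG2: "P.expectation (\<lambda>x. (G x)\<^sup>2) \<le> B"
  proof -
    have "P.expectation (\<lambda>x. (G x)\<^sup>2) = P.variance G" by (simp add: EG)
    also have "\<dots> \<le> 4 * card {..<n} * expectation (\<lambda>t. (test_fun p t)\<^sup>2)"
      unfolding G_def[abs_def] by (rule variance_pow_sum_le[OF _ _ t2]) auto
    also have "\<dots> \<le> 4 * card {..<n} * (Q * (1 + 1 / center_mass))"
      unfolding Q_def by (intro mult_left_mono test_fun_square_le[OF p]) auto
    finally show ?thesis by (simp add: B_def)
  qed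
  have comp: "d * Q / 2 \<le> P.expectation (\<lambda>x. F x * test_fun p (x i))"
    and comp_int: "integrable (gauss_pow {..<n}) (\<lambda>x. F x * test_fun p (x i))" if i: "i < n" for i
  proof -
    have [measurable]: "i \<in> {..<n}" using i by simp
    have i': "i \<in> {..<n}" using i by simp
    show int: "integrable (gauss_pow {..<n}) (\<lambda>x. F x * test_fun p (x i))"
      by (rule P.integrable_mult_of_squares[OF _ F2]) (auto intro: integrable_pow_component[OF i' t2])
    define T where "T = pow_sum ({..<n} - {i}) p"
    have upd: "F (x(i := t)) = (\<bar>t\<bar> powr p + T x) powr (1 / p)" for x t
      unfolding F_def lp_norm_real T_def by (simp add: pow_sum_upd[OF _ i'])
    have m1: "integrable gauss (\<lambda>t. \<bar>t\<bar> powr p)" using p by (intro integrable_gauss_powr) auto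
    have Tc: "integrable (gauss_pow {..<n}) (\<lambda>x. \<bar>x j\<bar> powr p)" "(\<integral>x. \<bar>x j\<bar> powr p \<partial>gauss_pow {..<n}) = \<sigma>" if "j < n" for j
      using that m1 by (auto simp: \<sigma>_def abs_moment_def intro: integrable_pow_component integral_pow_component)
    have T1: "integrable (gauss_pow {..<n}) T"
      unfolding T_def pow_sum_def[abs_def] using Tc by (intro Bochner_Integration.integrable_sum) auto
    have "P.expectation T = (n - 1) * \<sigma>"
      unfolding T_def pow_sum_def[abs_def] using Tc i by (subst Bochner_Integration.integral_sum) auto
    also have "\<dots> \<le> A" unfolding A_def using s0 by (intro mult_right_mono) auto
    finally have ET: "P.expectation T \<le> A" .
    \<comment> \<open>The power sum of the other coordinates has mean at most \<open>A\<close>, so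
      the affine factor averages to at least \<open>1 / 2\<close>.\<close>
    have "d * Q / 2 \<le> d * Q * (1 - P.expectation T / (2 * A))"
    proof -
      have "P.expectation T / (2 * A) \<le> 1 / 2" using ET A0 by (simp add: field_simps)
      then have "d * Q * (1 / 2) \<le> d * Q * (1 - P.expectation T / (2 * A))"
        using d0 Q0 by (intro mult_left_mono) auto
      then show ?thesis by simp
    qed
    also have "\<dots> = P.expectation (\<lambda>x. d * Q * (1 - T x / (2 * A)))"
      using T1 by (simp add: P.prob_space)
    \<comment> \<open>Resampling coordinate \<open>i\<close> separates it from \<open>T x\<close>,
      which allows the one-coordinate estimate under the outer integral.\<close>
    also have "\<dots> \<le> P.expectation (\<lambda>x. \<integral>t. F (x(i := t)) * test_fun p ((x(i := t)) i) \<partial>gauss)"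
    proof (rule integral_mono)
      show "integrable (gauss_pow {..<n}) (\<lambda>x. d * Q * (1 - T x / (2 * A)))" using T1 by simp
      show "integrable (gauss_pow {..<n}) (\<lambda>x. \<integral>t. F (x(i := t)) * test_fun p ((x(i := t)) i) \<partial>gauss)"
        by (rule integrable_pow_upd[OF _ i' int]) simp
      show "d * Q * (1 - T x / (2 * A)) \<le> (\<integral>t. F (x(i := t)) * test_fun p ((x(i := t)) i) \<partial>gauss)" for x
        unfolding upd fun_upd_same d_def Q_def
        by (rule integral_root_test_fun_ge[OF p _ A0 KA]) (simp add: T_def pow_sum_nonneg)
    qed
    also have "\<dots> = P.expectation (\<lambda>x. F x * test_fun p (x i))"
      by (rule integral_pow_upd[OF _ i' int]) simp
    finally show "d * Q / 2 \<le> P.expectation (\<lambda>x. F x * test_fun p (x i))" .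
  qed
  have "n * (d * Q / 2) = (\<Sum>i<n. d * Q / 2)" by simp
  also have "\<dots> \<le> (\<Sum>i<n. P.expectation (\<lambda>x. F x * test_fun p (x i)))" by (intro sum_mono comp) auto
  also have "\<dots> = P.expectation (\<lambda>x. F x * G x)"
    unfolding G_def sum_distrib_left by (rule Bochner_Integration.integral_sum[symmetric]) (use comp_int in auto)
  finally have "(n * (d * Q / 2))\<^sup>2 / B \<le> P.variance F"
    using d0 Q0 by (intro P.variance_ge_covariance[OF _ F2 _ G2 EG EG2 B0]) auto
  also have "P.variance F = var_lp_norm n (ereal p)" by (simp add: var_lp_norm_eq F_def)
  \<comment> \<open>\<open>2304 = 144 * 16\<close>: the square of the 12 in \<open>d\<close>, times
    4 from halving \<open>Q\<close> and 4 from \<open>B\<close>.\<close>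
  also have "(n * (d * Q / 2))\<^sup>2 / B = A powr (2 / p) * Q / (2304 * (1 + 1 / center_mass) * p\<^sup>2 * n * \<sigma>\<^sup>2)"
  proof -
    have "(A powr (1 / p))\<^sup>2 = A powr (2 / p)" using A0 by (simp add: powr_power)
    then have "d\<^sup>2 = A powr (2 / p) / (144 * p\<^sup>2 * (n\<^sup>2 * \<sigma>\<^sup>2))"
      by (simp add: d_def power_divide power_mult_distrib A_def)
    moreover have "(n * (d * Q / 2))\<^sup>2 / B = d\<^sup>2 * (real n * Q / (16 * (1 + 1 / center_mass)))"
    proof -
      have "(n * (d * Q / 2))\<^sup>2 / (4 * n * (Q * c)) = d\<^sup>2 * (real n * Q / (16 * c))" if "c > 0" for c
        using n Q0 that by (simp add: power2_eq_square field_simps)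
      then show ?thesis unfolding B_def using cm .
    qed
    ultimately show ?thesis
      using n Q0 cm s0 p by (simp add: power2_eq_square[of "real n"])
  qed
  finally show ?thesis by (simp add: A_def Q_def)
qed


section \<open>Small exponents: both bounds in explicit form\<close>

lemma abs_moment_root_bounds:
  assumes p: "p \<ge> 1"
  defines "\<sigma> \<equiv> abs_moment p"
  shows "window_const\<^sup>2 * (p / exp 1) \<le> \<sigma> powr (2 / p)" "\<sigma> powr (2 / p) \<le> 4 * p"
proof -
  have m0: "moment_scale p > 0" using p by (intro moment_scale_pos) simp
  \<comment> \<open>The exponent stays between 0 and 2, so constants raised to it remain bounded and
    bounded away from zero uniformly in \<open>p\<close>.\<close>
  have "2 / p \<le> 2" using p by (simp add: divide_le_eq)
  then have "window_const powr 2 \<le> window_const powr (2 / p)"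
    using window_const_pos window_const_le_1 by (intro powr_mono') auto
  then have "window_const\<^sup>2 * (p / exp 1) \<le> window_const powr (2 / p) * moment_scale p powr (2 / p)"
    using p window_const_pos by (simp only: moment_scale_root powr_numeral) (intro mult_right_mono, auto)
  also have "\<dots> = (window_const * moment_scale p) powr (2 / p)"
    using window_const_pos m0 by (simp add: powr_mult)
  also have "\<dots> \<le> \<sigma> powr (2 / p)"
    unfolding \<sigma>_def using p window_const_pos m0 abs_moment_ge by (intro powr_mono2) auto
  finally show "window_const\<^sup>2 * (p / exp 1) \<le> \<sigma> powr (2 / p)" .
  have "\<sigma> powr (2 / p) \<le> (2 * moment_scale p) powr (2 / p)"
    unfolding \<sigma>_def using p abs_moment_le abs_moment_pos[of p] by (intro powr_mono2) auto
  also have "\<dots> = 2 powr (2 / p) * (p / exp 1)"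
    using p m0 by (simp add: powr_mult moment_scale_root)
  also have "\<dots> \<le> 2 powr 2 * (p / 1)"
    using p by (intro mult_mono powr_mono divide_left_mono) (auto simp: field_simps)
  finally show "\<sigma> powr (2 / p) \<le> 4 * p" by simp
qed

text \<open>This bound provides the hypothesis of \<open>var_lp_norm_ge_moments\<close> and explains
  the range of \<open>p\<close>: for \<open>p \<le> ln n / 4\<close> the factor
  \<open>exp (2 * p)\<close> is at most \<open>sqrt n\<close>, well below the \<open>n\<close> terms
  of the power sum.\<close>

lemma window_edge_le:
  assumes p: "p \<ge> 1"
  shows "(sqrt (2 * p) + 1) powr p \<le> moment_scale p * exp (2 * p)"
proof -
  have "1 \<le> sqrt (2 * p)" using p by simp
  then have "sqrt (2 * p) + 1 \<le> 2 * sqrt (2 * p)" by simp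
  also have "\<dots> = sqrt (8 * p)" using real_sqrt_mult[of 4 "2 * p"] by simp
  also have "\<dots> = (8 * p) powr (1 / 2)" using p by (simp add: powr_half_sqrt)
  finally have "(sqrt (2 * p) + 1) powr p \<le> ((8 * p) powr (1 / 2)) powr p"
    using p by (intro powr_mono2) (auto simp: add_nonneg_nonneg)
  also have "\<dots> = (8 * p) powr (p / 2)" by (simp add: powr_powr)
  also have "\<dots> \<le> (p / exp 1 * exp 4) powr (p / 2)"
  proof (intro powr_mono2)
    have "8 \<le> exp (3::real)" using exp_lower_Taylor_quadratic[of "3::real"] by simp
    then have "8 * p \<le> exp 3 * p" using p by (intro mult_right_mono) auto
    also have "exp 3 * p = p / exp 1 * exp 4" using exp_add[of "1::real" 3] by simp
    finally show "8 * p \<le> p / exp 1 * exp 4" .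
  qed (use p in auto)
  also have "\<dots> = (p / exp 1) powr (p / 2) * exp 4 powr (p / 2)" by (rule powr_mult)
  also have "\<dots> = moment_scale p * exp (2 * p)" by (simp add: moment_scale_def exp_powr_real)
  finally show ?thesis .
qed

lemma exp_minus_le_inverse_square:
  fixes y :: real
  assumes "y > 0"
  shows "exp (- y) \<le> 2 / y\<^sup>2"
proof -
  have "y\<^sup>2 / 2 \<le> exp y" using exp_lower_Taylor_quadratic[of y] assms by linarith
  then show ?thesis using assms by (simp add: exp_minus field_simps)
qed

lemma var_lp_norm_small_exponent:
  "\<exists>c>0. \<exists>C>0. \<forall>\<^sub>F n in sequentially. \<forall>p. 1 \<le> p \<and> p \<le> 1 / 4 * ln (real n) \<longrightarrow>
    c * (2 powr p / p) \<le> real n powr (1 - 2 / p) * var_lp_norm n (ereal p) \<and>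
    real n powr (1 - 2 / p) * var_lp_norm n (ereal p) \<le> C * (2 powr p / p)"
proof (intro exI conjI)
  define w where "w = window_const"
  define z where "z = 2304 * (1 + 1 / center_mass)"
  define e :: real where "e = exp 1"
  define k where "k = 2 / w\<^sup>2"
  \<comment> \<open>Two factors \<open>w\<close> come from the root of the moment of order
    \<open>p\<close>, the third from the window moment; 4 comes from
    \<open>\<sigma> \<le> 2 * m\<close>, and \<open>e\<close> from \<open>moment_scale_root\<close>.
    In \<open>?C\<close>, \<open>k * 2 powr p\<close> bounds \<open>v / \<sigma>\<^sup>2\<close>, 16
    belongs to the linearized part and \<open>256 * k\<close> to the lower tail.\<close>
  let ?c = "w ^ 3 / (4 * e * z)"
  let ?C = "4 * k * (16 + 256 * k)"
  have w0: "w > 0" unfolding w_def by (rule window_const_pos)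
  have z0: "z > 0" using center_mass_pos by (simp add: z_def add_pos_pos)
  have e0: "e > 0" by (simp add: e_def)
  have k0: "k > 0" using w0 by (simp add: k_def)
  show "?c > 0" using w0 z0 e0 by simp
  show "?C > 0" using k0 by (simp add: add_pos_pos)
  have "\<forall>\<^sub>F n in sequentially. 1 / w \<le> sqrt (real n)" by real_asymp
  then show "\<forall>\<^sub>F n in sequentially. \<forall>p. 1 \<le> p \<and> p \<le> 1 / 4 * ln (real n) \<longrightarrow>
    ?c * (2 powr p / p) \<le> real n powr (1 - 2 / p) * var_lp_norm n (ereal p) \<and>
    real n powr (1 - 2 / p) * var_lp_norm n (ereal p) \<le> ?C * (2 powr p / p)"
    using eventually_gt_at_top[of 0]
  proof (eventually_elim, intro allI impI, elim conjE)
    fix n :: nat and p :: real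
    assume wn: "1 / w \<le> sqrt (real n)" and n: "0 < n" and p: "1 \<le> p" "p \<le> 1 / 4 * ln (real n)"
    define m where "m = moment_scale p"
    define \<sigma> where "\<sigma> = abs_moment p"
    define v where "v = abs_moment (2 * p)"
    define R where "R = v / \<sigma>\<^sup>2"
    have p0: "p > 0" using p by simp
    have m0: "m > 0" using p by (simp add: m_def moment_scale_pos)
    have s0: "\<sigma> > 0" and v0: "v > 0" using p by (auto simp: \<sigma>_def v_def intro: abs_moment_pos)
    have R0: "R > 0" using s0 v0 by (simp add: R_def)
    have n1: "real n > 0" using n by simp
    have "exp (2 * p) \<le> exp (ln (real n) / 2)" using p by simp
    also have "\<dots> = sqrt (real n)" using n by (simp add: powr_half_sqrt[symmetric] powr_def)
    finally have e2p: "exp (2 * p) \<le> sqrt (real n)" .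
    have sn: "sqrt (real n) * sqrt (real n) = real n" by simp
    have lo: "w * m \<le> \<sigma>" and hi: "\<sigma> \<le> 2 * m"
      unfolding w_def m_def \<sigma>_def using p by (auto intro: abs_moment_ge abs_moment_le)
    \<comment> \<open>After normalization a single factor \<open>n\<close> is left; it cancels
      against the \<open>1 / n\<close> of the relative variance of the power sum.\<close>
    have scale: "real n powr (1 - 2 / p) * (real n * \<sigma>) powr (2 / p) = real n * \<sigma> powr (2 / p)"
      using n s0 by (simp add: powr_mult powr_diff)
    show "?c * (2 powr p / p) \<le> real n powr (1 - 2 / p) * var_lp_norm n (ereal p) \<and>
      real n powr (1 - 2 / p) * var_lp_norm n (ereal p) \<le> ?C * (2 powr p / p)"
    proof
      have "(sqrt (2 * p) + 1) powr p \<le> m * sqrt (real n)"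
        using window_edge_le[OF p(1), folded m_def] mult_left_mono[OF e2p less_imp_le[OF m0]]
        by (rule order_trans)
      \<comment> \<open>The spare factor \<open>sqrt n\<close> pays for the constant
        \<open>w\<close> lost in \<open>w * m \<le> \<sigma>\<close>.\<close>
      also have "\<dots> \<le> m * (w * real n)"
      proof (intro mult_left_mono)
        have "w * (1 / w) * sqrt (real n) \<le> w * sqrt (real n) * sqrt (real n)"
          using wn w0 by (intro mult_right_mono mult_left_mono) auto
        then show "sqrt (real n) \<le> w * real n" using w0 by (simp add: mult.assoc)
      qed (use m0 in simp)
      also have "\<dots> \<le> n * \<sigma>" using lo n by (simp add: mult.commute mult.left_commute)
      finally have "(n * \<sigma>) powr (2 / p) * window_moment p / (z * p\<^sup>2 * n * \<sigma>\<^sup>2) \<le> var_lp_norm n (ereal p)"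
        unfolding \<sigma>_def z_def by (rule var_lp_norm_ge_moments[OF n p(1)])
      then have "real n powr (1 - 2 / p) * ((n * \<sigma>) powr (2 / p) * window_moment p / (z * p\<^sup>2 * n * \<sigma>\<^sup>2))
          \<le> real n powr (1 - 2 / p) * var_lp_norm n (ereal p)" by (intro mult_left_mono) auto
      moreover have "real n powr (1 - 2 / p) * ((n * \<sigma>) powr (2 / p) * window_moment p / (z * p\<^sup>2 * n * \<sigma>\<^sup>2))
          = \<sigma> powr (2 / p) * window_moment p / (z * p\<^sup>2 * \<sigma>\<^sup>2)"
        using scale n by (simp add: times_divide_eq_right mult.assoc[symmetric])
      moreover have "?c * (2 powr p / p) \<le> \<sigma> powr (2 / p) * window_moment p / (z * p\<^sup>2 * \<sigma>\<^sup>2)"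
      proof -
        have "?c * (2 powr p / p) = (w\<^sup>2 * (p / e)) * (w * (2 powr p * m\<^sup>2)) / (z * p\<^sup>2 * (2 * m)\<^sup>2)"
          using p0 m0 z0 e0 by (simp add: power2_eq_square power3_eq_cube field_simps)
        also have "\<dots> \<le> \<sigma> powr (2 / p) * window_moment p / (z * p\<^sup>2 * \<sigma>\<^sup>2)"
        proof (intro frac_le mult_mono mult_left_mono power_mono)
          show "w\<^sup>2 * (p / e) \<le> \<sigma> powr (2 / p)" unfolding w_def e_def \<sigma>_def by (rule abs_moment_root_bounds[OF p(1)])
          show "w * (2 powr p * m\<^sup>2) \<le> window_moment p"
            using window_moment_ge[OF p(1)] moment_scale_double[OF p0] by (simp add: w_def m_def)
        qed (use hi w0 m0 s0 z0 p0 window_moment_pos[OF p(1)] in \<open>auto\<close>)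
        finally show ?thesis .
      qed
      ultimately show "?c * (2 powr p / p) \<le> real n powr (1 - 2 / p) * var_lp_norm n (ereal p)" by simp
    next
      have Rk: "R \<le> k * 2 powr p"
      proof -
        have "R \<le> (2 * (2 powr p * m\<^sup>2)) / (w * m)\<^sup>2"
          unfolding R_def
        proof (intro frac_le power_mono)
          show "v \<le> 2 * (2 powr p * m\<^sup>2)"
            using abs_moment_le[of "2 * p"] moment_scale_double[OF p0] p0 by (simp add: v_def m_def)
        qed (use lo w0 m0 v0 in auto)
        also have "\<dots> = k * 2 powr p" using w0 m0 by (simp add: k_def power_mult_distrib)
        finally show ?thesis .
      qed
      have "p\<^sup>2 * 2 powr p \<le> 2 * real n"
      proof -
        have "p\<^sup>2 / 2 \<le> exp p" using exp_lower_Taylor_quadratic[of p] p0 by linarith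
        moreover have "2 powr p \<le> exp 1 powr p"
          using exp_ge_add_one_self[of "1::real"] p0 by (intro powr_mono2) auto
        then have "2 powr p \<le> exp p" by (simp add: exp_powr_real)
        ultimately have "p\<^sup>2 / 2 * 2 powr p \<le> exp p * exp p" by (intro mult_mono) auto
        also have "\<dots> = exp (2 * p)" by (simp flip: exp_add)
        also have "\<dots> \<le> real n"
        proof -
          have "1 \<le> exp (2 * p)" using p0 by simp
          then have "1 \<le> sqrt (real n)" using e2p by linarith
          then have "sqrt (real n) * 1 \<le> sqrt (real n) * sqrt (real n)" by (intro mult_left_mono) auto
          then show ?thesis using e2p by simp
        qed
        finally show ?thesis by simp
      qed
      then have "k * (p\<^sup>2 * 2 powr p) \<le> k * (2 * real n)" using k0 by (intro mult_left_mono) auto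
      moreover have "p\<^sup>2 * R \<le> p\<^sup>2 * (k * 2 powr p)" using Rk by (intro mult_left_mono) auto
      \<comment> \<open>Since \<open>p\<^sup>2 * R\<close> is at most a constant times
        \<open>n\<close>, the bound \<open>exp (- y) \<le> 2 / y\<^sup>2\<close> at
        \<open>y = n / (8 * R)\<close> brings the lower tail down to order
        \<open>R / (p\<^sup>2 * n)\<close>, the order of the linearized part.\<close>
      ultimately have pn: "p\<^sup>2 * R \<le> 2 * k * real n" by (simp add: mult_ac)
      have "exp (- (n * \<sigma>\<^sup>2 / (8 * v))) = exp (- (n / (8 * R)))"
        using s0 v0 by (simp add: R_def)
      also have "\<dots> \<le> 2 / (n / (8 * R))\<^sup>2" using n R0 by (intro exp_minus_le_inverse_square) auto
      also have "\<dots> = 128 * R / (p\<^sup>2 * (real n)\<^sup>2) * (p\<^sup>2 * R)"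
        using p0 n R0 by (simp add: power2_eq_square field_simps)
      also have "\<dots> \<le> 128 * R / (p\<^sup>2 * (real n)\<^sup>2) * (2 * k * real n)"
        using pn R0 by (intro mult_left_mono) auto
      also have "\<dots> = 256 * k * R / (p\<^sup>2 * n)" using n by (simp add: power2_eq_square mult_ac)
      finally have ex: "exp (- (n * \<sigma>\<^sup>2 / (8 * v))) \<le> 256 * k * R / (p\<^sup>2 * n)" .
      have "var_lp_norm n (ereal p) \<le> (n * \<sigma>) powr (2 / p)
          * (16 / p\<^sup>2 * (v / (n * \<sigma>\<^sup>2)) + exp (- (n * \<sigma>\<^sup>2 / (8 * v))))"
        unfolding \<sigma>_def v_def by (rule var_lp_norm_le_moments[OF n p(1)])
      also have "\<dots> \<le> (n * \<sigma>) powr (2 / p) * (16 / p\<^sup>2 * (v / (n * \<sigma>\<^sup>2)) + 256 * k * R / (p\<^sup>2 * n))"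
        by (intro mult_left_mono add_left_mono ex) auto
      also have "16 / p\<^sup>2 * (v / (n * \<sigma>\<^sup>2)) + 256 * k * R / (p\<^sup>2 * n) = (16 + 256 * k) * R / (p\<^sup>2 * n)"
        using s0 n p0 by (simp add: R_def field_simps)
      finally have "real n powr (1 - 2 / p) * var_lp_norm n (ereal p)
          \<le> real n powr (1 - 2 / p) * ((n * \<sigma>) powr (2 / p) * ((16 + 256 * k) * R / (p\<^sup>2 * n)))"
        by (intro mult_left_mono) auto
      also have "\<dots> = (real n * \<sigma> powr (2 / p)) * ((16 + 256 * k) * R / (p\<^sup>2 * n))"
        unfolding scale[symmetric] by (simp only: mult.assoc)
      also have "\<dots> = \<sigma> powr (2 / p) * ((16 + 256 * k) * R / p\<^sup>2)" using n by simp
      also have "\<dots> \<le> 4 * p * ((16 + 256 * k) * (k * 2 powr p) / p\<^sup>2)"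
        using abs_moment_root_bounds(2)[OF p(1)] Rk k0 R0 p0 unfolding \<sigma>_def
        by (intro mult_mono divide_right_mono mult_left_mono) auto
      also have "\<dots> = ?C * (2 powr p / p)" using p0 by (simp add: power2_eq_square)
      finally show "real n powr (1 - 2 / p) * var_lp_norm n (ereal p) \<le> ?C * (2 powr p / p)" .
    qed
  qed
qed

theorem theorem3p9:
  "\<exists>c\<^sub>0 c\<^sub>1 C\<^sub>1 :: real. c\<^sub>0 > 0 \<and> c\<^sub>1 > 0 \<and> C\<^sub>1 > 0 \<and>
     (\<forall>\<^sub>F n :: nat in sequentially.
        (\<forall>p :: real. 1 \<le> p \<and> p \<le> c\<^sub>0 * ln (real n) \<longrightarrow>
           c\<^sub>1 * (2 powr p / p) \<le> real n powr (1 - 2 / p) * var_lp_norm n (ereal p) \<and>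
           real n powr (1 - 2 / p) * var_lp_norm n (ereal p) \<le> C\<^sub>1 * (2 powr p / p)) \<and>
        (\<forall>p :: ereal. p > ereal (c\<^sub>0 * ln (real n)) \<longrightarrow>
           var_lp_norm n p \<le> C\<^sub>1 / ln (real n)) \<and>
        (\<forall>p :: ereal. p \<ge> ereal ((ln (real n))\<^sup>2) \<longrightarrow>
           var_lp_norm n p \<ge> c\<^sub>1 / ln (real n)))"
proof -
  obtain c C where small: "c > 0" "C > 0"
    "\<forall>\<^sub>F n in sequentially. \<forall>p. 1 \<le> p \<and> p \<le> 1 / 4 * ln (real n) \<longrightarrow>
      c * (2 powr p / p) \<le> real n powr (1 - 2 / p) * var_lp_norm n (ereal p) \<and>
      real n powr (1 - 2 / p) * var_lp_norm n (ereal p) \<le> C * (2 powr p / p)"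
    using var_lp_norm_small_exponent by blast
  obtain D where large: "D > 0"
    "\<forall>\<^sub>F n in sequentially. \<forall>p. p > ereal (1 / 4 * ln (real n)) \<longrightarrow> var_lp_norm n p \<le> D / ln (real n)"
    using var_lp_norm_large_exponent by blast
  obtain d where lower: "d > 0"
    "\<forall>\<^sub>F n in sequentially. \<forall>p. p \<ge> ereal ((ln (real n))\<^sup>2) \<longrightarrow> d / ln (real n) \<le> var_lp_norm n p"
    using var_lp_norm_ge_large_exponent by blast
  show ?thesis
  proof (intro exI conjI)
    show "(1 / 4 :: real) > 0" by simp
    show "min c d > 0" using small lower by simp
    show "max C D > 0" using small by simp
    show "\<forall>\<^sub>F n in sequentially.
        (\<forall>p. 1 \<le> p \<and> p \<le> 1 / 4 * ln (real n) \<longrightarrow>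
           min c d * (2 powr p / p) \<le> real n powr (1 - 2 / p) * var_lp_norm n (ereal p) \<and>
           real n powr (1 - 2 / p) * var_lp_norm n (ereal p) \<le> max C D * (2 powr p / p)) \<and>
        (\<forall>p. p > ereal (1 / 4 * ln (real n)) \<longrightarrow> var_lp_norm n p \<le> max C D / ln (real n)) \<and>
        (\<forall>p. p \<ge> ereal ((ln (real n))\<^sup>2) \<longrightarrow> var_lp_norm n p \<ge> min c d / ln (real n))"
      using small(3) large(2) lower(2) eventually_ge_at_top[of 1]
    proof eventually_elim
      case (elim n)
      have ln: "0 \<le> ln (real n)" using elim by simp
      have "min c d * (2 powr p / p) \<le> c * (2 powr p / p)" "C * (2 powr p / p) \<le> max C D * (2 powr p / p)"
        if "1 \<le> p" for p using that by (intro mult_right_mono, simp, simp)+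
      moreover have "D / ln (real n) \<le> max C D / ln (real n)" "min c d / ln (real n) \<le> d / ln (real n)"
        using ln by (auto intro: divide_right_mono)
      ultimately show ?case using elim by (meson order_trans)
    qed
  qed
qed

end
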